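(* Let $\mu^{1/2}$ be the uniform probability measure on $[\tfrac12,1]$. Let $(X^{\mu^{1/2},i})_{i\ge1}$ be a sequence of independent processes each of law $P^{\mu^{1/2}}$, and let $c_{1/2}=\frac{1}{\sqrt2}$. Then $$\mathcal{L}^{\mathcal{D}}\lim_{N\to\infty}\ \mathcal{L}\lim_{M\to\infty}\ c_{1/2}\,\frac{X^{\mu^{1/2},1}_{[Nt]}+\cdots+X^{\mu^{1/2},M}_{[Nt]}}{\sqrt{N\log N}\,\sqrt{M}}=B(t),$$ where $B$ is the classical Brownian motion; i.e. for each fixed $N\ge2$ the processes $\big(c_{1/2}\frac{X^{\mu^{1/2},1}_{[Nt]}+\cdots+X^{\mu^{1/2},M}_{[Nt]}}{\sqrt{N\log N}\sqrt M}\big)_{t\in[0,1]}$ converge as $M\to\infty$, in the sense of finite-dimensional distributions, to a process $Z_N$, and as $N\to\infty$ the processes $Z_N$ converge weakly, in the Skorohod topology on $D[0,1]$, to $(B(t))_{t\in[0,1]}$.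
   Context: For $p\in[0,1]$, the correlated random walk $X^p=(X^p_n)_{n\ge0}$ with persistence $p$ is the $\mathbb{Z}$-valued process such that: $X_0^p=0$, $P(X_1^p=1)=P(X_1^p=-1)=1/2$; for all $n\ge1$, $\varepsilon_n^p:=X_n^p-X_{n-1}^p$ equals $1$ or $-1$ a.s.; and for all $n\ge1$, $P(\varepsilon_{n+1}^p=\varepsilon_n^p\mid\sigma(X_k^p,0\le k\le n))=p$. Let $P^p$ be the law of $X^p$ on $\mathbb{Z}^{\mathbb{N}}$. For a probability measure $\mu$ on $[0,1]$, $P^\mu:=\int_0^1P^p\,d\mu(p)$ (annealed law: $p$ is drawn once according to $\mu$ for the whole walk). $[x]$ denotes the integer part of $x$. $D[0,1]$ is the space of cadlag functions on $[0,1]$; $\mathcal{L}$ denotes convergence of finite-dimensional distributions and $\mathcal{L}^{\mathcal{D}}$ denotes weak convergence in the Skorohod topology on $D[0,1]$. *)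

theory Defs
  imports "HOL-Probability.Probability"
begin

section \<open>Correlated random walks\<close>

definition walk_space :: "(nat \<Rightarrow> int) measure" where
  "walk_space = PiM UNIV (\<lambda>_. count_space UNIV)"

definition history :: "'a measure \<Rightarrow> (nat \<Rightarrow> 'a \<Rightarrow> int) \<Rightarrow> nat \<Rightarrow> 'a measure" where
  "history M X n = sigma (space M) (\<Union>k\<in>{..n}. {X k -` A \<inter> space M | A. A \<in> UNIV})"

definition walk_step :: "(nat \<Rightarrow> 'a \<Rightarrow> int) \<Rightarrow> nat \<Rightarrow> 'a \<Rightarrow> int" where
  "walk_step X n \<omega> = X n \<omega> - X (n - 1) \<omega>"

text \<open>All conditions are almost sure ones, so that they only depend on the law of the process and
  can be imposed on the coordinate process of \<^const>\<open>walk_space\<close>.\<close>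

definition correlated_random_walk :: "real \<Rightarrow> 'a measure \<Rightarrow> (nat \<Rightarrow> 'a \<Rightarrow> int) \<Rightarrow> bool" where
  "correlated_random_walk p M X \<longleftrightarrow>
     prob_space M \<and>
     (\<forall>n. X n \<in> M \<rightarrow>\<^sub>M count_space UNIV) \<and>
     (AE \<omega> in M. X 0 \<omega> = 0) \<and>
     measure M {\<omega> \<in> space M. X 1 \<omega> = 1} = 1 / 2 \<and>
     measure M {\<omega> \<in> space M. X 1 \<omega> = - 1} = 1 / 2 \<and>
     (\<forall>n\<ge>1. AE \<omega> in M. walk_step X n \<omega> = 1 \<or> walk_step X n \<omega> = - 1) \<and>
     (\<forall>n\<ge>1. AE \<omega> in M.
        real_cond_exp M (history M X n)
          (indicator {\<omega> \<in> space M. walk_step X (n + 1) \<omega> = walk_step X n \<omega>}) \<omega> = p)"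

text \<open>The conditions above determine the law of the walk uniquely for \<open>p\<close> in \<open>[0,1]\<close>; no such law
  exists for other \<open>p\<close>.\<close>

definition walk_law :: "real \<Rightarrow> (nat \<Rightarrow> int) measure" where
  "walk_law p = (THE P. sets P = sets walk_space \<and> correlated_random_walk p P (\<lambda>n x. x n))"

text \<open>Here \<open>\<mu>\<close> is a probability measure whose underlying space is the interval \<open>[0,1]\<close>, not the
  real line; the Giry bind is the mixture \<open>A \<mapsto> \<integral> walk_law p A d\<mu>(p)\<close>.\<close>

definition annealed_law :: "real measure \<Rightarrow> (nat \<Rightarrow> int) measure" where
  "annealed_law \<mu> = Giry_Monad.bind \<mu> walk_law"

definition \<mu>_half :: "real measure" where
  "\<mu>_half = uniform_measure (restrict_space lborel {0..1}) {1/2..1}"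


section \<open>Weak convergence and finite-dimensional distributions\<close>

definition borel_of :: "'a topology \<Rightarrow> 'a measure" where
  "borel_of T = sigma (topspace T) {U. openin T U}"

definition weakly_converges ::
    "'a topology \<Rightarrow> (nat \<Rightarrow> 'a measure) \<Rightarrow> 'a measure \<Rightarrow> bool" where
  "weakly_converges T \<mu>s \<mu> \<longleftrightarrow>
     (\<forall>f. continuous_map T euclideanreal f \<and> bounded (f ` topspace T) \<longrightarrow>
        (\<lambda>n. \<integral>x. f x \<partial>(\<mu>s n)) \<longlonglongrightarrow> (\<integral>x. f x \<partial>\<mu>))"

definition fdd ::
    "'a measure \<Rightarrow> (real \<Rightarrow> 'a \<Rightarrow> real) \<Rightarrow> real set \<Rightarrow> (real \<Rightarrow> real) measure" where
  "fdd M Y J = distr M (PiM J (\<lambda>_. borel)) (\<lambda>\<omega>. \<lambda>t\<in>J. Y t \<omega>)"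

definition fdd_converges ::
    "real set \<Rightarrow> 'a measure \<Rightarrow> (nat \<Rightarrow> real \<Rightarrow> 'a \<Rightarrow> real) \<Rightarrow>
     'b measure \<Rightarrow> (real \<Rightarrow> 'b \<Rightarrow> real) \<Rightarrow> bool" where
  "fdd_converges I M Y M' Z \<longleftrightarrow>
     (\<forall>J. finite J \<and> J \<subseteq> I \<longrightarrow>
        weakly_converges (product_topology (\<lambda>_. euclideanreal) J) (\<lambda>n. fdd M (Y n) J) (fdd M' Z J))"


section \<open>The Skorohod space on the unit interval\<close>

definition cadlag :: "(real \<Rightarrow> real) set" where
  "cadlag = {x \<in> extensional {0..1}.
     (\<forall>t\<in>{0..<1}. (x \<longlongrightarrow> x t) (at_right t)) \<and>
     (\<forall>t\<in>{0<..1}. \<exists>l. (x \<longlongrightarrow> l) (at_left t))}"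

definition time_changes :: "(real \<Rightarrow> real) set" where
  "time_changes = {\<theta>. strict_mono_on {0..1} \<theta> \<and> continuous_on {0..1} \<theta> \<and> \<theta> ` {0..1} = {0..1}}"

definition skorohod_bounds :: "(real \<Rightarrow> real) \<Rightarrow> (real \<Rightarrow> real) \<Rightarrow> real set" where
  "skorohod_bounds x y = {e. e > 0 \<and>
     (\<exists>\<theta>\<in>time_changes. \<forall>t\<in>{0..1}. \<bar>\<theta> t - t\<bar> \<le> e \<and> \<bar>x t - y (\<theta> t)\<bar> \<le> e)}"

text \<open>The value \<open>0\<close> outside the space is a dummy: \<^const>\<open>Metric_space\<close> requires
  a nonnegative symmetric function on the whole type.\<close>

definition skorohod_dist :: "(real \<Rightarrow> real) \<Rightarrow> (real \<Rightarrow> real) \<Rightarrow> real" where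
  "skorohod_dist x y = (if x \<in> cadlag \<and> y \<in> cadlag then Inf (skorohod_bounds x y) else 0)"

lemma cadlag_bounded:
  assumes "x \<in> cadlag"
  obtains K where "\<And>t. t \<in> {0..1} \<Longrightarrow> \<bar>x t\<bar> \<le> K"
proof -
  have loc: "\<exists>U K. open U \<and> t \<in> U \<and> (\<forall>s\<in>U \<inter> {0..1}. \<bar>x s\<bar> \<le> K)" if t: "t \<in> {0..1}" for t
  proof -
    have R: "\<exists>b>t. \<exists>K. \<forall>s\<in>{t<..<b}\<inter>{0..1}. \<bar>x s\<bar> \<le> K"
    proof (cases "t < 1")
      case True
      with assms t have "(x \<longlongrightarrow> x t) (at_right t)" by (auto simp: cadlag_def)
      then have "eventually (\<lambda>s. dist (x s) (x t) < 1) (at_right t)" by (rule tendstoD) simp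
      then obtain b where b: "b > t" "\<And>s. t < s \<Longrightarrow> s < b \<Longrightarrow> dist (x s) (x t) < 1"
        unfolding eventually_at_right_field by blast
      have "\<bar>x s\<bar> \<le> \<bar>x t\<bar> + 1" if "s \<in> {t<..<b}" for s
        using b(2)[of s] that by (auto simp: dist_real_def)
      with b(1) show ?thesis by blast
    next
      case False
      with t show ?thesis by (intro exI[of _ "t + 1"]) auto
    qed
    have L: "\<exists>a<t. \<exists>K. \<forall>s\<in>{a<..<t}\<inter>{0..1}. \<bar>x s\<bar> \<le> K"
    proof (cases "t > 0")
      case True
      with t have "t \<in> {0<..1}" by simp
      with assms obtain l where "(x \<longlongrightarrow> l) (at_left t)" unfolding cadlag_def by blast
      then have "eventually (\<lambda>s. dist (x s) l < 1) (at_left t)" by (rule tendstoD) simp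
      then obtain a where a: "a < t" "\<And>s. a < s \<Longrightarrow> s < t \<Longrightarrow> dist (x s) l < 1"
        unfolding eventually_at_left_field by blast
      have "\<bar>x s\<bar> \<le> \<bar>l\<bar> + 1" if "s \<in> {a<..<t}" for s
        using a(2)[of s] that by (auto simp: dist_real_def)
      with a(1) show ?thesis by blast
    next
      case False
      with t show ?thesis by (intro exI[of _ "t - 1"]) auto
    qed
    from R obtain b K1 where b: "b > t" "\<forall>s\<in>{t<..<b}\<inter>{0..1}. \<bar>x s\<bar> \<le> K1" by blast
    from L obtain a K2 where a: "a < t" "\<forall>s\<in>{a<..<t}\<inter>{0..1}. \<bar>x s\<bar> \<le> K2" by blast
    have "\<bar>x s\<bar> \<le> max \<bar>x t\<bar> (max K1 K2)" if s: "s \<in> {a<..<b} \<inter> {0..1}" for s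
    proof -
      consider "s < t" | "s = t" | "s > t" by linarith
      then show ?thesis
      proof cases
        case 1
        with s a(2) have "\<bar>x s\<bar> \<le> K2" by simp
        then show ?thesis by linarith
      next
        case 2
        then show ?thesis by simp
      next
        case 3
        with s b(2) have "\<bar>x s\<bar> \<le> K1" by simp
        then show ?thesis by linarith
      qed
    qed
    with a(1) b(1) show ?thesis
      by (intro exI[of _ "{a<..<b}"] exI[of _ "max \<bar>x t\<bar> (max K1 K2)"]) auto
  qed
  then obtain U K where UK: "\<And>t. t \<in> {0..1} \<Longrightarrow>
      open (U t) \<and> t \<in> U t \<and> (\<forall>s\<in>U t \<inter> {0..1}. \<bar>x s\<bar> \<le> K t)" by metis
  obtain F where F: "F \<subseteq> {0..1::real}" "finite F" "{0..1} \<subseteq> (\<Union>t\<in>F. U t)"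
    using compactE_image[OF compact_Icc, of "{0..1::real}" U 0 1] UK by blast
  show thesis
  proof (rule that)
    fix t :: real assume "t \<in> {0..1}"
    with F obtain s where s: "s \<in> F" "t \<in> U s" by blast
    with F UK \<open>t \<in> {0..1}\<close> have "\<bar>x t\<bar> \<le> K s" by blast
    also have "\<dots> \<le> \<bar>K s\<bar>" by simp
    also have "\<dots> \<le> (\<Sum>s\<in>F. \<bar>K s\<bar>)" using s(1) F(2) by (intro member_le_sum) auto
    finally show "\<bar>x t\<bar> \<le> (\<Sum>s\<in>F. \<bar>K s\<bar>)" .
  qed
qed

lemma skorohod_bounds_nonempty:
  assumes "x \<in> cadlag" "y \<in> cadlag"
  shows "skorohod_bounds x y \<noteq> {}"
proof -
  obtain K where K: "\<And>t. t \<in> {0..1} \<Longrightarrow> \<bar>x t\<bar> \<le> K" using cadlag_bounded[OF assms(1)] by blast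
  obtain L where L: "\<And>t. t \<in> {0..1} \<Longrightarrow> \<bar>y t\<bar> \<le> L" using cadlag_bounded[OF assms(2)] by blast
  have "(\<lambda>t. t) \<in> time_changes" by (auto simp: time_changes_def strict_mono_on_def)
  moreover have "\<bar>x t - y t\<bar> \<le> \<bar>K\<bar> + \<bar>L\<bar> + 1" if "t \<in> {0..1}" for t
    using K[OF that] L[OF that] by linarith
  ultimately have "\<bar>K\<bar> + \<bar>L\<bar> + 1 \<in> skorohod_bounds x y"
    unfolding skorohod_bounds_def by (auto intro!: bexI[of _ "\<lambda>t. t"])
  then show ?thesis by blast
qed

lemma bdd_below_skorohod_bounds: "bdd_below (skorohod_bounds x y)"
  by (rule bdd_belowI[of _ 0]) (auto simp: skorohod_bounds_def)

lemma time_change_inverse: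
  assumes "\<theta> \<in> time_changes"
  shows "inv_into {0..1} \<theta> \<in> time_changes"
proof -
  have sm: "strict_mono_on {0..1} \<theta>" and c: "continuous_on {0..1} \<theta>" and im: "\<theta> ` {0..1} = {0..1}"
    using assms by (auto simp: time_changes_def)
  have inj: "inj_on \<theta> {0..1}" using sm by (rule strict_mono_on_imp_inj_on)
  have "continuous_on (\<theta> ` {0..1}) (inv_into {0..1} \<theta>)"
    by (rule continuous_on_inv[OF c]) (auto simp: inj inv_into_f_f)
  moreover have "inv_into {0..1} \<theta> ` \<theta> ` {0..1} = {0..1}"
    by (rule inv_into_image_cancel[OF inj]) simp
  moreover have "inv_into {0..1} \<theta> s < inv_into {0..1} \<theta> t"
    if st: "s \<in> {0..1}" "t \<in> {0..1}" "s < t" for s t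
  proof (rule ccontr)
    let ?i = "inv_into {0..1} \<theta>"
    assume "\<not> ?i s < ?i t"
    then have le: "?i t \<le> ?i s" by simp
    have "?i s \<in> {0..1}" "?i t \<in> {0..1}" using st im by (metis inv_into_into)+
    with le have "\<theta> (?i t) \<le> \<theta> (?i s)"
      using strict_mono_on_leD[OF sm] by blast
    moreover have "\<theta> (?i s) = s" "\<theta> (?i t) = t" using st im by (metis f_inv_into_f)+
    ultimately show False using st(3) by simp
  qed
  ultimately show ?thesis unfolding time_changes_def by (auto simp: im strict_mono_on_def)
qed

lemma time_change_compose:
  assumes "\<theta> \<in> time_changes" "\<eta> \<in> time_changes"
  shows "(\<lambda>t. \<eta> (\<theta> t)) \<in> time_changes"
proof -
  have \<theta>: "strict_mono_on {0..1} \<theta>" "continuous_on {0..1} \<theta>" "\<theta> ` {0..1} = {0..1}"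
    and \<eta>: "strict_mono_on {0..1} \<eta>" "continuous_on {0..1} \<eta>" "\<eta> ` {0..1} = {0..1}"
    using assms by (auto simp: time_changes_def)
  have "continuous_on {0..1} (\<lambda>t. \<eta> (\<theta> t))"
    by (rule continuous_on_compose2[OF \<eta>(2) \<theta>(2)]) (simp add: \<theta>(3))
  moreover have "(\<lambda>t. \<eta> (\<theta> t)) ` {0..1} = {0..1}"
    using \<theta>(3) \<eta>(3) by (metis image_image)
  moreover have "strict_mono_on {0..1} (\<lambda>t. \<eta> (\<theta> t))"
  proof (rule strict_mono_onI)
    fix s t :: real assume st: "s \<in> {0..1}" "t \<in> {0..1}" "s < t"
    have "\<theta> s \<in> \<theta> ` {0..1}" "\<theta> t \<in> \<theta> ` {0..1}" using st by (auto intro: imageI)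
    then have "\<theta> s \<in> {0..1}" "\<theta> t \<in> {0..1}" by (simp_all only: \<theta>(3))
    moreover have "\<theta> s < \<theta> t" using strict_mono_onD[OF \<theta>(1)] st by blast
    ultimately show "\<eta> (\<theta> s) < \<eta> (\<theta> t)" using strict_mono_onD[OF \<eta>(1)] by blast
  qed
  ultimately show ?thesis by (simp add: time_changes_def)
qed

lemma time_change_1:
  assumes "\<theta> \<in> time_changes"
  shows "\<theta> 1 = 1"
proof -
  have \<theta>: "strict_mono_on {0..1} \<theta>" "\<theta> ` {0..1} = {0..1}"
    using assms by (auto simp: time_changes_def)
  have "(1::real) \<in> \<theta> ` {0..1}" using \<theta>(2) by simp
  then obtain u where u: "u \<in> {0..1}" "\<theta> u = 1" by (metis imageE)
  have "\<theta> u \<le> \<theta> 1" using strict_mono_on_leD[OF \<theta>(1), of u 1] u by simp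
  moreover have "\<theta> 1 \<in> {0..1}" using imageI[of 1 "{0..1}" \<theta>] \<theta>(2) by simp
  ultimately show ?thesis using u by simp
qed

lemma skorohod_bounds_swap: "skorohod_bounds x y \<subseteq> skorohod_bounds y x"
proof
  fix e assume "e \<in> skorohod_bounds x y"
  then obtain \<theta> where e: "e > 0" and \<theta>: "\<theta> \<in> time_changes"
    and b: "\<forall>t\<in>{0..1}. \<bar>\<theta> t - t\<bar> \<le> e \<and> \<bar>x t - y (\<theta> t)\<bar> \<le> e"
    by (auto simp: skorohod_bounds_def)
  let ?i = "inv_into {0..1} \<theta>"
  have "\<bar>?i t - t\<bar> \<le> e \<and> \<bar>y t - x (?i t)\<bar> \<le> e" if t: "t \<in> {0..1}" for t
  proof -
    have "t \<in> \<theta> ` {0..1}" using t \<theta> by (simp add: time_changes_def)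
    then have "?i t \<in> {0..1}" "\<theta> (?i t) = t" by (rule inv_into_into, rule f_inv_into_f)
    with b have "\<bar>t - ?i t\<bar> \<le> e \<and> \<bar>x (?i t) - y t\<bar> \<le> e" by metis
    then show ?thesis by (simp add: abs_minus_commute)
  qed
  with e time_change_inverse[OF \<theta>] show "e \<in> skorohod_bounds y x"
    unfolding skorohod_bounds_def by blast
qed

lemma skorohod_bounds_triangle:
  assumes "e \<in> skorohod_bounds x y" "f \<in> skorohod_bounds y z"
  shows "e + f \<in> skorohod_bounds x z"
proof -
  obtain \<theta> where e: "e > 0" and \<theta>: "\<theta> \<in> time_changes"
    and b: "\<forall>t\<in>{0..1}. \<bar>\<theta> t - t\<bar> \<le> e \<and> \<bar>x t - y (\<theta> t)\<bar> \<le> e"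
    using assms(1) by (auto simp: skorohod_bounds_def)
  obtain \<eta> where f: "f > 0" and \<eta>: "\<eta> \<in> time_changes"
    and c: "\<forall>t\<in>{0..1}. \<bar>\<eta> t - t\<bar> \<le> f \<and> \<bar>y t - z (\<eta> t)\<bar> \<le> f"
    using assms(2) by (auto simp: skorohod_bounds_def)
  have "\<bar>\<eta> (\<theta> t) - t\<bar> \<le> e + f \<and> \<bar>x t - z (\<eta> (\<theta> t))\<bar> \<le> e + f" if t: "t \<in> {0..1}" for t
  proof -
    have "\<theta> t \<in> \<theta> ` {0..1}" using t by (rule imageI)
    then have "\<theta> t \<in> {0..1}" using \<theta> by (simp add: time_changes_def)
    with c have "\<bar>\<eta> (\<theta> t) - \<theta> t\<bar> \<le> f" "\<bar>y (\<theta> t) - z (\<eta> (\<theta> t))\<bar> \<le> f" by blast+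
    moreover have "\<bar>\<theta> t - t\<bar> \<le> e" "\<bar>x t - y (\<theta> t)\<bar> \<le> e" using b t by blast+
    ultimately show ?thesis by linarith
  qed
  then have "\<exists>\<zeta>\<in>time_changes. \<forall>t\<in>{0..1}. \<bar>\<zeta> t - t\<bar> \<le> e + f \<and> \<bar>x t - z (\<zeta> t)\<bar> \<le> e + f"
    by (intro bexI[OF _ time_change_compose[OF \<theta> \<eta>]] ballI)
  with e f show ?thesis unfolding skorohod_bounds_def by simp
qed

lemma skorohod_separated:
  assumes x: "x \<in> cadlag" and y: "y \<in> cadlag" and 0: "Inf (skorohod_bounds x y) = 0"
  shows "x = y"
proof -
  have small: "\<exists>\<theta>\<in>time_changes. \<forall>t\<in>{0..1}. \<bar>\<theta> t - t\<bar> < e \<and> \<bar>x t - y (\<theta> t)\<bar> < e"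
    if e: "e > 0" for e
  proof -
    have "Inf (skorohod_bounds x y) < e" using 0 e by simp
    then obtain d where d: "d \<in> skorohod_bounds x y" "d < e"
      using cInf_lessD[OF skorohod_bounds_nonempty[OF x y]] by blast
    from d(1) obtain \<theta> where \<theta>: "\<theta> \<in> time_changes"
      "\<forall>t\<in>{0..1}. \<bar>\<theta> t - t\<bar> \<le> d \<and> \<bar>x t - y (\<theta> t)\<bar> \<le> d"
      unfolding skorohod_bounds_def by blast
    have "\<forall>t\<in>{0..1}. \<bar>\<theta> t - t\<bar> < e \<and> \<bar>x t - y (\<theta> t)\<bar> < e"
      using \<theta>(2) d(2) by (auto intro: le_less_trans)
    with \<theta>(1) show ?thesis by blast
  qed
  have close: "\<bar>x t - y t\<bar> \<le> 3 * e" if t: "t \<in> {0..1}" and e: "e > 0" for t e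
  proof (cases "t < 1")
    case True
    with t x y have "(x \<longlongrightarrow> x t) (at_right t)" "(y \<longlongrightarrow> y t) (at_right t)"
      by (auto simp: cadlag_def)
    moreover have "eventually (\<lambda>s. s < 1) (at_right t)"
      by (rule eventually_at_rightI[of t 1]) (use True in auto)
    ultimately have
      "eventually (\<lambda>s. dist (x s) (x t) < e \<and> dist (y s) (y t) < e \<and> s < 1) (at_right t)"
      using e by (intro eventually_conj tendstoD)
    then obtain b where b: "b > t"
      "\<And>s. t < s \<Longrightarrow> s < b \<Longrightarrow> dist (x s) (x t) < e \<and> dist (y s) (y t) < e \<and> s < 1"
      unfolding eventually_at_right_field by blast
    define s where "s = (t + b) / 2"
    have s: "t < s" "s < b" using b(1) by (auto simp: s_def)
    have s01: "s \<in> {0..1}" using b(2)[OF s] s t by auto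
    have "min e ((b - t) / 4) > 0" using e b(1) by simp
    from small[OF this] obtain \<theta> where
      \<theta>: "\<bar>\<theta> s - s\<bar> < min e ((b - t) / 4)" "\<bar>x s - y (\<theta> s)\<bar> < min e ((b - t) / 4)"
      using s01 by blast
    have "\<bar>\<theta> s - s\<bar> < (b - t) / 4" using \<theta>(1) by simp
    with b(1) have "t < \<theta> s" "\<theta> s < b" unfolding s_def abs_less_iff by argo+
    from b(2)[OF this] b(2)[OF s] \<theta>(2) show ?thesis
      unfolding dist_real_def by linarith
  next
    case False
    with t have "t = 1" by simp
    from small[OF e] t obtain \<theta> where "\<theta> \<in> time_changes" "\<bar>x t - y (\<theta> t)\<bar> < e" by blast
    then show ?thesis using time_change_1[of \<theta>] e \<open>t = 1\<close> by simp
  qed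
  have "x \<in> extensional {0..1}" "y \<in> extensional {0..1}" using x y by (simp_all add: cadlag_def)
  then show ?thesis
  proof (rule extensionalityI)
    fix t :: real assume t: "t \<in> {0..1}"
    have "\<bar>x t - y t\<bar> \<le> 0 + e" if "e > 0" for e
      using close[OF t, of "e / 3"] that by simp
    then have "\<bar>x t - y t\<bar> \<le> 0" by (rule field_le_epsilon)
    then show "x t = y t" by simp
  qed
qed

lemma Metric_space_skorohod: "Metric_space cadlag skorohod_dist"
proof
  show "0 \<le> skorohod_dist x y" for x y
  proof (cases "x \<in> cadlag \<and> y \<in> cadlag")
    case True
    then have "0 \<le> Inf (skorohod_bounds x y)"
      by (intro cInf_greatest skorohod_bounds_nonempty) (simp_all add: skorohod_bounds_def)
    then show ?thesis by (simp add: skorohod_dist_def)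
  next
    case False
    then show ?thesis by (auto simp: skorohod_dist_def)
  qed
  show "skorohod_dist x y = skorohod_dist y x" for x y
  proof -
    have "skorohod_bounds x y = skorohod_bounds y x" by (intro equalityI skorohod_bounds_swap)
    then show ?thesis by (simp add: skorohod_dist_def conj_commute)
  qed
  show "skorohod_dist x y = 0 \<longleftrightarrow> x = y" if x: "x \<in> cadlag" and y: "y \<in> cadlag" for x y
  proof
    assume "skorohod_dist x y = 0"
    with x y show "x = y" by (intro skorohod_separated) (auto simp: skorohod_dist_def)
  next
    assume [simp]: "x = y"
    have "(\<lambda>t. t) \<in> time_changes" by (auto simp: time_changes_def strict_mono_on_def)
    then have "e \<in> skorohod_bounds x x" if "e > 0" for e
      unfolding skorohod_bounds_def mem_Collect_eq
      by (intro conjI that bexI[of _ "\<lambda>t. t"]) (use that in auto)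
    then have "skorohod_bounds x x = {0<..}" by (auto simp: skorohod_bounds_def)
    with y show "skorohod_dist x y = 0" by (simp add: skorohod_dist_def)
  qed
  show "skorohod_dist x z \<le> skorohod_dist x y + skorohod_dist y z"
    if x: "x \<in> cadlag" and y: "y \<in> cadlag" and z: "z \<in> cadlag" for x y z
  proof -
    have le: "Inf (skorohod_bounds x z) \<le> e + f"
      if "e \<in> skorohod_bounds x y" "f \<in> skorohod_bounds y z" for e f
      by (rule cInf_lower[OF skorohod_bounds_triangle[OF that] bdd_below_skorohod_bounds])
    have "Inf (skorohod_bounds x z) - f \<le> Inf (skorohod_bounds x y)"
      if "f \<in> skorohod_bounds y z" for f
      using le that by (intro cInf_greatest skorohod_bounds_nonempty x y) (simp add: algebra_simps)
    then have "Inf (skorohod_bounds x z) - Inf (skorohod_bounds x y) \<le> Inf (skorohod_bounds y z)"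
      by (intro cInf_greatest skorohod_bounds_nonempty y z) (simp add: algebra_simps)
    with x y z show ?thesis by (simp add: skorohod_dist_def)
  qed
qed

definition skorohod_topology :: "(real \<Rightarrow> real) topology" where
  "skorohod_topology = Metric_space.mtopology cadlag skorohod_dist"

lemma topspace_skorohod_topology: "topspace skorohod_topology = cadlag"
  by (simp add: skorohod_topology_def Metric_space.topspace_mtopology[OF Metric_space_skorohod])


section \<open>Brownian motion on the unit interval\<close>

definition brownian_motion :: "'a measure \<Rightarrow> (real \<Rightarrow> 'a \<Rightarrow> real) \<Rightarrow> bool" where
  "brownian_motion M B \<longleftrightarrow>
     prob_space M \<and>
     (\<forall>t\<in>{0..1}. B t \<in> borel_measurable M) \<and>
     (AE \<omega> in M. B 0 \<omega> = 0) \<and>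
     (\<forall>\<omega>\<in>space M. continuous_on {0..1} (\<lambda>t. B t \<omega>)) \<and>
     (\<forall>s t. 0 \<le> s \<and> s < t \<and> t \<le> 1 \<longrightarrow>
        distributed M lborel (\<lambda>\<omega>. B t \<omega> - B s \<omega>) (normal_density 0 (sqrt (t - s)))) \<and>
     (\<forall>(n::nat) \<tau>. (\<forall>i\<le>n. \<tau> i \<in> {0..1}) \<and> (\<forall>i<n. \<tau> i < \<tau> (Suc i)) \<longrightarrow>
        prob_space.indep_vars M (\<lambda>_. borel) (\<lambda>i \<omega>. B (\<tau> (Suc i)) \<omega> - B (\<tau> i) \<omega>) {..<n})"

definition random_path :: "(real \<Rightarrow> 'a \<Rightarrow> real) \<Rightarrow> 'a \<Rightarrow> real \<Rightarrow> real" where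
  "random_path Y \<omega> = (\<lambda>t\<in>{0..1}. Y t \<omega>)"

definition path_law :: "'a measure \<Rightarrow> (real \<Rightarrow> 'a \<Rightarrow> real) \<Rightarrow> (real \<Rightarrow> real) measure" where
  "path_law M Y = distr M (borel_of skorohod_topology) (random_path Y)"


section \<open>The rescaled sums\<close>

definition c_half :: real where
  "c_half = 1 / sqrt 2"

definition rescaled_sum ::
    "(nat \<Rightarrow> 'a \<Rightarrow> nat \<Rightarrow> int) \<Rightarrow> nat \<Rightarrow> nat \<Rightarrow> real \<Rightarrow> 'a \<Rightarrow> real" where
  "rescaled_sum X N m t \<omega> =
     c_half * ((\<Sum>i=1..m. real_of_int (X i \<omega> (nat \<lfloor>real N * t\<rfloor>)))
       / (sqrt (real N * ln (real N)) * sqrt (real m)))"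

end

theory Submission
  imports Defs
begin

text \<open>Averaging \<open>(2 p - 1)\<^sup>k\<close> over \<open>p\<close> uniform in \<open>[1/2, 1]\<close> gives \<open>1 / (k + 1)\<close>, so the annealed steps
  are stationary with covariance \<open>1 / (|i - j| + 1)\<close>, and the annealed walk has variance
  \<open>2 (n + 1) H\<^sub>n - 3 n \<sim> 2 n ln n\<close> at time \<open>n\<close>. For fixed \<open>N\<close> the multivariate central limit theorem
  yields a Gaussian limit with the same covariance. After division by \<open>2 N ln N\<close> the
  variances of its increments converge to the lengths of the time intervals, which by polarization
  identifies the Brownian covariance; they are also bounded by a multiple of these lengths, so that
  fourth moments of increments control the oscillation over the blocks of a grid. Hence integrals of
  bounded Lipschitz functions can be compared on a fixed grid, where only finite-dimensional
  convergence is needed.\<close>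

section \<open>Multivariate continuity theorem\<close>

text \<open>Why fourth moments: over \<open>m\<close> blocks, squared oscillations of order 1/m add
  up to a constant, whereas fourth powers of order 1/m^2 add up to O(1/m). They are at hand because
  the inner limit is already Gaussian, so that the fourth moment of an increment is three times its
  squared variance; this asks for a variance bound linear in the number of steps, uniformly in N.
  Bounded continuous test functions are reached from Lipschitz ones through Lipschitz minorants,
  which bound integrals from below; the same bound for the negative function gives the other side.
  Upper bounds on the Skorohod distance come from the uniform distance, which suffices because the
  limit has continuous paths. On the side of the walk the obstacle is that its law is a definite
  description in terms of conditional expectations. Existence comes from a recursion driven by
  independent uniform variables, jointly measurable in p and these variables, so that mixing over p
  makes sense; uniqueness comes from the probabilities of finite prefixes. As only finitely many
  prefixes occur up to time N, the Gaussian limit lives on a finite product of standard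
  normals.\<close>

inductive trig_poly :: "nat \<Rightarrow> ((nat \<Rightarrow> real) \<Rightarrow> real) \<Rightarrow> bool" for d :: nat where
  cos: "trig_poly d (\<lambda>x. a * cos ((\<Sum>k<d. u k * x k) + b))"
| add: "trig_poly d f \<Longrightarrow> trig_poly d g \<Longrightarrow> trig_poly d (\<lambda>x. f x + g x)"

text \<open>Product-to-sum formula. The phase \<open>b\<close> makes the class closed under
  products, as Stone-Weierstrass requires, and it covers the sine; expectations of its members are
  determined by characteristic functions of linear forms.\<close>

lemma trig_poly_mult_cos:
  assumes "trig_poly d f"
  shows "trig_poly d (\<lambda>x. f x * (a * cos ((\<Sum>k<d. u k * x k) + b)))"
  using assms
proof induction
  case (cos a' u' b')
  have "(\<lambda>x. a' * cos ((\<Sum>k<d. u' k * x k) + b') * (a * cos ((\<Sum>k<d. u k * x k) + b)))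
     = (\<lambda>x. a' * a / 2 * cos ((\<Sum>k<d. (u' k - u k) * x k) + (b' - b))
           + a' * a / 2 * cos ((\<Sum>k<d. (u' k + u k) * x k) + (b' + b)))" (is "?l = ?r")
  proof
    fix x
    have 1: "(\<Sum>k<d. (u' k - u k) * x k) + (b' - b) =
        ((\<Sum>k<d. u' k * x k) + b') - ((\<Sum>k<d. u k * x k) + b)"
      by (simp add: algebra_simps sum_subtractf)
    have 2: "(\<Sum>k<d. (u' k + u k) * x k) + (b' + b) =
        ((\<Sum>k<d. u' k * x k) + b') + ((\<Sum>k<d. u k * x k) + b)"
      by (simp add: algebra_simps sum.distrib)
    show "?l x = ?r x"
      unfolding 1 2 cos_diff cos_add by (simp add: algebra_simps)
  qed
  then show ?case by (simp only: trig_poly.intros)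
next
  case (add f g)
  then show ?case using trig_poly.add[OF add.IH] by (simp add: distrib_right)
qed

lemma trig_poly_mult:
  assumes "trig_poly d f" "trig_poly d g"
  shows "trig_poly d (\<lambda>x. f x * g x)"
  using assms(2)
proof induction
  case (cos a u b)
  then show ?case by (rule trig_poly_mult_cos[OF assms(1)])
next
  case (add g h)
  then show ?case using trig_poly.add[OF add.IH] by (simp add: distrib_left)
qed

lemma trig_poly_const: "trig_poly d (\<lambda>x. c)"
  using trig_poly.cos[of d c "\<lambda>_. 0" 0] by simp

lemma trig_poly_sin_coord:
  assumes "j < d"
  shows "trig_poly d (\<lambda>x. sin (x j * r))"
proof -
  have "(\<lambda>x. sin (x j * r)) = (\<lambda>x. 1 * cos ((\<Sum>k<d. (if k = j then r else 0) * x k) + - (pi / 2)))"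
  proof
    fix x :: "nat \<Rightarrow> real"
    have "(\<Sum>k<d. (if k = j then r else 0) * x k) = (\<Sum>k<d. if k = j then r * x k else 0)"
      by (intro sum.cong) auto
    also have "\<dots> = x j * r" using assms by (simp add: sum.delta)
    finally show "sin (x j * r) = 1 * cos ((\<Sum>k<d. (if k = j then r else 0) * x k) + - (pi / 2))"
      by (simp add: cos_diff)
  qed
  then show ?thesis by (simp only: trig_poly.cos)
qed

text \<open>On the cube the substitution \<open>y = sin (x / \<rho>)\<close> turns the polynomials of Stone--Weierstrass
  into trigonometric ones, whose sup norm is then controlled on the whole space.\<close>

lemma trig_poly_approximation:
  fixes f :: "(nat \<Rightarrow> real) \<Rightarrow> real"
  assumes f: "continuous_on UNIV f" "\<And>x. \<bar>f x\<bar> \<le> K" and e: "e > 0" and R: "R > 0"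
  shows "\<exists>p. trig_poly d p \<and> (\<forall>x. \<bar>p x\<bar> \<le> K + e) \<and>
    (\<forall>x. (\<forall>k<d. \<bar>x k\<bar> \<le> R) \<and> (\<forall>k\<ge>d. x k = 0) \<longrightarrow> \<bar>f x - p x\<bar> \<le> e)"
proof -
  \<comment> \<open>For \<open>\<bar>x k\<bar> \<le> R\<close> the angle \<open>x k * r\<close>
    stays in [-pi/2, pi/2], where \<open>arcsin\<close> inverts \<open>sin\<close>.\<close>
  define r where "r = pi / (2 * R)"
  have r: "r > 0" using R by (simp add: r_def)
  \<comment> \<open>Coordinates from \<open>d\<close> on are pinned to 0, which makes
    \<open>S\<close> compact although sequences have infinitely many coordinates.\<close>
  define S where "S = (\<Pi>\<^sub>E k\<in>UNIV. if k < d then {-1..1::real} else {0})"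
  define s where "s x k = (if k < d then sin (x k * r) else 0)" for x and k :: nat
  define F where "F y = f (\<lambda>k. if k < d then arcsin (y k) / r else 0)" for y
  \<comment> \<open>The ring for Stone-Weierstrass: functions on \<open>S\<close> that become
    trigonometric after the substitution \<open>s\<close>.\<close>
  define A where "A = {g. continuous_on S g \<and> trig_poly d (\<lambda>x. g (s x))}"
  have sS: "s x \<in> S" for x by (auto simp: s_def S_def)
  have Sk: "y k \<in> {-1..1}" if "y \<in> S" "k < d" for y k
    using PiE_mem[OF that(1)[unfolded S_def], of k] that(2) by simp
  have S: "compact S"
    unfolding S_def compactin_euclidean_iff[symmetric] euclidean_product_topology[symmetric]
    by (subst compactin_PiE) auto
  have ring: "function_ring_on A S"
  proof
    show "compact S" by (rule S)
    show "continuous_on S g" if "g \<in> A" for g using that by (simp add: A_def)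
    show "(\<lambda>x. g x + h x) \<in> A" if "g \<in> A" "h \<in> A" for g h
      using that by (auto simp: A_def intro: continuous_intros trig_poly.add)
    show "(\<lambda>x. g x * h x) \<in> A" if "g \<in> A" "h \<in> A" for g h
      using that by (auto simp: A_def intro: continuous_intros trig_poly_mult)
    show "(\<lambda>_. c) \<in> A" for c by (simp add: A_def trig_poly_const)
    show "\<exists>f\<in>A. f x \<noteq> f y" if xy: "x \<in> S" "y \<in> S" "x \<noteq> y" for x y
    proof -
      obtain k where k: "x k \<noteq> y k" using \<open>x \<noteq> y\<close> by auto
      have kd: "k < d"
      proof (rule ccontr)
        assume "\<not> k < d"
        then have "x k = 0" "y k = 0" using PiE_mem[OF xy(1)[unfolded S_def], of k]
          PiE_mem[OF xy(2)[unfolded S_def], of k] by simp_all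
        with k show False by simp
      qed
      have "continuous_on S (\<lambda>x. x k)"
        by (rule continuous_on_subset[OF continuous_on_product_coordinates subset_UNIV])
      moreover have "trig_poly d (\<lambda>x. s x k)"
        unfolding s_def if_P[OF kd] by (rule trig_poly_sin_coord[OF kd])
      ultimately have "(\<lambda>x. x k) \<in> A" unfolding A_def mem_Collect_eq by (rule conjI)
      with k show ?thesis by (intro bexI[of _ "\<lambda>x. x k"])
    qed
  qed
  have "continuous_on S F"
    unfolding F_def
  proof (rule continuous_on_compose2[OF f(1)])
    show "continuous_on S (\<lambda>x k. if k < d then arcsin (x k) / r else 0)"
    proof (rule continuous_on_coordinatewise_then_product)
      fix k
      have "continuous_on S (\<lambda>x. arcsin (x k) / r)" if "k < d"
        using Sk[OF _ that] r
        by (intro continuous_intros continuous_on_subset[OF continuous_on_product_coordinates subset_UNIV])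
           auto
      then show "continuous_on S (\<lambda>x. if k < d then arcsin (x k) / r else 0)"
        by (cases "k < d") simp_all
    qed
  qed auto
  from function_ring_on.Stone_Weierstrass_basic[OF ring this e]
  obtain g where g: "g \<in> A" "\<And>y. y \<in> S \<Longrightarrow> \<bar>F y - g y\<bar> < e" by blast
  have "\<bar>g (s x)\<bar> \<le> K + e" for x
    using g(2)[OF sS, of x] f(2)[of "\<lambda>k. if k < d then arcsin (s x k) / r else 0"]
    unfolding F_def by linarith
  moreover have "\<bar>f x - g (s x)\<bar> \<le> e" if x: "\<forall>k<d. \<bar>x k\<bar> \<le> R" "\<forall>k\<ge>d. x k = 0" for x
  proof -
    have "arcsin (sin (x k * r)) / r = x k" if "k < d" for k
    proof -
      have "\<bar>x k * r\<bar> \<le> R * r" using x(1) that r by (simp add: abs_mult)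
      also have "R * r = pi / 2" using R by (simp add: r_def)
      finally show ?thesis using r by (subst arcsin_sin) auto
    qed
    then have "(\<lambda>k. if k < d then arcsin (s x k) / r else 0) = x"
      using x(2) by (auto simp: s_def)
    then show ?thesis using g(2)[OF sS, of x] by (simp add: F_def)
  qed
  ultimately show ?thesis using g(1) unfolding A_def by blast
qed

text \<open>Characteristic functions are evaluated at 1 here and below: the coefficients of a linear
  form absorb the frequency, in the manner of Cramer and Wold.\<close>

lemma integral_cos_distr_char:
  assumes "prob_space M" "X \<in> borel_measurable M"
  shows "(\<integral>\<omega>. cos (X \<omega> + b) \<partial>M) = Re (iexp b * char (distr M borel X) 1)"
proof -
  interpret prob_space M by fact
  note [measurable] = assms(2)
  have int: "integrable M (\<lambda>\<omega>. iexp (X \<omega>))"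
    by (intro integrable_const_bound[of _ 1]) auto
  have "iexp b * char (distr M borel X) 1 = (\<integral>\<omega>. iexp b * iexp (X \<omega>) \<partial>M)"
    unfolding char_def by (subst integral_distr) auto
  also have "Re \<dots> = (\<integral>\<omega>. Re (iexp b * iexp (X \<omega>)) \<partial>M)"
    by (intro integral_Re[symmetric] integrable_mult_right int)
  also have "\<dots> = (\<integral>\<omega>. cos (X \<omega> + b) \<partial>M)"
    by (intro Bochner_Integration.integral_cong)
       (simp_all add: Re_exp Im_exp cos_add)
  finally show ?thesis by simp
qed

lemma char_convergence_imp_trig_poly:
  assumes P: "\<And>n. prob_space (M n)" "prob_space M'"
    and [measurable]: "\<And>n k. (\<lambda>\<omega>. V n \<omega> k) \<in> borel_measurable (M n)"
      "\<And>k. (\<lambda>\<omega>. W \<omega> k) \<in> borel_measurable M'"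
    and char: "\<And>u. (\<lambda>n. char (distr (M n) borel (\<lambda>\<omega>. \<Sum>k<d. u k * V n \<omega> k)) 1)
        \<longlonglongrightarrow> char (distr M' borel (\<lambda>\<omega>. \<Sum>k<d. u k * W \<omega> k)) 1"
    and p: "trig_poly d p"
  shows "(\<lambda>n. \<integral>\<omega>. p (V n \<omega>) \<partial>M n) \<longlonglongrightarrow> (\<integral>\<omega>. p (W \<omega>) \<partial>M')"
    "\<And>n. integrable (M n) (\<lambda>\<omega>. p (V n \<omega>))" "integrable M' (\<lambda>\<omega>. p (W \<omega>))"
proof -
  have "(\<lambda>n. \<integral>\<omega>. p (V n \<omega>) \<partial>M n) \<longlonglongrightarrow> (\<integral>\<omega>. p (W \<omega>) \<partial>M') \<and>
    (\<forall>n. integrable (M n) (\<lambda>\<omega>. p (V n \<omega>))) \<and> integrable M' (\<lambda>\<omega>. p (W \<omega>))"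
    using p
  proof induction
    case (cos a u b)
    have i: "integrable N (\<lambda>\<omega>. a * cos (X \<omega> + b))"
      if "prob_space N" "X \<in> borel_measurable N" for N :: "'x measure" and X
    proof -
      interpret prob_space N by fact
      note [measurable] = that(2)
      show ?thesis by (intro integrable_mult_right integrable_const_bound[of _ 1]) auto
    qed
    have "(\<lambda>n. \<integral>\<omega>. a * cos ((\<Sum>k<d. u k * V n \<omega> k) + b) \<partial>M n)
      \<longlonglongrightarrow> (\<integral>\<omega>. a * cos ((\<Sum>k<d. u k * W \<omega> k) + b) \<partial>M')"
      unfolding integral_mult_right_zero
      by (subst integral_cos_distr_char[OF P(1)] integral_cos_distr_char[OF P(2)],
          measurable)+ (intro tendsto_intros char)
    moreover have "integrable (M n) (\<lambda>\<omega>. a * cos ((\<Sum>k<d. u k * V n \<omega> k) + b))" for n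
      by (rule i[OF P(1)]) measurable
    moreover have "integrable M' (\<lambda>\<omega>. a * cos ((\<Sum>k<d. u k * W \<omega> k) + b))"
      by (rule i[OF P(2)]) measurable
    ultimately show ?case by blast
  next
    case (add f g)
    then show ?case by (auto intro: tendsto_add)
  qed
  then show "(\<lambda>n. \<integral>\<omega>. p (V n \<omega>) \<partial>M n) \<longlonglongrightarrow> (\<integral>\<omega>. p (W \<omega>) \<partial>M')"
    "\<And>n. integrable (M n) (\<lambda>\<omega>. p (V n \<omega>))" "integrable M' (\<lambda>\<omega>. p (W \<omega>))" by auto
qed

lemma borel_measurable_sequence:
  assumes "\<And>k. (\<lambda>\<omega>. V \<omega> k) \<in> borel_measurable M"
  shows "(V :: 'a \<Rightarrow> nat \<Rightarrow> real) \<in> M \<rightarrow>\<^sub>M borel"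
proof -
  have "(\<lambda>\<omega> k. V \<omega> k) \<in> M \<rightarrow>\<^sub>M PiM UNIV (\<lambda>_. borel)"
    by (intro measurable_PiM_single') (auto simp: assms)
  then show ?thesis by (simp add: measurable_cong_sets[OF refl sets_PiM_equal_borel])
qed

text \<open>Chebyshev's inequality in integrated form. Inside the cube the error is at most
  \<open>e\<close>; outside it some \<open>(X \<omega> k)^2 / R^2\<close> is at least 1, so the
  trivial bound \<open>2 * K + e\<close> is dominated by its product with the sum of these
  quotients.\<close>

lemma expectation_diff_le_second_moment:
  fixes f p :: "(nat \<Rightarrow> real) \<Rightarrow> real"
  assumes "prob_space N" and X[measurable]: "\<And>k. (\<lambda>\<omega>. X \<omega> k) \<in> borel_measurable N"
    and f: "continuous_on UNIV f" "\<And>x. \<bar>f x\<bar> \<le> K" and p: "integrable N (\<lambda>\<omega>. p (X \<omega>))"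
      "\<And>x. \<bar>p x\<bar> \<le> K + e"
    and close: "\<And>x. (\<forall>k<d. \<bar>x k\<bar> \<le> R) \<and> (\<forall>k\<ge>d. x k = 0) \<Longrightarrow> \<bar>f x - p x\<bar> \<le> e"
    and supp: "\<And>\<omega> k. d \<le> k \<Longrightarrow> X \<omega> k = 0"
    and mom: "\<And>k. integrable N (\<lambda>\<omega>. (X \<omega> k)\<^sup>2)" "\<And>k. (\<integral>\<omega>. (X \<omega> k)\<^sup>2 \<partial>N) \<le> C"
    and e: "e > 0" and R: "R > 0"
  shows "\<bar>(\<integral>\<omega>. f (X \<omega>) \<partial>N) - (\<integral>\<omega>. p (X \<omega>) \<partial>N)\<bar> \<le> e + (2 * K + e) * (real d * C / R\<^sup>2)"
proof -
  interpret prob_space N by fact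
  have K: "K \<ge> 0" using f(2)[of undefined] by linarith
  have [measurable]: "X \<in> N \<rightarrow>\<^sub>M borel" by (rule borel_measurable_sequence) measurable
  have [measurable]: "f \<in> borel_measurable borel" using f(1) by (rule borel_measurable_continuous_onI)
  have fi: "integrable N (\<lambda>\<omega>. f (X \<omega>))"
    by (intro integrable_const_bound[of _ K]) (auto simp: f)
  have pt: "\<bar>f (X \<omega>) - p (X \<omega>)\<bar> \<le> e + (2 * K + e) * (\<Sum>k<d. (X \<omega> k)\<^sup>2 / R\<^sup>2)" for \<omega>
  proof (cases "\<forall>k<d. \<bar>X \<omega> k\<bar> \<le> R")
    case True
    have "0 \<le> (2 * K + e) * (\<Sum>k<d. (X \<omega> k)\<^sup>2 / R\<^sup>2)"
      using K e by (intro mult_nonneg_nonneg sum_nonneg) auto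
    with close[of "X \<omega>"] True supp show ?thesis by fastforce
  next
    case False
    then obtain k where k: "k < d" "\<bar>X \<omega> k\<bar> > R" by force
    have "R\<^sup>2 \<le> (X \<omega> k)\<^sup>2" using k(2) R by (intro abs_le_square_iff[THEN iffD1]) simp
    then have "1 \<le> (X \<omega> k)\<^sup>2 / R\<^sup>2" using R by simp
    also have "\<dots> \<le> (\<Sum>k<d. (X \<omega> k)\<^sup>2 / R\<^sup>2)"
      using k(1) by (intro member_le_sum) auto
    finally have "2 * K + e \<le> (2 * K + e) * (\<Sum>k<d. (X \<omega> k)\<^sup>2 / R\<^sup>2)"
      using mult_left_mono[of 1 "\<Sum>k<d. (X \<omega> k)\<^sup>2 / R\<^sup>2" "2 * K + e"] K e by simp
    moreover have "\<bar>f (X \<omega>) - p (X \<omega>)\<bar> \<le> 2 * K + e" using f(2)[of "X \<omega>"] p(2)[of "X \<omega>"] by linarith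
    ultimately have "\<bar>f (X \<omega>) - p (X \<omega>)\<bar> \<le> (2 * K + e) * (\<Sum>k<d. (X \<omega> k)\<^sup>2 / R\<^sup>2)"
      by (rule order_trans[rotated])
    with e show ?thesis by (rule le_add_same_cancel2[THEN iffD2, OF less_imp_le, THEN order_trans[rotated]])
  qed
  have "\<bar>(\<integral>\<omega>. f (X \<omega>) \<partial>N) - (\<integral>\<omega>. p (X \<omega>) \<partial>N)\<bar> = \<bar>\<integral>\<omega>. f (X \<omega>) - p (X \<omega>) \<partial>N\<bar>"
    using fi p(1) by simp
  also have "\<dots> \<le> (\<integral>\<omega>. \<bar>f (X \<omega>) - p (X \<omega>)\<bar> \<partial>N)" by (rule integral_abs_bound)
  also have "\<dots> \<le> (\<integral>\<omega>. e + (2 * K + e) * (\<Sum>k<d. (X \<omega> k)\<^sup>2 / R\<^sup>2) \<partial>N)"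
    using fi p(1) mom(1) by (intro integral_mono pt) auto
  also have "\<dots> = e + (2 * K + e) * (\<Sum>k<d. (\<integral>\<omega>. (X \<omega> k)\<^sup>2 \<partial>N) / R\<^sup>2)"
    using mom(1) by (subst Bochner_Integration.integral_add) (auto simp: prob_space)
  also have "\<dots> \<le> e + (2 * K + e) * (\<Sum>k<d. C / R\<^sup>2)"
    using K e R by (intro add_left_mono mult_left_mono sum_mono divide_right_mono mom) auto
  finally show ?thesis by simp
qed

text \<open>The bounded second moments provide the tightness.\<close>

lemma multivariate_levy_continuity:
  fixes M :: "nat \<Rightarrow> 'a measure" and M' :: "'b measure" and f :: "(nat \<Rightarrow> real) \<Rightarrow> real"
  assumes P: "\<And>n. prob_space (M n)" "prob_space M'"
    and V: "\<And>n k. (\<lambda>\<omega>. V n \<omega> k) \<in> borel_measurable (M n)"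
      "\<And>n \<omega> k. d \<le> k \<Longrightarrow> V n \<omega> k = 0"
      "\<And>n k. integrable (M n) (\<lambda>\<omega>. (V n \<omega> k)\<^sup>2)" "\<And>n k. (\<integral>\<omega>. (V n \<omega> k)\<^sup>2 \<partial>M n) \<le> C"
    and W: "\<And>k. (\<lambda>\<omega>. W \<omega> k) \<in> borel_measurable M'"
      "\<And>\<omega> k. d \<le> k \<Longrightarrow> W \<omega> k = 0"
      "\<And>k. integrable M' (\<lambda>\<omega>. (W \<omega> k)\<^sup>2)" "\<And>k. (\<integral>\<omega>. (W \<omega> k)\<^sup>2 \<partial>M') \<le> C"
    and char: "\<And>u. (\<lambda>n. char (distr (M n) borel (\<lambda>\<omega>. \<Sum>k<d. u k * V n \<omega> k)) 1)
        \<longlonglongrightarrow> char (distr M' borel (\<lambda>\<omega>. \<Sum>k<d. u k * W \<omega> k)) 1"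
    and f: "continuous_on UNIV f" "\<And>x. \<bar>f x\<bar> \<le> K"
  shows "(\<lambda>n. \<integral>\<omega>. f (V n \<omega>) \<partial>M n) \<longlonglongrightarrow> (\<integral>\<omega>. f (W \<omega>) \<partial>M')"
proof (rule LIMSEQ_I)
  fix r :: real assume r: "r > 0"
  \<comment> \<open>Two approximation errors of \<open>2 * e\<close> each, plus \<open>e\<close> for
    the convergence of the trigonometric expectations.\<close>
  define e where "e = r / 5"
  have e: "e > 0" using r by (simp add: e_def)
  have K: "K \<ge> 0" using f(2)[of undefined] by linarith
  have C: "C \<ge> 0" using W(4)[of 0] by (rule order_trans[rotated]) simp
  define D where "D = (2 * K + e) * (real d * C)"
  have D: "D \<ge> 0" using K C e by (simp add: D_def)
  \<comment> \<open>Makes the tail term \<open>D / R^2\<close> at most \<open>e\<close>; the summand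
    1 keeps \<open>R\<close> positive when \<open>D = 0\<close>.\<close>
  define R where "R = sqrt (D / e + 1)"
  have R: "R > 0" and R2: "R\<^sup>2 = D / e + 1"
    using D e by (auto simp: R_def intro!: add_nonneg_pos)
  have RD: "(2 * K + e) * (real d * C / R\<^sup>2) \<le> e"
  proof -
    have "(2 * K + e) * (real d * C / R\<^sup>2) = D / R\<^sup>2" by (simp add: D_def)
    also have "\<dots> \<le> e"
      unfolding R2 using D e by (simp add: pos_divide_le_eq add_nonneg_pos distrib_left)
    finally show ?thesis .
  qed
  from trig_poly_approximation[OF f e R] obtain p where p: "trig_poly d p" "\<And>x. \<bar>p x\<bar> \<le> K + e"
    "\<And>x. (\<forall>k<d. \<bar>x k\<bar> \<le> R) \<and> (\<forall>k\<ge>d. x k = 0) \<Longrightarrow> \<bar>f x - p x\<bar> \<le> e" by blast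
  note T = char_convergence_imp_trig_poly[where V=V and W=W, OF P V(1) W(1) char p(1)]
  have A: "\<bar>(\<integral>\<omega>. f (V n \<omega>) \<partial>M n) - (\<integral>\<omega>. p (V n \<omega>) \<partial>M n)\<bar> \<le> 2 * e" for n
    using expectation_diff_le_second_moment[where X="V n", OF P(1) V(1) f T(2) p(2,3) V(2,3,4) e R] RD by fastforce
  have B: "\<bar>(\<integral>\<omega>. f (W \<omega>) \<partial>M') - (\<integral>\<omega>. p (W \<omega>) \<partial>M')\<bar> \<le> 2 * e"
    using expectation_diff_le_second_moment[where X="W", OF P(2) W(1) f T(3) p(2,3) W(2,3,4) e R] RD by fastforce
  from LIMSEQ_D[OF T(1) e] obtain n0 where
    n0: "\<And>n. n \<ge> n0 \<Longrightarrow> norm ((\<integral>\<omega>. p (V n \<omega>) \<partial>M n) - (\<integral>\<omega>. p (W \<omega>) \<partial>M')) < e" by blast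
  show "\<exists>no. \<forall>n\<ge>no. norm ((\<integral>\<omega>. f (V n \<omega>) \<partial>M n) - (\<integral>\<omega>. f (W \<omega>) \<partial>M')) < r"
  proof (intro exI[of _ n0] allI impI)
    fix n assume "n \<ge> n0"
    from n0[OF this] A[of n] B have "\<bar>(\<integral>\<omega>. f (V n \<omega>) \<partial>M n) - (\<integral>\<omega>. f (W \<omega>) \<partial>M')\<bar> < 5 * e"
      unfolding real_norm_def by linarith
    then show "norm ((\<integral>\<omega>. f (V n \<omega>) \<partial>M n) - (\<integral>\<omega>. f (W \<omega>) \<partial>M')) < r" by (simp add: e_def)
  qed
qed

section \<open>Linear forms in independent Gaussians\<close>

text \<open>Restriction to \<open>I\<close> is the identity on the product space, so the joint law
  of the coordinates is the product measure itself.\<close>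

lemma indep_vars_PiM_coordinates:
  assumes M: "\<And>i. i \<in> I \<Longrightarrow> prob_space (M i)" and I: "I \<noteq> {}"
  shows "prob_space.indep_vars (PiM I M) M (\<lambda>i x. x i) I"
proof -
  interpret prob_space "PiM I M" by (rule prob_space_PiM) (rule M)
  have "distr (PiM I M) (PiM I M) (\<lambda>x. \<lambda>i\<in>I. x i) = distr (PiM I M) (PiM I M) (\<lambda>x. x)"
    by (intro distr_cong) (auto simp: space_PiM PiE_def extensional_restrict)
  also have "\<dots> = PiM I (\<lambda>i. distr (PiM I M) (M i) (\<lambda>x. x i))"
    unfolding distr_id2[OF refl] by (intro PiM_cong refl distr_PiM_component[symmetric] M)
  finally show ?thesis
    by (subst indep_vars_iff_distr_eq_PiM'[OF I]) auto
qed

definition gauss_space :: "'i set \<Rightarrow> ('i \<Rightarrow> real) measure" where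
  "gauss_space I = PiM I (\<lambda>_. std_normal_distribution)"

lemma prob_space_gauss_space: "prob_space (gauss_space I)"
  unfolding gauss_space_def
  using real_dist_normal_dist by (intro prob_space_PiM) (simp add: real_distribution_def)

lemma measurable_gauss_coord:
  "i \<in> I \<Longrightarrow> (\<lambda>g. g i) \<in> borel_measurable (gauss_space I)"
  using measurable_component_singleton[of i I "\<lambda>_. std_normal_distribution"]
  by (simp add: gauss_space_def cong: measurable_cong_sets)

lemma measurable_gauss_sum:
  "J \<subseteq> I \<Longrightarrow> (\<lambda>g. \<Sum>i\<in>J. a i * g i) \<in> borel_measurable (gauss_space I)"
  by (rule borel_measurable_sum,
      rule borel_measurable_times[OF borel_measurable_const measurable_gauss_coord]) blast

lemma char_distr_scale:
  assumes "X \<in> borel_measurable M"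
  shows "char (distr M borel (\<lambda>\<omega>. c * X \<omega>)) t = char (distr M borel X) (t * c)"
proof -
  note [measurable] = assms
  have "char (distr M borel (\<lambda>\<omega>. c * X \<omega>)) t = (\<integral>\<omega>. iexp (t * (c * X \<omega>)) \<partial>M)"
    unfolding char_def by (subst integral_distr) (use assms in auto)
  also have "\<dots> = (\<integral>\<omega>. iexp (t * c * X \<omega>) \<partial>M)" by (simp only: mult.assoc)
  also have "\<dots> = char (distr M borel X) (t * c)"
    unfolding char_def by (subst integral_distr) (use assms in auto)
  finally show ?thesis .
qed

text \<open>Both laws have characteristic function exp(-t^2 s^2 / 2), where s^2 is the sum of the
  squared coefficients. A scaled standard normal, unlike a normal density, also covers s =
  0.\<close>

lemma distr_gauss_sum:
  assumes "finite I"
  shows "distr (gauss_space I) borel (\<lambda>g. \<Sum>i\<in>I. a i * g i) =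
    distr std_normal_distribution borel (\<lambda>x. sqrt (\<Sum>i\<in>I. (a i)\<^sup>2) * x)"
proof (rule Levy_uniqueness)
  interpret prob_space "gauss_space I" by (rule prob_space_gauss_space)
  interpret S: prob_space "std_normal_distribution"
    using real_dist_normal_dist by (simp add: real_distribution_def)
  let ?s = "sqrt (\<Sum>i\<in>I. (a i)\<^sup>2)"
  show "real_distribution (distr (gauss_space I) borel (\<lambda>g. \<Sum>i\<in>I. a i * g i))"
    by (rule real_distribution_distr) (rule measurable_gauss_sum, simp)
  show "real_distribution (distr std_normal_distribution borel (\<lambda>x. ?s * x))"
    by (rule S.real_distribution_distr) measurable
  have ind: "indep_vars (\<lambda>_. borel) (\<lambda>i g. a i * g i) I"
  proof (cases "I = {}")
    case True
    then show ?thesis unfolding indep_vars_def indep_sets_def by auto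
  next
    case False
    have "indep_vars (\<lambda>_. std_normal_distribution) (\<lambda>i g. g i) I"
      unfolding gauss_space_def by (intro indep_vars_PiM_coordinates False S.prob_space_axioms)
    then show ?thesis by (rule indep_vars_compose2) (simp cong: measurable_cong_sets)
  qed
  have coord: "distr (gauss_space I) borel (\<lambda>g. g i) = std_normal_distribution" if "i \<in> I" for i
  proof -
    have "distr (gauss_space I) borel (\<lambda>g. g i) = distr (gauss_space I) std_normal_distribution (\<lambda>g. g i)"
      by (intro distr_cong) auto
    also have "\<dots> = std_normal_distribution"
      unfolding gauss_space_def by (intro distr_PiM_component S.prob_space_axioms that)
    finally show ?thesis .
  qed
  show "char (distr (gauss_space I) borel (\<lambda>g. \<Sum>i\<in>I. a i * g i)) =
    char (distr std_normal_distribution borel (\<lambda>x. ?s * x))"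
  proof
    fix t
    have "char (distr (gauss_space I) borel (\<lambda>g. \<Sum>i\<in>I. a i * g i)) t =
      (\<Prod>i\<in>I. char (distr (gauss_space I) borel (\<lambda>g. a i * g i)) t)"
      by (rule char_distr_sum[OF ind])
    also have "\<dots> = (\<Prod>i\<in>I. complex_of_real (exp (- (t * a i)\<^sup>2 / 2)))"
      by (intro prod.cong refl)
         (simp add: char_distr_scale[OF measurable_gauss_coord] coord char_std_normal_distribution)
    also have "\<dots> = complex_of_real (exp (\<Sum>i\<in>I. - (t * a i)\<^sup>2 / 2))"
      using assms by (simp add: exp_sum)
    also have "(\<Sum>i\<in>I. - (t * a i)\<^sup>2 / 2) = - (t * ?s)\<^sup>2 / 2"
      by (simp add: power_mult_distrib sum_distrib_left sum_divide_distrib sum_negf sum_nonneg)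
    also have "complex_of_real (exp (- (t * ?s)\<^sup>2 / 2)) =
        char (distr std_normal_distribution borel (\<lambda>x. ?s * x)) t"
      by (simp add: char_distr_scale char_std_normal_distribution distr_id2)
    finally show "char (distr (gauss_space I) borel (\<lambda>g. \<Sum>i\<in>I. a i * g i)) t =
      char (distr std_normal_distribution borel (\<lambda>x. ?s * x)) t" .
  qed
qed

lemma char_gauss_sum:
  assumes "finite I"
  shows "char (distr (gauss_space I) borel (\<lambda>g. \<Sum>i\<in>I. a i * g i)) 1 =
    exp (- (\<Sum>i\<in>I. (a i)\<^sup>2) / 2)"
  unfolding distr_gauss_sum[OF assms]
  by (simp add: char_distr_scale char_std_normal_distribution distr_id2 sum_nonneg)

text \<open>The factor \<open>fact (2 * k) / (2 ^ k * fact k)\<close> is the double factorial (2k -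
  1)!!: it is 1 for the variance and 3 for the fourth moment.\<close>

lemma gauss_sum_even_moment:
  assumes "finite I"
  shows "integrable (gauss_space I) (\<lambda>g. (\<Sum>i\<in>I. a i * g i) ^ (2 * k))"
    "(\<integral>g. (\<Sum>i\<in>I. a i * g i) ^ (2 * k) \<partial>gauss_space I) =
      (\<Sum>i\<in>I. (a i)\<^sup>2) ^ k * (fact (2 * k) / (2 ^ k * fact k))"
proof -
  let ?s = "sqrt (\<Sum>i\<in>I. (a i)\<^sup>2)"
  have m: "(\<lambda>g. \<Sum>i\<in>I. a i * g i) \<in> borel_measurable (gauss_space I)"
    by (rule measurable_gauss_sum) simp
  have s: "?s ^ (2 * k) = (\<Sum>i\<in>I. (a i)\<^sup>2) ^ k"
    by (simp add: power_mult sum_nonneg)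
  have p: "(\<lambda>x::real. x ^ (2 * k)) \<in> borel_measurable borel" by measurable
  have "integrable (gauss_space I) (\<lambda>g. (\<Sum>i\<in>I. a i * g i) ^ (2 * k)) \<longleftrightarrow>
    integrable (distr (gauss_space I) borel (\<lambda>g. \<Sum>i\<in>I. a i * g i)) (\<lambda>x. x ^ (2 * k))"
    by (subst integrable_distr_eq[OF m p]) (rule refl)
  also have "\<dots> \<longleftrightarrow> integrable std_normal_distribution (\<lambda>x. (?s * x) ^ (2 * k))"
    unfolding distr_gauss_sum[OF assms] by (subst integrable_distr_eq[OF _ p]) simp_all
  also have "\<dots>"
    unfolding power_mult_distrib
    by (intro integrable_mult_right std_normal_distribution_even_moments)
  finally show "integrable (gauss_space I) (\<lambda>g. (\<Sum>i\<in>I. a i * g i) ^ (2 * k))" .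
  have "(\<integral>g. (\<Sum>i\<in>I. a i * g i) ^ (2 * k) \<partial>gauss_space I) =
    (\<integral>x. x ^ (2 * k) \<partial>distr (gauss_space I) borel (\<lambda>g. \<Sum>i\<in>I. a i * g i))"
    by (subst integral_distr[OF m p]) (rule refl)
  also have "\<dots> = (\<integral>x. (?s * x) ^ (2 * k) \<partial>std_normal_distribution)"
    unfolding distr_gauss_sum[OF assms] by (subst integral_distr[OF _ p]) simp_all
  also have "\<dots> = (\<Sum>i\<in>I. (a i)\<^sup>2) ^ k * (fact (2 * k) / (2 ^ k * fact k))"
    unfolding power_mult_distrib integral_mult_right_zero s
    by (simp only: std_normal_distribution_even_moments)
  finally show "(\<integral>g. (\<Sum>i\<in>I. a i * g i) ^ (2 * k) \<partial>gauss_space I) =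
      (\<Sum>i\<in>I. (a i)\<^sup>2) ^ k * (fact (2 * k) / (2 ^ k * fact k))" .
qed

section \<open>Weak convergence in the Skorohod space\<close>

interpretation skorohod: Metric_space cadlag skorohod_dist
  by (rule Metric_space_skorohod)

lemma sets_borel_of: "sets (borel_of T) = sigma_sets (topspace T) {U. openin T U}"
  unfolding borel_of_def by (rule sets_measure_of) (auto dest: openin_subset)

lemma space_borel_of [simp]: "space (borel_of T) = topspace T"
  unfolding borel_of_def by (rule space_measure_of) (auto dest: openin_subset)

lemma openin_imp_sets_borel_of: "openin T U \<Longrightarrow> U \<in> sets (borel_of T)"
  unfolding sets_borel_of by (rule sigma_sets.Basic) simp

lemma measurable_borel_ofI:
  assumes "F \<in> space M \<rightarrow> topspace T" "\<And>U. openin T U \<Longrightarrow> F -` U \<inter> space M \<in> sets M"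
  shows "F \<in> M \<rightarrow>\<^sub>M borel_of T"
  unfolding borel_of_def using assms
  by (intro measurable_measure_of) (auto dest: openin_subset)

lemma continuous_map_measurable_borel_of:
  assumes "continuous_map T euclideanreal g"
  shows "g \<in> borel_measurable (borel_of T)"
proof (rule borel_measurableI)
  fix S :: "real set" assume "open S"
  then have "openin T {x \<in> topspace T. g x \<in> S}"
    using openin_continuous_map_preimage[OF assms] by simp
  moreover have "g -` S \<inter> space (borel_of T) = {x \<in> topspace T. g x \<in> S}" by auto
  ultimately show "g -` S \<inter> space (borel_of T) \<in> sets (borel_of T)"
    by (simp add: openin_imp_sets_borel_of)
qed

text \<open>The identity is an admissible time change. The slack \<open>d\<close> is there because
  \<open>skorohod_bounds\<close> contains positive numbers only, while \<open>e\<close> may be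
  0.\<close>

lemma skorohod_dist_le:
  assumes x: "x \<in> cadlag" and y: "y \<in> cadlag" and e: "e \<ge> 0"
    and le: "\<And>t. t \<in> {0..1} \<Longrightarrow> \<bar>x t - y t\<bar> \<le> e"
  shows "skorohod_dist x y \<le> e"
proof (rule field_le_epsilon)
  fix d :: real assume d: "d > 0"
  have "(\<lambda>t. t) \<in> time_changes" by (auto simp: time_changes_def strict_mono_on_def)
  moreover have "\<bar>x t - y t\<bar> \<le> e + d" if "t \<in> {0..1}" for t
    using le[OF that] d by linarith
  ultimately have "e + d \<in> skorohod_bounds x y"
    unfolding skorohod_bounds_def mem_Collect_eq using e d
    by (intro conjI bexI[of _ "\<lambda>t. t"]) auto
  then have "Inf (skorohod_bounds x y) \<le> e + d" by (rule cInf_lower[OF _ bdd_below_skorohod_bounds])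
  then show "skorohod_dist x y \<le> e + d" using x y by (simp add: skorohod_dist_def)
qed

lemma skorohod_dist_lessD:
  assumes "x \<in> cadlag" "y \<in> cadlag" "skorohod_dist x y < e"
  obtains \<theta> where "\<theta> \<in> time_changes" "\<And>t. t \<in> {0..1} \<Longrightarrow> \<bar>\<theta> t - t\<bar> < e"
    "\<And>t. t \<in> {0..1} \<Longrightarrow> \<bar>x t - y (\<theta> t)\<bar> < e"
proof -
  have "Inf (skorohod_bounds x y) < e" using assms by (simp add: skorohod_dist_def)
  then obtain d where d: "d \<in> skorohod_bounds x y" "d < e"
    using cInf_lessD[OF skorohod_bounds_nonempty[OF assms(1,2)]] by blast
  then obtain \<theta> where "\<theta> \<in> time_changes" "\<forall>t\<in>{0..1}. \<bar>\<theta> t - t\<bar> \<le> d \<and> \<bar>x t - y (\<theta> t)\<bar> \<le> d"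
    unfolding skorohod_bounds_def by blast
  with d(2) show thesis by (intro that[of \<theta>]) (auto intro: le_less_trans)
qed

lemma openin_skorohod_iff:
  "openin skorohod_topology U \<longleftrightarrow> U \<subseteq> cadlag \<and>
     (\<forall>x\<in>U. \<exists>e>0. \<forall>y\<in>cadlag. skorohod_dist x y < e \<longrightarrow> y \<in> U)"
proof -
  have "(\<exists>r>0. skorohod.mball x r \<subseteq> U) \<longleftrightarrow>
    (\<exists>e>0. \<forall>y\<in>cadlag. skorohod_dist x y < e \<longrightarrow> y \<in> U)" if "x \<in> cadlag" for x
    using that by (auto simp: subset_iff)
  then show ?thesis
    unfolding skorohod_topology_def skorohod.openin_mtopology by (meson subsetD)
qed

text \<open>A path at distance less than \<open>e\<close> takes, at the shifted time
  \<open>\<theta> s\<close>, a value within \<open>e\<close> of \<open>x s\<close>; for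
  \<open>e\<close> below the three gaps the shifted time is still in the open interval and the value
  still above \<open>c\<close>.\<close>

lemma openin_skorohod_exceeds:
  assumes ab: "0 \<le> a" "b \<le> 1"
  shows "openin skorohod_topology {x \<in> cadlag. \<exists>s\<in>{a<..<b}. c < x s}"
  unfolding openin_skorohod_iff
proof (intro conjI ballI)
  fix x assume "x \<in> {x \<in> cadlag. \<exists>s\<in>{a<..<b}. c < x s}"
  then obtain s where x: "x \<in> cadlag" and s: "a < s" "s < b" "c < x s" by auto
  define e where "e = min (x s - c) (min (s - a) (b - s))"
  have "e > 0" using s by (simp add: e_def)
  moreover have "y \<in> {x \<in> cadlag. \<exists>s\<in>{a<..<b}. c < x s}"
    if y: "y \<in> cadlag" and "skorohod_dist x y < e" for y
  proof -
    obtain \<theta> where "\<And>t. t \<in> {0..1} \<Longrightarrow> \<bar>\<theta> t - t\<bar> < e"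
      "\<And>t. t \<in> {0..1} \<Longrightarrow> \<bar>x t - y (\<theta> t)\<bar> < e"
      using skorohod_dist_lessD[OF x y \<open>skorohod_dist x y < e\<close>] by metis
    from this[of s] have "\<bar>\<theta> s - s\<bar> < e" "\<bar>x s - y (\<theta> s)\<bar> < e" using s ab by auto
    then have "\<bar>\<theta> s - s\<bar> < s - a" "\<bar>\<theta> s - s\<bar> < b - s" "\<bar>x s - y (\<theta> s)\<bar> < x s - c"
      by (simp_all add: e_def)
    then have "\<theta> s \<in> {a<..<b}" "c < y (\<theta> s)" by auto
    with y show ?thesis by blast
  qed
  ultimately show "\<exists>e>0. \<forall>y\<in>cadlag. skorohod_dist x y < e \<longrightarrow>
      y \<in> {x \<in> cadlag. \<exists>s\<in>{a<..<b}. c < x s}" by blast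
qed auto

text \<open>At 1 there are no right neighbourhoods to use, but every time change fixes 1, so the
  value there moves by less than the distance.\<close>

lemma openin_skorohod_endpoint: "openin skorohod_topology {x \<in> cadlag. c < x 1}"
  unfolding openin_skorohod_iff
proof (intro conjI ballI)
  fix x assume "x \<in> {x \<in> cadlag. c < x 1}"
  then have x: "x \<in> cadlag" "c < x 1" by auto
  have "c < y 1" if y: "y \<in> cadlag" and d: "skorohod_dist x y < x 1 - c" for y
  proof -
    obtain \<theta> where "\<theta> \<in> time_changes" "\<And>t. t \<in> {0..1} \<Longrightarrow> \<bar>x t - y (\<theta> t)\<bar> < x 1 - c"
      using skorohod_dist_lessD[OF x(1) y d] by metis
    from this(2)[of 1] time_change_1[OF this(1)] show ?thesis by auto
  qed
  with x(2) show "\<exists>e>0. \<forall>y\<in>cadlag. skorohod_dist x y < e \<longrightarrow> y \<in> {x \<in> cadlag. c < x 1}"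
    by (intro exI[of _ "x 1 - c"]) auto
qed auto

text \<open>Evaluation is not continuous, but by right-continuity \<open>x t \<ge> c\<close> iff \<open>x\<close> exceeds every
  \<open>c' < c\<close> somewhere in every right neighbourhood of \<open>t\<close>, which is a countable intersection of open
  conditions.\<close>

lemma cadlag_ge_iff:
  assumes x: "x \<in> cadlag" and t: "0 \<le> t" "t < 1"
  shows "c \<le> x t \<longleftrightarrow>
    (\<forall>n m. \<exists>s\<in>{t<..<min 1 (t + 1 / real (Suc n))}. c - 1 / real (Suc m) < x s)"
proof -
  have lim: "(x \<longlongrightarrow> x t) (at_right t)" using x t by (auto simp: cadlag_def)
  have near: "\<exists>b>t. \<forall>s. t < s \<and> s < b \<longrightarrow> \<bar>x s - x t\<bar> < e" if "e > 0" for e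
    using tendstoD[OF lim that] unfolding eventually_at_right_field dist_real_def by auto
  show ?thesis
  proof (intro iffI allI)
    fix n m :: nat assume c: "c \<le> x t"
    obtain b where b: "b > t" "\<forall>s. t < s \<and> s < b \<longrightarrow> \<bar>x s - x t\<bar> < 1 / real (Suc m)"
      using near[of "1 / real (Suc m)"] by auto
    have "t < min b (min 1 (t + 1 / real (Suc n)))" using b(1) t by simp
    then obtain s where s: "t < s" "s < min b (min 1 (t + 1 / real (Suc n)))" using dense by blast
    with b(2) have "\<bar>x s - x t\<bar> < 1 / real (Suc m)" by simp
    then have "c - 1 / real (Suc m) < x s" using c by linarith
    with s show "\<exists>s\<in>{t<..<min 1 (t + 1 / real (Suc n))}. c - 1 / real (Suc m) < x s"
      by (intro bexI[of _ s]) auto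
  next
    assume A: "\<forall>n m. \<exists>s\<in>{t<..<min 1 (t + 1 / real (Suc n))}. c - 1 / real (Suc m) < x s"
    show "c \<le> x t"
    proof (rule ccontr)
      assume "\<not> c \<le> x t"
      then have "(c - x t) / 2 > 0" by simp
      from near[OF this] obtain b where b: "b > t" "\<forall>s. t < s \<and> s < b \<longrightarrow> \<bar>x s - x t\<bar> < (c - x t) / 2"
        by blast
      from b(1) obtain n where n: "1 / real (Suc n) < b - t"
        using reals_Archimedean[of "b - t"] by (auto simp: inverse_eq_divide)
      from reals_Archimedean[OF \<open>(c - x t) / 2 > 0\<close>]
      obtain m where m: "1 / real (Suc m) < (c - x t) / 2" by (auto simp: inverse_eq_divide)
      from A obtain s where s: "t < s" "s < t + 1 / real (Suc n)" "c - 1 / real (Suc m) < x s" by force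
      then have "s < b" using n by linarith
      with b(2) s(1) have "\<bar>x s - x t\<bar> < (c - x t) / 2" by blast
      then have "x s - x t < (c - x t) / 2" by (rule le_less_trans[OF abs_ge_self])
      moreover define d where "d = 1 / real (Suc m)"
      ultimately show False using s(3) m unfolding d_def[symmetric] by argo
    qed
  qed
qed

lemma measurable_skorohod_eval:
  assumes t: "t \<in> {0..1}"
  shows "(\<lambda>x. x t) \<in> borel_measurable (borel_of skorohod_topology)"
proof (cases "t = 1")
  case True
  have "{x \<in> space (borel_of skorohod_topology). c < x 1} \<in> sets (borel_of skorohod_topology)" for c
    using openin_imp_sets_borel_of[OF openin_skorohod_endpoint]
    by (simp add: topspace_skorohod_topology)
  then show ?thesis unfolding True by (rule borel_measurableI_greater)
next
  case False
  with t have t: "0 \<le> t" "t < 1" by auto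
  show ?thesis
  proof (rule borel_measurableI_ge)
    fix c :: real
    let ?B = "borel_of skorohod_topology"
    let ?U = "\<lambda>n m. {x \<in> cadlag. \<exists>s\<in>{t<..<min 1 (t + 1 / real (Suc n))}. c - 1 / real (Suc m) < x s}"
    have U: "?U n m \<in> sets ?B" for n m
      by (intro openin_imp_sets_borel_of openin_skorohod_exceeds) (use t in auto)
    have "(\<Inter>n. \<Inter>m. ?U n m) \<in> sets ?B"
      using U by (intro sets.countable_INT') auto
    also have "(\<Inter>n. \<Inter>m. ?U n m) = {x \<in> space ?B. c \<le> x t}"
    proof (intro set_eqI)
      fix x
      show "x \<in> (\<Inter>n. \<Inter>m. ?U n m) \<longleftrightarrow> x \<in> {x \<in> space ?B. c \<le> x t}"
      proof (cases "x \<in> cadlag")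
        case True
        then show ?thesis
          unfolding space_borel_of topspace_skorohod_topology mem_Collect_eq cadlag_ge_iff[OF True t]
          by blast
      next
        case False
        then show ?thesis by (simp add: topspace_skorohod_topology)
      qed
    qed
    finally show "{x \<in> space ?B. c \<le> x t} \<in> sets ?B" .
  qed
qed

section \<open>Step paths on an equidistant grid\<close>

definition step_path :: "nat \<Rightarrow> (nat \<Rightarrow> real) \<Rightarrow> real \<Rightarrow> real" where
  "step_path N y = (\<lambda>t\<in>{0..1}. y (nat \<lfloor>real N * t\<rfloor>))"

lemma step_path_eq: "t \<in> {0..1} \<Longrightarrow> step_path N y t = y (nat \<lfloor>real N * t\<rfloor>)"
  by (simp add: step_path_def)

lemma floor_index_le:
  assumes "t \<in> {0..1}"
  shows "nat \<lfloor>real N * t\<rfloor> \<le> N"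
proof -
  have "real N * t \<le> real N * 1" using assms by (intro mult_left_mono) auto
  then have "\<lfloor>real N * t\<rfloor> \<le> \<lfloor>real N\<rfloor>" by (intro floor_mono) simp
  then show ?thesis by simp
qed

text \<open>The path is constant from \<open>t\<close> up to the next grid point and constant on a
  left neighbourhood of \<open>t\<close>. For \<open>N = 0\<close> it is the constant
  \<open>y 0\<close>, so that sequences of paths may start at index 0.\<close>

lemma step_path_cadlag: "step_path N y \<in> cadlag"
proof (cases "N = 0")
  case True
  have c: "step_path N y t = y 0" if "t \<in> {0..1}" for t using that True by (simp add: step_path_def)
  show ?thesis
    unfolding cadlag_def
  proof (intro CollectI conjI ballI)
    show "step_path N y \<in> extensional {0..1}" by (simp add: step_path_def)
    fix t :: real assume t: "t \<in> {0..<1}"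
    have "eventually (\<lambda>s. step_path N y s = y 0) (at_right t)"
      unfolding eventually_at_right_field using t by (intro exI[of _ 1]) (auto intro!: c)
    then show "(step_path N y \<longlongrightarrow> step_path N y t) (at_right t)"
      using c[of t] t by (simp add: tendsto_eventually)
  next
    fix t :: real assume t: "t \<in> {0<..1}"
    have "eventually (\<lambda>s. step_path N y s = y 0) (at_left t)"
      unfolding eventually_at_left_field using t by (intro exI[of _ 0]) (auto intro!: c)
    then show "\<exists>l. (step_path N y \<longlongrightarrow> l) (at_left t)"
      by (blast intro: tendsto_eventually)
  qed
next
  case False
  then have N: "real N > 0" by simp
  show ?thesis
    unfolding cadlag_def
  proof (intro CollectI conjI ballI)
    show "step_path N y \<in> extensional {0..1}" by (simp add: step_path_def)
    fix t :: real assume t: "t \<in> {0..<1}"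
    let ?b = "(of_int \<lfloor>real N * t\<rfloor> + 1) / real N"
    have b: "t < ?b" using N by (simp add: pos_less_divide_eq mult.commute)
    have "step_path N y s = step_path N y t" if s: "t < s" "s < min 1 ?b" for s
    proof -
      have "real N * s < of_int \<lfloor>real N * t\<rfloor> + 1"
        using s N by (simp add: pos_less_divide_eq mult.commute)
      moreover have "real N * t \<le> real N * s" using s N by (intro mult_left_mono) auto
      then have "of_int \<lfloor>real N * t\<rfloor> \<le> real N * s" by linarith
      ultimately have "\<lfloor>real N * s\<rfloor> = \<lfloor>real N * t\<rfloor>" by (intro floor_unique)
      then show ?thesis using s t by (simp add: step_path_def)
    qed
    moreover have "t < min 1 ?b" using b t by simp
    ultimately have "eventually (\<lambda>s. step_path N y s = step_path N y t) (at_right t)"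
      unfolding eventually_at_right_field by blast
    then show "(step_path N y \<longlongrightarrow> step_path N y t) (at_right t)"
      by (rule tendsto_eventually)
  next
    fix t :: real assume t: "t \<in> {0<..1}"
    \<comment> \<open>The last grid point strictly before \<open>t\<close>: ceiling minus one rather
      than floor, because at a grid point \<open>t\<close> the left limit is the preceding
      value.\<close>
    let ?a = "(of_int \<lceil>real N * t\<rceil> - 1) / real N"
    have a: "?a < t" using N by (simp add: pos_divide_less_eq mult.commute) linarith
    have "step_path N y s = y (nat (\<lceil>real N * t\<rceil> - 1))" if s: "max 0 ?a < s" "s < t" for s
    proof -
      have "of_int \<lceil>real N * t\<rceil> - 1 < real N * s"
        using s N by (simp add: pos_divide_less_eq mult.commute)
      moreover have "real N * s < real N * t" using s N by simp
      then have "real N * s < of_int \<lceil>real N * t\<rceil>" by linarith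
      ultimately have "\<lfloor>real N * s\<rfloor> = \<lceil>real N * t\<rceil> - 1" by (intro floor_unique) auto
      then show ?thesis using s t by (simp add: step_path_def)
    qed
    moreover have "max 0 ?a < t" using a t by simp
    ultimately have "eventually (\<lambda>s. step_path N y s = y (nat (\<lceil>real N * t\<rceil> - 1))) (at_left t)"
      unfolding eventually_at_left_field by blast
    then show "\<exists>l. (step_path N y \<longlongrightarrow> l) (at_left t)"
      by (blast intro: tendsto_eventually)
  qed
qed

lemma skorohod_dist_step_path_le:
  assumes "e \<ge> 0" "\<And>j. j \<le> N \<Longrightarrow> \<bar>y j - z j\<bar> \<le> e"
  shows "skorohod_dist (step_path N y) (step_path N z) \<le> e"
  using assms by (intro skorohod_dist_le step_path_cadlag) (auto simp: step_path_eq floor_index_le)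

text \<open>Only the coordinates up to \<open>N\<close> enter, so uniform closeness of the paths is
  an open condition in the product topology.\<close>

lemma eventually_step_path_close:
  assumes "e > 0"
  shows "eventually (\<lambda>z. skorohod_dist (step_path N y) (step_path N z) < e) (nhds y)"
proof -
  have "eventually (\<lambda>z. \<forall>j\<in>{..N}. dist (z j) (y j) < e / 2) (nhds y)"
  proof (rule eventually_ball_finite)
    show "\<forall>j\<in>{..N}. \<forall>\<^sub>F z in nhds y. dist (z j) (y j) < e / 2"
    proof
      fix j
      have "((\<lambda>z. z j) \<longlongrightarrow> y j) (nhds y)"
        using continuous_on_product_coordinates[where 'a=nat and 'b=real, of j]
        by (simp add: continuous_on_def tendsto_at_iff_tendsto_nhds[of "\<lambda>z. z j"])
      then show "\<forall>\<^sub>F z in nhds y. dist (z j) (y j) < e / 2"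
        by (rule tendstoD) (use assms in simp)
    qed
  qed simp
  then show ?thesis
  proof eventually_elim
    case (elim z)
    then have "skorohod_dist (step_path N y) (step_path N z) \<le> e / 2"
      using assms by (intro skorohod_dist_step_path_le) (auto simp: dist_real_def abs_minus_commute intro: less_imp_le)
    then show ?case using assms by linarith
  qed
qed

text \<open>By continuity in the values. It turns countably many random variables into a random
  element of the Skorohod space.\<close>

lemma measurable_step_path:
  "step_path N \<in> borel \<rightarrow>\<^sub>M borel_of skorohod_topology"
proof (rule measurable_borel_ofI)
  show "step_path N \<in> space borel \<rightarrow> topspace skorohod_topology"
    by (simp add: topspace_skorohod_topology step_path_cadlag)
  fix U assume U: "openin skorohod_topology U"
  have "open (step_path N -` U)"
    unfolding open_subopen[of "step_path N -` U"]
  proof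
    fix y assume "y \<in> step_path N -` U"
    with U obtain e where e: "e > 0" "\<And>x. x \<in> cadlag \<Longrightarrow> skorohod_dist (step_path N y) x < e \<Longrightarrow> x \<in> U"
      unfolding openin_skorohod_iff by blast
    from eventually_step_path_close[OF e(1), of N y] obtain T where
      "open T" "y \<in> T" "\<And>z. z \<in> T \<Longrightarrow> skorohod_dist (step_path N y) (step_path N z) < e"
      unfolding eventually_nhds by blast
    with e(2) step_path_cadlag show "\<exists>T. open T \<and> y \<in> T \<and> T \<subseteq> step_path N -` U"
      by (intro exI[of _ T]) auto
  qed
  then show "step_path N -` U \<inter> space borel \<in> sets borel" by simp
qed

section \<open>Reduction of weak convergence to Lipschitz test functions\<close>

lemma lipschitz_imp_continuous_map_skorohod:
  assumes lip: "\<And>x y. x \<in> cadlag \<Longrightarrow> y \<in> cadlag \<Longrightarrow> \<bar>g x - g y\<bar> \<le> L * skorohod_dist x y"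
  shows "continuous_map skorohod_topology euclideanreal g"
  unfolding continuous_map_def
proof (intro conjI allI impI)
  show "g \<in> topspace skorohod_topology \<rightarrow> topspace euclideanreal" by simp
  fix U :: "real set" assume "openin euclideanreal U"
  then have U: "open U" by simp
  show "openin skorohod_topology {x \<in> topspace skorohod_topology. g x \<in> U}"
    unfolding openin_skorohod_iff topspace_skorohod_topology
  proof (intro conjI ballI)
    fix x assume "x \<in> {x \<in> cadlag. g x \<in> U}"
    then have x: "x \<in> cadlag" "g x \<in> U" by auto
    from U x(2) obtain e where e: "e > 0" "\<And>r. \<bar>r - g x\<bar> < e \<Longrightarrow> r \<in> U"
      by (auto simp: open_dist dist_real_def)
    have "g y \<in> U" if y: "y \<in> cadlag" and d: "skorohod_dist x y < e / (\<bar>L\<bar> + 1)" for y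
    proof (rule e(2))
      have "\<bar>g y - g x\<bar> \<le> L * skorohod_dist y x" by (rule lip[OF y x(1)])
      also have "\<dots> \<le> (\<bar>L\<bar> + 1) * skorohod_dist x y"
        unfolding skorohod.commute[of y x] by (intro mult_right_mono) auto
      also have "\<dots> < e" using d by (simp add: pos_less_divide_eq mult.commute)
      finally show "\<bar>g y - g x\<bar> < e" .
    qed
    then show "\<exists>e>0. \<forall>y\<in>cadlag. skorohod_dist x y < e \<longrightarrow> y \<in> {x \<in> cadlag. g x \<in> U}"
      using e(1) by (intro exI[of _ "e / (\<bar>L\<bar> + 1)"]) auto
  qed auto
qed

text \<open>The Pasch-Hausdorff envelope, an infimal convolution with \<open>k\<close> times the
  metric: for \<open>k \<ge> 0\<close> and bounded \<open>f\<close> it is the largest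
  \<open>k\<close>-Lipschitz function below \<open>f\<close>.\<close>

definition lipschitz_minorant ::
    "real \<Rightarrow> ((real \<Rightarrow> real) \<Rightarrow> real) \<Rightarrow> (real \<Rightarrow> real) \<Rightarrow> real" where
  "lipschitz_minorant k f x = (INF y\<in>cadlag. f y + k * skorohod_dist x y)"

context
  fixes f :: "(real \<Rightarrow> real) \<Rightarrow> real" and K :: real
  assumes f_bound: "\<And>x. x \<in> cadlag \<Longrightarrow> \<bar>f x\<bar> \<le> K"
begin

lemma bdd_below_lipschitz_minorant:
  assumes "k \<ge> 0"
  shows "bdd_below ((\<lambda>y. f y + k * skorohod_dist x y) ` cadlag)"
proof (rule bdd_belowI2)
  fix y assume "y \<in> cadlag"
  moreover have "0 \<le> k * skorohod_dist x y" using assms by simp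
  ultimately show "- K \<le> f y + k * skorohod_dist x y" using f_bound[of y] by linarith
qed

lemma lipschitz_minorant_le:
  assumes "k \<ge> 0" "x \<in> cadlag"
  shows "lipschitz_minorant k f x \<le> f x"
  unfolding lipschitz_minorant_def
  by (rule cINF_lower2[OF bdd_below_lipschitz_minorant[OF assms(1)] assms(2)])
     (simp add: assms)

lemma lipschitz_minorant_ge:
  assumes "k \<ge> 0"
  shows "- K \<le> lipschitz_minorant k f x"
  unfolding lipschitz_minorant_def
proof (rule cINF_greatest)
  show "cadlag \<noteq> {}" using step_path_cadlag by blast
  fix y assume "y \<in> cadlag"
  moreover have "0 \<le> k * skorohod_dist x y" using assms by simp
  ultimately show "- K \<le> f y + k * skorohod_dist x y" using f_bound[of y] by linarith
qed

lemma lipschitz_minorant_bounded: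
  assumes "k \<ge> 0" "x \<in> cadlag"
  shows "\<bar>lipschitz_minorant k f x\<bar> \<le> K"
  using lipschitz_minorant_le[OF assms] lipschitz_minorant_ge[OF assms(1)] f_bound[OF assms(2)]
  by (metis abs_le_iff minus_le_iff order_trans)

lemma lipschitz_minorant_lipschitz:
  assumes k: "k \<ge> 0" and x: "x \<in> cadlag" and y: "y \<in> cadlag"
  shows "\<bar>lipschitz_minorant k f x - lipschitz_minorant k f y\<bar> \<le> k * skorohod_dist x y"
proof -
  have "lipschitz_minorant k f x \<le> lipschitz_minorant k f y + k * skorohod_dist x y"
    if x: "x \<in> cadlag" and y: "y \<in> cadlag" for x y
  proof -
    have "lipschitz_minorant k f x - k * skorohod_dist x y \<le> lipschitz_minorant k f y"
      unfolding lipschitz_minorant_def[of k f y]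
    proof (rule cINF_greatest)
      show "cadlag \<noteq> {}" using x by blast
      fix z assume z: "z \<in> cadlag"
      have "lipschitz_minorant k f x \<le> f z + k * skorohod_dist x z"
        unfolding lipschitz_minorant_def
        by (rule cINF_lower[OF bdd_below_lipschitz_minorant[OF k] z])
      also have "k * skorohod_dist x z \<le> k * (skorohod_dist x y + skorohod_dist y z)"
        using k skorohod.triangle[OF x y z] by (rule mult_left_mono[rotated])
      finally show "lipschitz_minorant k f x - k * skorohod_dist x y \<le> f z + k * skorohod_dist y z"
        by (simp add: distrib_left)
    qed
    then show ?thesis by simp
  qed
  from this[OF x y] this[OF y x] show ?thesis
    unfolding skorohod.commute[of y x] by (simp add: abs_le_iff)
qed

text \<open>Close to \<open>x\<close> continuity keeps \<open>f y\<close> above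
  \<open>f x - r / 2\<close>; at distance at least \<open>d\<close> the penalty is at least
  \<open>2 * K\<close>, which exceeds any possible drop of \<open>f\<close>.\<close>

lemma lipschitz_minorant_tendsto:
  assumes f: "continuous_map skorohod_topology euclideanreal f" and x: "x \<in> cadlag"
  shows "(\<lambda>k. lipschitz_minorant (real k) f x) \<longlonglongrightarrow> f x"
proof (rule LIMSEQ_I)
  fix r :: real assume r: "r > 0"
  have "openin skorohod_topology {y \<in> topspace skorohod_topology. f y \<in> {f x - r / 2<..}}"
    by (rule openin_continuous_map_preimage[OF f]) simp
  then obtain d where d: "d > 0"
    "\<And>y. y \<in> cadlag \<Longrightarrow> skorohod_dist x y < d \<Longrightarrow> f x - r / 2 < f y"
    unfolding openin_skorohod_iff topspace_skorohod_topology using x r by auto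
  obtain k0 :: nat where k0: "2 * K / d \<le> real k0" using real_arch_simple by blast
  show "\<exists>no. \<forall>k\<ge>no. norm (lipschitz_minorant (real k) f x - f x) < r"
  proof (intro exI[of _ k0] allI impI)
    fix k assume "k \<ge> k0"
    with k0 have "2 * K / d \<le> real k" by linarith
    then have kd: "2 * K \<le> real k * d" using d(1) by (simp add: pos_divide_le_eq)
    have "f x - r / 2 \<le> lipschitz_minorant (real k) f x"
      unfolding lipschitz_minorant_def
    proof (rule cINF_greatest)
      show "cadlag \<noteq> {}" using x by blast
      fix y assume y: "y \<in> cadlag"
      show "f x - r / 2 \<le> f y + real k * skorohod_dist x y"
      proof (cases "skorohod_dist x y < d")
        case True
        have "0 \<le> real k * skorohod_dist x y" by simp
        with d(2)[OF y True] show ?thesis by linarith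
      next
        case False
        then have "real k * d \<le> real k * skorohod_dist x y" by (intro mult_left_mono) auto
        with kd f_bound[OF x] f_bound[OF y] r show ?thesis by linarith
      qed
    qed
    with lipschitz_minorant_le[of "real k", OF _ x] r
    show "norm (lipschitz_minorant (real k) f x - f x) < r" by simp
  qed
qed

end

text \<open>Dominated convergence under \<open>P\<close> fixes one minorant with almost the same
  integral as \<open>f\<close>. Convergence for this Lipschitz function, which lies below
  \<open>f\<close> under every \<open>Z n\<close>, gives the lower bound.\<close>

lemma integral_liminf_lipschitz:
  fixes Z :: "nat \<Rightarrow> (real \<Rightarrow> real) measure"
  assumes Z: "\<And>n. prob_space (Z n)" "\<And>n. sets (Z n) = sets (borel_of skorohod_topology)"
    and P: "prob_space P" "sets P = sets (borel_of skorohod_topology)"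
    and lip: "\<And>g L K. L \<ge> 0 \<Longrightarrow>
      (\<And>x y. x \<in> cadlag \<Longrightarrow> y \<in> cadlag \<Longrightarrow> \<bar>g x - g y\<bar> \<le> L * skorohod_dist x y) \<Longrightarrow>
      (\<And>x. x \<in> cadlag \<Longrightarrow> \<bar>g x\<bar> \<le> K) \<Longrightarrow> (\<lambda>n. \<integral>x. g x \<partial>Z n) \<longlonglongrightarrow> (\<integral>x. g x \<partial>P)"
    and f: "continuous_map skorohod_topology euclideanreal f" "\<And>x. x \<in> cadlag \<Longrightarrow> \<bar>f x\<bar> \<le> K"
    and e: "e > 0"
  shows "eventually (\<lambda>n. (\<integral>x. f x \<partial>Z n) > (\<integral>x. f x \<partial>P) - e) sequentially"
proof -
  let ?m = "\<lambda>k. lipschitz_minorant (real k) f"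
  have sp: "space P = cadlag" "space (Z n) = cadlag" for n
    using sets_eq_imp_space_eq[OF P(2)] sets_eq_imp_space_eq[OF Z(2)]
    by (simp_all add: topspace_skorohod_topology)
  note mlip = lipschitz_minorant_lipschitz[where K=K, OF f(2)]
  note mbd = lipschitz_minorant_bounded[where K=K, OF f(2)]
  have meas: "?m k \<in> borel_measurable (borel_of skorohod_topology)" for k
    by (intro continuous_map_measurable_borel_of
        lipschitz_imp_continuous_map_skorohod[where L="real k"] mlip) auto
  have fmeas: "f \<in> borel_measurable (borel_of skorohod_topology)"
    by (rule continuous_map_measurable_borel_of[OF f(1)])
  have measP: "?m k \<in> borel_measurable P" "f \<in> borel_measurable P" for k
    using meas fmeas P(2) by (simp_all cong: measurable_cong_sets)
  have measZ: "?m k \<in> borel_measurable (Z n)" "f \<in> borel_measurable (Z n)" for k n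
    using meas fmeas Z(2) by (simp_all cong: measurable_cong_sets)
  interpret P: prob_space P by (rule P(1))
  have "(\<lambda>k. \<integral>x. ?m k x \<partial>P) \<longlonglongrightarrow> (\<integral>x. f x \<partial>P)"
  proof (rule integral_dominated_convergence[where w="\<lambda>_. K"])
    show "AE x in P. (\<lambda>k. ?m k x) \<longlonglongrightarrow> f x"
      using lipschitz_minorant_tendsto[OF f(2) f(1)] sp by (intro AE_I2) auto
    show "AE x in P. norm (?m k x) \<le> K" for k
      using mbd[where k="real k"] sp by (intro AE_I2) auto
  qed (use measP in auto)
  from LIMSEQ_D[OF this, of "e / 2"] e obtain k where
    k: "\<bar>(\<integral>x. ?m k x \<partial>P) - (\<integral>x. f x \<partial>P)\<bar> < e / 2" by auto
  have "(\<lambda>n. \<integral>x. ?m k x \<partial>Z n) \<longlonglongrightarrow> (\<integral>x. ?m k x \<partial>P)"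
    by (rule lip[of "real k" _ K]) (auto intro: mlip mbd)
  moreover have "(\<integral>x. f x \<partial>P) - e < (\<integral>x. ?m k x \<partial>P)" using k e by linarith
  ultimately have "eventually (\<lambda>n. (\<integral>x. ?m k x \<partial>Z n) > (\<integral>x. f x \<partial>P) - e) sequentially"
    by (rule order_tendstoD(1))
  then show ?thesis
  proof eventually_elim
    case (elim n)
    interpret Zn: prob_space "Z n" by (rule Z(1))
    have "(\<integral>x. ?m k x \<partial>Z n) \<le> (\<integral>x. f x \<partial>Z n)"
    proof (rule integral_mono)
      show "integrable (Z n) (?m k)"
        using measZ mbd sp by (intro Zn.integrable_const_bound[of _ K] AE_I2) auto
      show "integrable (Z n) f"
        using measZ f(2) sp by (intro Zn.integrable_const_bound[of _ K] AE_I2) auto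
      show "?m k x \<le> f x" if "x \<in> space (Z n)" for x
        using that sp by (intro lipschitz_minorant_le[where K=K] f(2)) auto
    qed
    with elim show ?case by linarith
  qed
qed

lemma weakly_converges_lipschitzI:
  fixes Z :: "nat \<Rightarrow> (real \<Rightarrow> real) measure"
  assumes Z: "\<And>n. prob_space (Z n)" "\<And>n. sets (Z n) = sets (borel_of skorohod_topology)"
    and P: "prob_space P" "sets P = sets (borel_of skorohod_topology)"
    and lip: "\<And>g L K. L \<ge> 0 \<Longrightarrow>
      (\<And>x y. x \<in> cadlag \<Longrightarrow> y \<in> cadlag \<Longrightarrow> \<bar>g x - g y\<bar> \<le> L * skorohod_dist x y) \<Longrightarrow>
      (\<And>x. x \<in> cadlag \<Longrightarrow> \<bar>g x\<bar> \<le> K) \<Longrightarrow> (\<lambda>n. \<integral>x. g x \<partial>Z n) \<longlonglongrightarrow> (\<integral>x. g x \<partial>P)"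
  shows "weakly_converges skorohod_topology Z P"
  unfolding weakly_converges_def
proof (intro allI impI, elim conjE)
  fix f assume f: "continuous_map skorohod_topology euclideanreal f"
    and "bounded (f ` topspace skorohod_topology)"
  then obtain K where K: "\<And>x. x \<in> cadlag \<Longrightarrow> \<bar>f x\<bar> \<le> K"
    by (auto simp: bounded_iff topspace_skorohod_topology)
  have f': "continuous_map skorohod_topology euclideanreal (\<lambda>x. - f x)"
    using f by (rule continuous_map_minus)
  show "(\<lambda>n. \<integral>x. f x \<partial>Z n) \<longlonglongrightarrow> (\<integral>x. f x \<partial>P)"
  proof (rule tendstoI)
    fix e :: real assume e: "e > 0"
    have "eventually (\<lambda>n. (\<integral>x. f x \<partial>Z n) > (\<integral>x. f x \<partial>P) - e) sequentially"
      by (rule integral_liminf_lipschitz[OF Z P lip f K e])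
    moreover have "eventually (\<lambda>n. (\<integral>x. - f x \<partial>Z n) > (\<integral>x. - f x \<partial>P) - e) sequentially"
      by (rule integral_liminf_lipschitz[where K=K, OF Z P lip f' _ e]) (simp_all add: K)
    ultimately show "eventually (\<lambda>n. dist (\<integral>x. f x \<partial>Z n) (\<integral>x. f x \<partial>P) < e) sequentially"
    proof eventually_elim
      case (elim n)
      then show ?case by (simp add: dist_real_def abs_less_iff)
    qed
  qed
qed

text \<open>\<open>V k\<close> is the open neighbourhood of radius \<open>1 / real (Suc k)\<close>
  of the complement of \<open>U\<close>. The limit lies in \<open>U\<close> iff for some
  \<open>k\<close> the approximations eventually avoid \<open>V k\<close>, a countable combination
  of measurable events. It serves to make the Brownian path a random element.\<close>

lemma measurable_skorohod_limit:
  assumes F: "\<And>m. F m \<in> M \<rightarrow>\<^sub>M borel_of skorohod_topology"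
    and G: "\<And>\<omega>. \<omega> \<in> space M \<Longrightarrow> G \<omega> \<in> cadlag"
    and lim: "\<And>\<omega>. \<omega> \<in> space M \<Longrightarrow> (\<lambda>m. skorohod_dist (F m \<omega>) (G \<omega>)) \<longlonglongrightarrow> 0"
  shows "G \<in> M \<rightarrow>\<^sub>M borel_of skorohod_topology"
proof (rule measurable_borel_ofI)
  show "G \<in> space M \<rightarrow> topspace skorohod_topology"
    using G by (auto simp: topspace_skorohod_topology)
  fix U assume U: "openin skorohod_topology U"
  have Fc: "F m \<omega> \<in> cadlag" if "\<omega> \<in> space M" for m \<omega>
    using measurable_space[OF F that] by (simp add: topspace_skorohod_topology)
  define V where "V k = {x \<in> cadlag. \<exists>y\<in>cadlag - U. skorohod_dist x y < 1 / real (Suc k)}" for k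
  have V: "openin skorohod_topology (V k)" for k
    unfolding openin_skorohod_iff
  proof (intro conjI ballI)
    fix x assume "x \<in> V k"
    then obtain y where x: "x \<in> cadlag" and y: "y \<in> cadlag" "y \<notin> U" "skorohod_dist x y < 1 / real (Suc k)"
      by (auto simp: V_def)
    have "z \<in> V k" if z: "z \<in> cadlag" "skorohod_dist x z < 1 / real (Suc k) - skorohod_dist x y" for z
    proof -
      have "skorohod_dist z y \<le> skorohod_dist x z + skorohod_dist x y"
        using skorohod.triangle[OF z(1) x y(1)] by (simp add: skorohod.commute)
      then have "skorohod_dist z y < 1 / real (Suc k)" using z(2) by linarith
      then show ?thesis using z(1) y unfolding V_def by blast
    qed
    with y(3) show "\<exists>e>0. \<forall>z\<in>cadlag. skorohod_dist x z < e \<longrightarrow> z \<in> V k"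
      by (intro exI[of _ "1 / real (Suc k) - skorohod_dist x y"]) auto
  qed (auto simp: V_def)
  have "G -` U \<inter> space M = {\<omega> \<in> space M. \<exists>k n. \<forall>m\<in>{n..}. F m \<omega> \<notin> V k}"
  proof (intro set_eqI iffI)
    fix \<omega> assume "\<omega> \<in> G -` U \<inter> space M"
    then have \<omega>: "\<omega> \<in> space M" "G \<omega> \<in> U" by auto
    obtain e where e: "e > 0" "\<And>y. y \<in> cadlag \<Longrightarrow> skorohod_dist (G \<omega>) y < e \<Longrightarrow> y \<in> U"
      using U \<omega>(2) unfolding openin_skorohod_iff by blast
    obtain k where k: "1 / real (Suc k) < e / 2"
      using reals_Archimedean[of "e / 2"] e(1) by (auto simp: inverse_eq_divide)
    from LIMSEQ_D[OF lim[OF \<omega>(1)], of "e / 2"] e(1) obtain n where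
      n: "\<And>m. m \<ge> n \<Longrightarrow> skorohod_dist (F m \<omega>) (G \<omega>) < e / 2" by auto
    have "F m \<omega> \<notin> V k" if "m \<ge> n" for m
    proof
      assume "F m \<omega> \<in> V k"
      then obtain y where y: "y \<in> cadlag" "y \<notin> U" "skorohod_dist (F m \<omega>) y < 1 / real (Suc k)"
        by (auto simp: V_def)
      have "skorohod_dist (G \<omega>) y \<le> skorohod_dist (F m \<omega>) (G \<omega>) + skorohod_dist (F m \<omega>) y"
        using skorohod.triangle[OF G[OF \<omega>(1)] Fc[OF \<omega>(1), of m] y(1)] by (simp add: skorohod.commute)
      then have "skorohod_dist (G \<omega>) y < e" using n[OF that] y(3) k by linarith
      with e(2)[OF y(1)] y(2) show False by blast
    qed
    with \<omega>(1) show "\<omega> \<in> {\<omega> \<in> space M. \<exists>k n. \<forall>m\<in>{n..}. F m \<omega> \<notin> V k}" by blast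
  next
    fix \<omega> assume "\<omega> \<in> {\<omega> \<in> space M. \<exists>k n. \<forall>m\<in>{n..}. F m \<omega> \<notin> V k}"
    then obtain k n where \<omega>: "\<omega> \<in> space M" "\<And>m. m \<ge> n \<Longrightarrow> F m \<omega> \<notin> V k" by auto
    have "G \<omega> \<in> U"
    proof (rule ccontr)
      assume "G \<omega> \<notin> U"
      from LIMSEQ_D[OF lim[OF \<omega>(1)], of "1 / real (Suc k)"] obtain n' where
        n': "\<And>m. m \<ge> n' \<Longrightarrow> skorohod_dist (F m \<omega>) (G \<omega>) < 1 / real (Suc k)" by auto
      have "F (max n n') \<omega> \<in> V k"
        using n'[of "max n n'"] Fc[OF \<omega>(1)] G[OF \<omega>(1)] \<open>G \<omega> \<notin> U\<close> by (auto simp: V_def)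
      with \<omega>(2)[of "max n n'"] show False by simp
    qed
    with \<omega>(1) show "\<omega> \<in> G -` U \<inter> space M" by blast
  qed
  also have "\<dots> \<in> sets M"
  proof -
    have "{\<omega> \<in> space M. F m \<omega> \<notin> V k} \<in> sets M" for m k
    proof -
      have "F m -` V k \<inter> space M \<in> sets M"
        by (rule measurable_sets[OF F openin_imp_sets_borel_of[OF V]])
      then have "space M - (F m -` V k \<inter> space M) \<in> sets M" by auto
      also have "space M - (F m -` V k \<inter> space M) = {\<omega> \<in> space M. F m \<omega> \<notin> V k}" by auto
      finally show ?thesis .
    qed
    then show ?thesis by (intro sets.sets_Collect_countable_Ex sets.sets_Collect_countable_Ball) auto
  qed
  finally show "G -` U \<inter> space M \<in> sets M" .
qed

section \<open>The law of the correlated random walk\<close>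

definition unit_uniform :: "real measure" where
  "unit_uniform = uniform_measure lborel {0..1}"

lemma prob_space_unit_uniform: "prob_space unit_uniform"
  unfolding unit_uniform_def by (rule prob_space_uniform_measure) auto

lemma sets_unit_uniform [measurable_cong, simp]: "sets unit_uniform = sets borel"
  by (simp add: unit_uniform_def)

lemma space_unit_uniform [simp]: "space unit_uniform = UNIV"
  by (simp add: unit_uniform_def)

lemma measure_unit_uniform_atMost:
  assumes "p \<in> {0..1}"
  shows "measure unit_uniform {..p} = p"
proof -
  have "{0..1} \<inter> {..p} = {0..p}" using assms by auto
  then show ?thesis using assms by (simp add: unit_uniform_def)
qed

abbreviation uniforms :: "nat set \<Rightarrow> (nat \<Rightarrow> real) measure" where
  "uniforms I \<equiv> PiM I (\<lambda>_. unit_uniform)"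

lemma prob_space_uniforms: "prob_space (uniforms I)"
  by (intro prob_space_PiM prob_space_unit_uniform)

section \<open>Construction of the walk from independent uniform variables\<close>

definition flip :: "real \<Rightarrow> real \<Rightarrow> int" where
  "flip p u = (if u \<le> p then 1 else - 1)"

text \<open>\<open>crw_sign p u n\<close> is the step from time \<open>n\<close> to
  \<open>n + 1\<close>. The variable \<open>u 0\<close> tosses the fair first sign, each later one
  decides between repeating and reversing. The same uniforms drive the walks of all
  persistences.\<close>

primrec crw_sign :: "real \<Rightarrow> (nat \<Rightarrow> real) \<Rightarrow> nat \<Rightarrow> int" where
  "crw_sign p u 0 = flip (1/2) (u 0)"
| "crw_sign p u (Suc n) = crw_sign p u n * flip p (u (Suc n))"

definition crw :: "real \<Rightarrow> (nat \<Rightarrow> real) \<Rightarrow> nat \<Rightarrow> int" where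
  "crw p u n = (\<Sum>k<n. crw_sign p u k)"

lemma crw_sign_cases: "crw_sign p u n = 1 \<or> crw_sign p u n = - 1"
  by (induction n) (auto simp: flip_def)

lemma crw_sign_square: "crw_sign p u n * crw_sign p u n = 1"
  using crw_sign_cases[of p u n] by auto

lemma crw_step: "crw p u (Suc n) - crw p u n = crw_sign p u n"
  by (simp add: crw_def)

lemma abs_crw_le: "\<bar>crw p u n\<bar> \<le> int n"
proof -
  have "\<bar>crw p u n\<bar> \<le> (\<Sum>k<n. \<bar>crw_sign p u k\<bar>)" unfolding crw_def by (rule sum_abs)
  also have "\<dots> \<le> (\<Sum>k<n. 1)" using crw_sign_cases[of p u] by (intro sum_mono) (metis abs_1 abs_minus order_refl)
  finally show ?thesis by simp
qed

lemma crw_sign_cong: "(\<And>k. k \<le> n \<Longrightarrow> u k = v k) \<Longrightarrow> crw_sign p u n = crw_sign p v n"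
  by (induction n) auto

lemma crw_cong: "(\<And>k. k < n \<Longrightarrow> u k = v k) \<Longrightarrow> crw p u n = crw p v n"
  unfolding crw_def by (intro sum.cong refl crw_sign_cong) auto

lemma space_walk_space [simp]: "space walk_space = UNIV"
  by (auto simp: walk_space_def space_PiM)

lemma measurable_walk_coord [measurable]: "(\<lambda>x. x n) \<in> walk_space \<rightarrow>\<^sub>M count_space UNIV"
  unfolding walk_space_def by (rule measurable_component_singleton) simp

lemma measurable_count_space_binop:
  fixes f :: "'x \<Rightarrow> 'y::countable" and g :: "'x \<Rightarrow> 'z::countable"
  assumes f: "f \<in> M \<rightarrow>\<^sub>M count_space UNIV" and g: "g \<in> M \<rightarrow>\<^sub>M count_space UNIV"
  shows "(\<lambda>x. h (f x) (g x)) \<in> M \<rightarrow>\<^sub>M count_space UNIV"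
proof -
  have "(\<lambda>x. h i (g x)) \<in> M \<rightarrow>\<^sub>M count_space UNIV" for i
    by (rule measurable_compose[OF g]) simp
  then show ?thesis by (rule measurable_compose_countable[OF _ f])
qed

lemma sets_walk_repeat: "{x. x (Suc n) - x n = x n - x (n - 1)} \<in> sets walk_space"
proof -
  have "(\<lambda>x. x (Suc n) - x n = x n - x (n - 1)) \<in> walk_space \<rightarrow>\<^sub>M count_space UNIV"
    by (intro measurable_count_space_binop[where h="(=)"] measurable_count_space_binop[where h="(-)"]
        measurable_walk_coord)
  from measurable_sets[OF this, of "{True}"] show ?thesis by (simp add: vimage_def)
qed

text \<open>Joint measurability in \<open>p\<close> and the uniforms makes \<open>crw_law\<close> a
  kernel. The index set is arbitrary because the Markov property also runs the walk on an initial
  segment of the uniforms.\<close>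

lemma measurable_crw [measurable]:
  "(\<lambda>z. crw (fst z) (snd z)) \<in> borel \<Otimes>\<^sub>M uniforms I \<rightarrow>\<^sub>M walk_space"
proof -
  let ?M = "borel \<Otimes>\<^sub>M uniforms I"
  have u: "(\<lambda>z. snd z k) \<in> borel_measurable ?M" for k
  proof (cases "k \<in> I")
    case True
    then have "(\<lambda>z. snd z k) \<in> ?M \<rightarrow>\<^sub>M unit_uniform" by measurable
    then show ?thesis by (simp cong: measurable_cong_sets)
  next
    case False
    \<comment> \<open>Outside \<open>I\<close> every point of the product space has the constant
      value \<open>undefined\<close>.\<close>
    have "(\<lambda>z. undefined) \<in> borel_measurable ?M" by simp
    then show ?thesis
      by (rule measurable_cong[THEN iffD1, rotated])
         (use False in \<open>auto simp: space_pair_measure space_PiM PiE_def extensional_def\<close>)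
  qed
  have flip: "(\<lambda>z. flip (q z) (v z)) \<in> ?M \<rightarrow>\<^sub>M count_space UNIV"
    if [measurable]: "q \<in> borel_measurable ?M" "v \<in> borel_measurable ?M" for q v
    unfolding flip_def by measurable
  have sign: "(\<lambda>z. crw_sign (fst z) (snd z) k) \<in> ?M \<rightarrow>\<^sub>M count_space UNIV" for k
  proof (induction k)
    case 0
    show ?case by (simp, intro flip u) simp
  next
    case (Suc k)
    show ?case unfolding crw_sign.simps
      by (rule measurable_count_space_binop[OF Suc flip[OF _ u]]) simp
  qed
  have "(\<lambda>z. crw (fst z) (snd z) k) \<in> ?M \<rightarrow>\<^sub>M count_space UNIV" for k
  proof (induction k)
    case 0
    show ?case by (simp add: crw_def)
  next
    case (Suc k)
    show ?case using measurable_count_space_binop[OF Suc sign, of "(+)" k] by (simp add: crw_def)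
  qed
  then show ?thesis
    unfolding walk_space_def by (intro measurable_PiM_single') auto
qed

lemma measurable_crw' [measurable]: "crw p \<in> uniforms I \<rightarrow>\<^sub>M walk_space"
proof -
  have "(\<lambda>u. (p, u)) \<in> uniforms I \<rightarrow>\<^sub>M borel \<Otimes>\<^sub>M uniforms I" by simp
  from measurable_compose[OF this measurable_crw] show ?thesis by simp
qed

definition crw_law :: "real \<Rightarrow> (nat \<Rightarrow> int) measure" where
  "crw_law p = distr (uniforms UNIV) walk_space (crw p)"

lemma sets_crw_law [simp, measurable_cong]: "sets (crw_law p) = sets walk_space"
  by (simp add: crw_law_def)

lemma space_crw_law [simp]: "space (crw_law p) = UNIV"
  by (simp add: crw_law_def)

lemma prob_space_crw_law: "prob_space (crw_law p)"
  unfolding crw_law_def by (intro prob_space.prob_space_distr prob_space_uniforms measurable_crw')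

lemma indep_vars_uniforms:
  "prob_space.indep_vars (uniforms UNIV) (\<lambda>_. unit_uniform) (\<lambda>i u. u i) UNIV"
  by (rule indep_vars_PiM_coordinates) (auto intro: prob_space_unit_uniform)

lemma measure_uniforms_coord:
  assumes "p \<in> {0..1}"
  shows "measure (uniforms UNIV) {u. u n \<le> p} = p"
proof -
  have "measure unit_uniform {..p} = measure (distr (uniforms UNIV) unit_uniform (\<lambda>u. u n)) {..p}"
    by (subst distr_PiM_component) (auto intro: prob_space_unit_uniform)
  also have "\<dots> = measure (uniforms UNIV) ((\<lambda>u. u n) -` {..p} \<inter> space (uniforms UNIV))"
    by (rule measure_distr) auto
  also have "(\<lambda>u. u n) -` {..p} \<inter> space (uniforms UNIV) = {u. u n \<le> p}"
    by (auto simp: space_PiM)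
  finally show ?thesis using measure_unit_uniform_atMost[OF assms] by simp
qed

section \<open>Histories and the Markov property\<close>

lemma sets_history:
  "sets (history M X n) =
     sigma_sets (space M) (\<Union>k\<in>{..n}. {X k -` A \<inter> space M | A. A \<in> UNIV})"
  unfolding history_def by (rule sets_measure_of) auto

text \<open>True for the generators, and preserved by complements and countable unions.\<close>

lemma history_coordinate_determined:
  assumes "space P = UNIV" "A \<in> sets (history P (\<lambda>n x. x n) n)" "\<And>k. k \<le> n \<Longrightarrow> x k = y k"
  shows "x \<in> A \<longleftrightarrow> y \<in> A"
  using assms(2) unfolding sets_history
proof induction
  case (Basic a)
  then show ?case using assms(1,3) by auto
next
  case Empty
  then show ?case by simp
next
  case (Compl a)
  then show ?case using assms(1) by auto
next
  case (Union a)
  then show ?case by blast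
qed

lemma subalgebra_history:
  assumes "\<And>k. X k \<in> M \<rightarrow>\<^sub>M count_space UNIV"
  shows "subalgebra M (history M X n)"
  unfolding subalgebra_def
proof
  show "space (history M X n) = space M" unfolding history_def by (rule space_measure_of) auto
  show "sets (history M X n) \<subseteq> sets M"
    unfolding sets_history
    by (rule sets.sigma_sets_subset) (auto intro: measurable_sets[OF assms])
qed

text \<open>The conditional expectation in the definition of a correlated random walk only enters through
  this integrated form.\<close>

lemma cond_exp_indicator_const_iff:
  assumes "prob_space M" and sub: "subalgebra M F" and S: "S \<in> sets M"
  shows "(AE x in M. real_cond_exp M F (indicator S) x = p) \<longleftrightarrow>
    (\<forall>A\<in>sets F. measure M (A \<inter> S) = p * measure M A)"
proof -
  interpret prob_space M by fact
  interpret finite_measure_subalgebra M F by standard (rule sub)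
  have AM: "A \<in> sets M" if "A \<in> sets F" for A using sub that by (auto simp: subalgebra_def)
  have iS: "integrable M (indicator S :: _ \<Rightarrow> real)" using S by (simp add: emeasure_eq_measure)
  have 1: "(\<integral>x\<in>A. indicator S x \<partial>M) = measure M (A \<inter> S)" if "A \<in> sets F" for A
    using AM[OF that] S unfolding set_lebesgue_integral_def
    by (simp add: indicator_inter_arith[symmetric])
  have 2: "(\<integral>x\<in>A. p \<partial>M) = p * measure M A" if "A \<in> sets F" for A
    using AM[OF that] unfolding set_lebesgue_integral_def by simp
  show ?thesis
  proof
    assume AE: "AE x in M. real_cond_exp M F (indicator S) x = p"
    show "\<forall>A\<in>sets F. measure M (A \<inter> S) = p * measure M A"
    proof
      fix A assume A: "A \<in> sets F"
      have "measure M (A \<inter> S) = (\<integral>x\<in>A. real_cond_exp M F (indicator S) x \<partial>M)"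
        unfolding 1[OF A, symmetric] by (rule real_cond_exp_intA[OF iS A])
      also have "\<dots> = (\<integral>x\<in>A. p \<partial>M)"
        unfolding set_lebesgue_integral_def
        using AE by (intro integral_cong_AE) (use AM[OF A] in auto)
      finally show "measure M (A \<inter> S) = p * measure M A" using 2[OF A] by simp
    qed
  next
    assume "\<forall>A\<in>sets F. measure M (A \<inter> S) = p * measure M A"
    then show "AE x in M. real_cond_exp M F (indicator S) x = p"
      using 1 2 iS by (intro real_cond_exp_charact) auto
  qed
qed

text \<open>An event of the history up to time \<open>n\<close> depends on the uniforms with index
  below \<open>n\<close> only, and the step is repeated exactly when \<open>u n \<le> p\<close>.
  Independence of the two produces the factor \<open>p\<close>.\<close>

lemma crw_law_markov:
  assumes p: "p \<in> {0..1}" and n: "n \<ge> 1"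
    and A: "A \<in> sets (history (crw_law p) (\<lambda>n x. x n) n)"
  shows "measure (crw_law p) (A \<inter> {x. x (Suc n) - x n = x n - x (n - 1)}) = p * measure (crw_law p) A"
proof -
  interpret prob_space "uniforms UNIV" by (rule prob_space_uniforms)
  let ?S = "{x :: nat \<Rightarrow> int. x (Suc n) - x n = x n - x (n - 1)}"
  obtain m where m: "n = Suc m" using n by (cases n) auto
  have AM: "A \<in> sets walk_space"
    using A subalgebra_history[of "\<lambda>n x. x n" "crw_law p" n] by (auto simp: subalgebra_def)
  have S: "?S \<in> sets walk_space" by (rule sets_walk_repeat)
  have crwS: "crw p u \<in> ?S \<longleftrightarrow> u n \<le> p" for u
    using crw_sign_cases[of p u m] unfolding mem_Collect_eq crw_step m diff_Suc_1
    by (auto simp: flip_def)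
  have crwA: "crw p u \<in> A \<longleftrightarrow> crw p (restrict u {..<n}) \<in> A" for u
    by (rule history_coordinate_determined[OF _ A]) (auto intro!: crw_cong)
  have ind: "indep_var (uniforms {..<n}) (\<lambda>u. restrict u {..<n}) (uniforms {n}) (\<lambda>u. restrict u {n})"
    using indep_var_restrict[OF indep_vars_uniforms, of "{..<n}" "{n}"] by simp
  let ?A = "crw p -` A \<inter> space (uniforms {..<n})"
  let ?B = "{w \<in> space (uniforms {n}). w n \<le> p}"
  have A': "?A \<in> sets (uniforms {..<n})" by (rule measurable_sets[OF measurable_crw' AM])
  have B': "?B \<in> sets (uniforms {n})" by measurable
  have sp: "space (uniforms I) = (\<Pi>\<^sub>E i\<in>I. UNIV)" for I by (simp add: space_PiM)
  have "measure (crw_law p) (A \<inter> ?S) = prob (crw p -` (A \<inter> ?S) \<inter> space (uniforms UNIV))"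
    unfolding crw_law_def using AM S by (intro measure_distr) auto
  also have "crw p -` (A \<inter> ?S) \<inter> space (uniforms UNIV) =
      (\<lambda>u. (restrict u {..<n}, restrict u {n})) -` (?A \<times> ?B) \<inter> space (uniforms UNIV)"
    using crwS crwA by (auto simp: sp)
  also have "prob \<dots> = prob ((\<lambda>u. restrict u {..<n}) -` ?A \<inter> space (uniforms UNIV)) *
      prob ((\<lambda>u. restrict u {n}) -` ?B \<inter> space (uniforms UNIV))"
    by (rule indep_varD[OF ind A' B'])
  also have "(\<lambda>u. restrict u {..<n}) -` ?A \<inter> space (uniforms UNIV) =
      crw p -` A \<inter> space (uniforms UNIV)"
    using crwA by (auto simp: sp)
  also have "(\<lambda>u. restrict u {n}) -` ?B \<inter> space (uniforms UNIV) = {u. u n \<le> p}"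
    by (auto simp: sp)
  also have "prob (crw p -` A \<inter> space (uniforms UNIV)) = measure (crw_law p) A"
    unfolding crw_law_def using AM by (intro measure_distr[symmetric]) auto
  finally show ?thesis using measure_uniforms_coord[OF p] by simp
qed

lemma correlated_random_walk_crw_law:
  assumes p: "p \<in> {0..1}"
  shows "correlated_random_walk p (crw_law p) (\<lambda>n x. x n)"
proof -
  interpret U: prob_space "uniforms UNIV" by (rule prob_space_uniforms)
  have coord: "(\<lambda>x. x n) \<in> crw_law p \<rightarrow>\<^sub>M count_space UNIV" for n by measurable
  have AE: "AE x in crw_law p. P x" if "{x. P x} \<in> sets walk_space" "\<And>u. P (crw p u)" for P
    unfolding crw_law_def using that by (subst AE_distr_iff) auto
  have step: "(\<lambda>x. x (Suc n) - x n) \<in> walk_space \<rightarrow>\<^sub>M count_space UNIV" for n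
    by (intro measurable_count_space_binop[where h="(-)"] measurable_walk_coord)
  have half: "measure (crw_law p) {x. x 1 = 1} = 1 / 2"
    "measure (crw_law p) {x. x 1 = - 1} = 1 / 2"
  proof -
    have s: "{x. x 1 = c} \<in> sets walk_space" for c :: int
      using measurable_sets[OF measurable_walk_coord[of 1], of "{c}"] by (simp add: vimage_def)
    have d: "measure (crw_law p) {x. x 1 = c} = U.prob {u. crw p u 1 = c}" for c
      unfolding crw_law_def using s by (subst measure_distr) (auto simp: vimage_def space_PiM)
    have h: "U.prob {u. u 0 \<le> 1/2} = 1/2" by (rule measure_uniforms_coord) simp
    have "{u. crw p u 1 = 1} = {u. u 0 \<le> 1/2}" by (auto simp: crw_def flip_def)
    with h show "measure (crw_law p) {x. x 1 = 1} = 1 / 2"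
      unfolding d by (simp only:)
    have "{u. crw p u 1 = - 1} = space (uniforms UNIV) - {u. u 0 \<le> 1/2}"
      by (auto simp: crw_def flip_def space_PiM)
    moreover have "{u \<in> space (uniforms UNIV). u 0 \<le> 1/2} \<in> U.events" by measurable
    then have "{u. u 0 \<le> 1/2} \<in> U.events" by (simp add: space_PiM)
    ultimately show "measure (crw_law p) {x. x 1 = - 1} = 1 / 2"
      unfolding d using U.prob_compl[of "{u. u 0 \<le> 1/2}"] h by (simp only:)
  qed
  have "AE x in crw_law p. real_cond_exp (crw_law p) (history (crw_law p) (\<lambda>n x. x n) n)
      (indicator {x \<in> space (crw_law p). walk_step (\<lambda>n x. x n) (n + 1) x = walk_step (\<lambda>n x. x n) n x}) x = p"
    if n: "n \<ge> 1" for n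
  proof (subst cond_exp_indicator_const_iff[OF prob_space_crw_law subalgebra_history[OF coord]])
    have eq: "{x \<in> space (crw_law p). walk_step (\<lambda>n x. x n) (n + 1) x = walk_step (\<lambda>n x. x n) n x} =
        {x. x (Suc n) - x n = x n - x (n - 1)}"
      by (auto simp: walk_step_def)
    show "{x \<in> space (crw_law p). walk_step (\<lambda>n x. x n) (n + 1) x = walk_step (\<lambda>n x. x n) n x}
        \<in> sets (crw_law p)" unfolding eq sets_crw_law by (rule sets_walk_repeat)
    show "\<forall>A\<in>sets (history (crw_law p) (\<lambda>n x. x n) n). measure (crw_law p)
        (A \<inter> {x \<in> space (crw_law p). walk_step (\<lambda>n x. x n) (n + 1) x = walk_step (\<lambda>n x. x n) n x}) =
        p * measure (crw_law p) A"
      unfolding eq using crw_law_markov[OF p n] by blast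
  qed
  moreover have "AE x in crw_law p. walk_step (\<lambda>n x. x n) n x = 1 \<or> walk_step (\<lambda>n x. x n) n x = - 1"
    if n: "n \<ge> 1" for n
  proof (rule AE)
    obtain m where m: "n = Suc m" using n by (cases n) auto
    show "{x. walk_step (\<lambda>n x. x n) n x = 1 \<or> walk_step (\<lambda>n x. x n) n x = - 1} \<in> sets walk_space"
      using measurable_sets[OF step[of m], of "{1, - 1}"] unfolding m walk_step_def
      by (simp add: vimage_def)
    show "walk_step (\<lambda>n x. x n) n (crw p u) = 1 \<or> walk_step (\<lambda>n x. x n) n (crw p u) = - 1" for u
      using crw_sign_cases[of p u m] by (simp add: walk_step_def m crw_step)
  qed
  moreover have "AE x in crw_law p. x 0 = 0"
    using measurable_sets[OF measurable_walk_coord[of 0], of "{0}"]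
    by (intro AE) (auto simp: vimage_def crw_def)
  ultimately show ?thesis
    unfolding correlated_random_walk_def using prob_space_crw_law coord half by simp
qed

section \<open>Uniqueness of the law of the walk\<close>

definition cylinder :: "(nat \<Rightarrow> int) \<Rightarrow> nat \<Rightarrow> (nat \<Rightarrow> int) set" where
  "cylinder v n = {x. \<forall>k\<le>n. x k = v k}"

lemma cylinder_Suc: "cylinder v (Suc n) = cylinder v n \<inter> {x. x (Suc n) = v (Suc n)}"
  by (auto simp: cylinder_def le_Suc_eq)

lemma sets_walk_coord_eq: "{x. x n = c} \<in> sets walk_space"
  using measurable_sets[OF measurable_walk_coord[of n], of "{c}"] by (simp add: vimage_def)

lemma sets_cylinder: "cylinder v n \<in> sets walk_space"
proof (induction n)
  case 0
  show ?case using sets_walk_coord_eq[of 0] by (simp add: cylinder_def)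
next
  case (Suc n)
  show ?case unfolding cylinder_Suc by (intro sets.Int Suc sets_walk_coord_eq)
qed

lemma cylinder_in_history:
  assumes "space P = UNIV"
  shows "cylinder v n \<in> sets (history P (\<lambda>n x. x n) n)"
proof -
  let ?H = "history P (\<lambda>n x. x n) n"
  have sp: "space ?H = UNIV" unfolding history_def using assms by (subst space_measure_of) auto
  have one: "{x. x k = v k} \<in> sets ?H" if "k \<le> n" for k
    unfolding sets_history
    by (rule sigma_sets.Basic) (use that assms in \<open>auto intro!: bexI[of _ k] exI[of _ "{v k}"]\<close>)
  have "(\<Inter>k\<in>{..n}. {x. x k = v k}) \<in> sets ?H"
    by (intro sets.finite_INT one) auto
  also have "(\<Inter>k\<in>{..n}. {x. x k = v k}) = cylinder v n" by (auto simp: cylinder_def)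
  finally show ?thesis .
qed

text \<open>The transition probability from the prefix of \<open>v\<close> to its next value:
  repeat, reverse, or impossible. It does not mention the measure, which is what forces
  uniqueness.\<close>

definition step_weight :: "real \<Rightarrow> (nat \<Rightarrow> int) \<Rightarrow> nat \<Rightarrow> real" where
  "step_weight p v n =
    (if v (Suc n) - v n = v n - v (n - 1) then p
     else if v (Suc n) - v n = - (v n - v (n - 1)) then 1 - p else 0)"

text \<open>The conditional expectation prices the repetition of a step. Steps are almost surely
  units, so not repeating means reversing, which gets the rest \<open>1 - p\<close>; a prefix ending
  in a non-unit step is null, and so are its extensions.\<close>

lemma correlated_random_walk_cylinder_Suc:
  assumes crw: "correlated_random_walk p P (\<lambda>n x. x n)" and P: "sets P = sets walk_space"
    and n: "n \<ge> 1"
  shows "measure P (cylinder v (Suc n)) = step_weight p v n * measure P (cylinder v n)"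
proof -
  interpret prob_space P using crw by (simp add: correlated_random_walk_def)
  have sp: "space P = UNIV" using sets_eq_imp_space_eq[OF P] by simp
  have cyl: "cylinder v k \<in> events" for k using sets_cylinder P by simp
  have coord: "(\<lambda>x. x k) \<in> P \<rightarrow>\<^sub>M count_space UNIV" for k
    using measurable_walk_coord P by (simp cong: measurable_cong_sets)
  obtain m where m: "n = Suc m" using n by (cases n) auto
  let ?S = "{x. x (Suc n) - x n = x n - x (n - 1)}"
  have S: "?S \<in> events" using sets_walk_repeat P by simp
  have "AE x in P. real_cond_exp P (history P (\<lambda>n x. x n) n) (indicator ?S) x = p"
    using crw n sp unfolding correlated_random_walk_def walk_step_def by simp
  then have markov: "prob (cylinder v n \<inter> ?S) = p * prob (cylinder v n)"
    using cond_exp_indicator_const_iff[OF prob_space_axioms subalgebra_history[where X="\<lambda>n x. x n", OF coord] S]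
      cylinder_in_history[OF sp] by blast
  have unit: "AE x in P. (x (Suc k) - x k = 1 \<or> x (Suc k) - x k = - 1)" for k
  proof -
    have "Suc k \<ge> 1" by simp
    with crw have "AE x in P. walk_step (\<lambda>n x. x n) (Suc k) x = 1 \<or> walk_step (\<lambda>n x. x n) (Suc k) x = - 1"
      unfolding correlated_random_walk_def by blast
    then show ?thesis by (simp add: walk_step_def)
  qed
  let ?d = "v n - v (n - 1)" and ?e = "v (Suc n) - v n"
  consider "\<bar>?d\<bar> \<noteq> 1" | "\<bar>?d\<bar> = 1" "?e = ?d" | "\<bar>?d\<bar> = 1" "?e = - ?d" | "\<bar>?d\<bar> = 1" "?e \<noteq> ?d" "?e \<noteq> - ?d"
    by blast
  then show ?thesis
  proof cases
    case 1
    have "AE x in P. x \<notin> cylinder v n"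
      using unit[of m]
    proof eventually_elim
      case (elim x)
      show ?case
      proof
        assume "x \<in> cylinder v n"
        then have "x n = v n" "x m = v m" using m by (auto simp: cylinder_def)
        with elim 1 m show False by auto
      qed
    qed
    then have z: "prob (cylinder v n) = 0" using cyl[of n] by (simp add: prob_eq_0)
    have "prob (cylinder v (Suc n)) \<le> prob (cylinder v n)"
      unfolding cylinder_Suc by (rule finite_measure_mono[OF _ cyl]) auto
    with z show ?thesis by (simp add: measure_le_0_iff)
  next
    case 2
    have "cylinder v (Suc n) = cylinder v n \<inter> ?S"
      unfolding cylinder_Suc using 2(2) m by (auto simp: cylinder_def)
    then show ?thesis using markov 2 by (simp add: step_weight_def)
  next
    case 3
    have "prob (cylinder v (Suc n)) = prob (cylinder v n - ?S)"
    proof (rule finite_measure_eq_AE)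
      show "AE x in P. x \<in> cylinder v (Suc n) \<longleftrightarrow> x \<in> cylinder v n - ?S"
        using unit[of n]
      proof eventually_elim
        case (elim x)
        show ?case unfolding cylinder_Suc using 3 m elim by (auto simp: cylinder_def)
      qed
    qed (use cyl S in auto)
    also have "\<dots> = prob (cylinder v n) - prob (cylinder v n \<inter> ?S)"
      using cyl S by (intro finite_measure_Diff')
    also have "\<dots> = (1 - p) * prob (cylinder v n)" unfolding markov by (simp add: algebra_simps)
    finally show ?thesis using 3 by (auto simp: step_weight_def)
  next
    case 4
    have "AE x in P. x \<notin> cylinder v (Suc n)"
      using unit[of n]
    proof eventually_elim
      case (elim x)
      show ?case
      proof
        assume "x \<in> cylinder v (Suc n)"
        then have "x (Suc n) = v (Suc n)" "x n = v n" by (auto simp: cylinder_def)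
        with elim 4 show False by auto
      qed
    qed
    then have "prob (cylinder v (Suc n)) = 0" using cyl[of "Suc n"] by (simp add: prob_eq_0)
    then show ?thesis using 4 by (simp add: step_weight_def)
  qed
qed

lemma correlated_random_walk_cylinder_1:
  assumes crw: "correlated_random_walk p P (\<lambda>n x. x n)" and P: "sets P = sets walk_space"
  shows "measure P (cylinder v 1) = (if v 0 = 0 \<and> \<bar>v 1\<bar> = 1 then 1 / 2 else 0)"
proof -
  interpret prob_space P using crw by (simp add: correlated_random_walk_def)
  have sp: "space P = UNIV" using sets_eq_imp_space_eq[OF P] by simp
  have cyl: "cylinder v k \<in> events" for k using sets_cylinder P by simp
  have zero: "AE x in P. x 0 = 0" using crw by (simp add: correlated_random_walk_def)
  have "AE x in P. walk_step (\<lambda>n x. x n) 1 x = 1 \<or> walk_step (\<lambda>n x. x n) 1 x = - 1"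
    using crw unfolding correlated_random_walk_def by blast
  then have unit: "AE x in P. (x 1 - x 0 = 1 \<or> x 1 - x 0 = - 1)" by (simp add: walk_step_def)
  have half: "prob {x. x 1 = 1} = 1 / 2" "prob {x. x 1 = - 1} = 1 / 2"
    using crw sp by (simp_all add: correlated_random_walk_def)
  show ?thesis
  proof (cases "v 0 = 0 \<and> \<bar>v 1\<bar> = 1")
    case True
    have "prob (cylinder v 1) = prob {x. x 1 = v 1}"
    proof (rule finite_measure_eq_AE)
      show "AE x in P. x \<in> cylinder v 1 \<longleftrightarrow> x \<in> {x. x 1 = v 1}"
        using zero by eventually_elim (use True in \<open>auto simp: cylinder_def le_Suc_eq\<close>)
    qed (use cyl P sets_walk_coord_eq in auto)
    also have "\<dots> = 1 / 2"
    proof -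
      have "v 1 = 1 \<or> v 1 = - 1" using True by linarith
      then show ?thesis using half by auto
    qed
    finally show ?thesis using True by simp
  next
    case False
    have "AE x in P. x \<notin> cylinder v 1"
      using zero unit by eventually_elim (use False in \<open>auto simp: cylinder_def\<close>)
    then show ?thesis using False cyl[of 1] by (auto simp: prob_eq_0)
  qed
qed

lemma correlated_random_walk_cylinder_unique:
  assumes "correlated_random_walk p P (\<lambda>n x. x n)" "sets P = sets walk_space"
    and "correlated_random_walk p Q (\<lambda>n x. x n)" "sets Q = sets walk_space"
    and "n \<ge> 1"
  shows "measure P (cylinder v n) = measure Q (cylinder v n)"
  using \<open>n \<ge> 1\<close>
proof (induction n rule: nat_induct_at_least)
  case base
  show ?case using assms by (simp only: correlated_random_walk_cylinder_1)
next
  case (Suc n)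
  then show ?case using assms by (simp only: correlated_random_walk_cylinder_Suc)
qed

lemma measurable_walk_prefix:
  "(\<lambda>x. map x [0..<n]) \<in> walk_space \<rightarrow>\<^sub>M count_space UNIV"
proof (induction n)
  case 0
  show ?case by simp
next
  case (Suc n)
  show ?case
    using measurable_count_space_binop[OF Suc measurable_walk_coord[of n], of "\<lambda>l a. l @ [a]"] by simp
qed

lemma vimage_walk_prefix:
  "(\<lambda>x. map x [0..<Suc n]) -` {l} = (if length l = Suc n then cylinder (\<lambda>k. l ! k) n else {})"
  by (auto simp: cylinder_def list_eq_iff_nth_eq less_Suc_eq_le nth_append)

text \<open>The list of the first values of the walk lies in a countable type, so agreement on
  cylinders gives agreement of its law. Every generator of the product sigma-algebra is a preimage
  under such a list.\<close>

lemma correlated_random_walk_unique: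
  assumes P: "correlated_random_walk p P (\<lambda>n x. x n)" "sets P = sets walk_space"
    and Q: "correlated_random_walk p Q (\<lambda>n x. x n)" "sets Q = sets walk_space"
  shows "P = Q"
proof (rule measure_eqI_PiM_infinite)
  show "sets P = PiM UNIV (\<lambda>_. count_space UNIV)" "sets Q = PiM UNIV (\<lambda>_. count_space UNIV)"
    using P(2) Q(2) by (simp_all add: walk_space_def)
  interpret P: prob_space P using P(1) by (simp add: correlated_random_walk_def)
  interpret Q: prob_space Q using Q(1) by (simp add: correlated_random_walk_def)
  show "finite_measure P" by (rule P.finite_measure_axioms)
  have sp: "space P = UNIV" "space Q = UNIV"
    using sets_eq_imp_space_eq[OF P(2)] sets_eq_imp_space_eq[OF Q(2)] by simp_all
  fix A :: "nat \<Rightarrow> int set" and J :: "nat set" assume J: "finite J"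
  \<comment> \<open>At least 1, where the recursion for the cylinder probabilities starts.\<close>
  obtain n where n: "\<And>j. j \<in> J \<Longrightarrow> j \<le> n" "n \<ge> 1"
  proof -
    obtain k where "J \<subseteq> {..k}" using finite_nat_set_iff_bounded_le[THEN iffD1, OF J] by auto
    then show thesis by (intro that[of "Suc k"]) auto
  qed
  let ?f = "\<lambda>x :: nat \<Rightarrow> int. map x [0..<Suc n]"
  have fP: "?f \<in> P \<rightarrow>\<^sub>M count_space UNIV" and fQ: "?f \<in> Q \<rightarrow>\<^sub>M count_space UNIV"
    using measurable_walk_prefix[of "Suc n"] P(2) Q(2) by (simp_all only: cong: measurable_cong_sets)
  have "distr P (count_space UNIV) ?f = distr Q (count_space UNIV) ?f"
  proof (rule measure_eqI_countable[of _ UNIV])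
    fix l :: "int list"
    have "measure P (?f -` {l}) = measure Q (?f -` {l})"
      unfolding vimage_walk_prefix using correlated_random_walk_cylinder_unique[OF P Q n(2)] by simp
    then show "emeasure (distr P (count_space UNIV) ?f) {l} = emeasure (distr Q (count_space UNIV) ?f) {l}"
      using fP fQ sp by (simp add: emeasure_distr P.emeasure_eq_measure Q.emeasure_eq_measure del: upt_Suc)
  qed auto
  then have "emeasure (distr P (count_space UNIV) ?f) {l. \<forall>j\<in>J. l ! j \<in> A j} =
    emeasure (distr Q (count_space UNIV) ?f) {l. \<forall>j\<in>J. l ! j \<in> A j}" by simp
  then have "emeasure P (?f -` {l. \<forall>j\<in>J. l ! j \<in> A j}) = emeasure Q (?f -` {l. \<forall>j\<in>J. l ! j \<in> A j})"
    using fP fQ sp by (simp add: emeasure_distr del: upt_Suc)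
  moreover have "?f -` {l. \<forall>j\<in>J. l ! j \<in> A j} = prod_emb UNIV (\<lambda>_. count_space UNIV) J (Pi\<^sub>E J A)"
  proof -
    have "(\<forall>j\<in>J. map x [0..<Suc n] ! j \<in> A j) \<longleftrightarrow> (\<forall>j\<in>J. x j \<in> A j)" for x :: "nat \<Rightarrow> int"
      using n(1) by (intro ball_cong refl) (simp add: less_Suc_eq_le del: upt_Suc)
    then show ?thesis by (auto simp: prod_emb_def space_PiM PiE_iff simp del: upt_Suc)
  qed
  ultimately show "emeasure P (prod_emb UNIV (\<lambda>_. count_space UNIV) J (Pi\<^sub>E J A)) =
    emeasure Q (prod_emb UNIV (\<lambda>_. count_space UNIV) J (Pi\<^sub>E J A))" by (simp only:)
qed

lemma walk_law_eq_crw_law: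
  assumes "p \<in> {0..1}"
  shows "walk_law p = crw_law p"
  unfolding walk_law_def
  by (rule the_equality)
     (auto intro: correlated_random_walk_crw_law[OF assms] correlated_random_walk_unique
        [OF _ _ correlated_random_walk_crw_law[OF assms]])

section \<open>Covariance of the annealed walk\<close>

lemma emeasure_restrict_half:
  "emeasure (restrict_space lborel {0..1}) {1/2..1::real} = ennreal (1/2)"
  by (subst emeasure_restrict_space) auto

lemma \<mu>_half_eq_density:
  "\<mu>_half = density (restrict_space lborel {0..1}) (\<lambda>p. ennreal (2 * indicator {1/2..1} p))"
proof -
  have "ennreal 1 / ennreal (1 / 2) = ennreal (1 / (1 / 2))" by (rule divide_ennreal) auto
  moreover have "1 / (1 / 2) = (2 :: real)" by simp
  ultimately have two: "1 / ennreal (1 / 2) = ennreal 2" by (simp only: ennreal_1)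
  show ?thesis
    unfolding \<mu>_half_def uniform_measure_def emeasure_restrict_half
    by (intro arg_cong2[where f=density] refl ext, unfold indicator_def of_bool_def)
       (simp only: two split: if_split, simp)
qed

lemma space_\<mu>_half [simp]: "space \<mu>_half = {0..1}"
  by (simp add: \<mu>_half_def space_restrict_space)

lemma prob_space_\<mu>_half: "prob_space \<mu>_half"
  unfolding \<mu>_half_def
  by (rule prob_space_uniform_measure) (simp_all only: emeasure_restrict_half, simp_all)

lemma measurable_\<mu>_half: "f \<in> borel_measurable borel \<Longrightarrow> f \<in> borel_measurable \<mu>_half"
  unfolding \<mu>_half_def
  by (subst measurable_cong_sets[OF sets_uniform_measure refl])
     (intro measurable_restrict_space1, simp)

lemma integral_\<mu>_half_power: "(\<integral>p. (2 * p - 1) ^ k \<partial>\<mu>_half) = 1 / (real k + 1)"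
proof -
  have "(\<integral>p. (2 * p - 1) ^ k \<partial>\<mu>_half) =
    (\<integral>p. (2 * indicator {1/2..1} p) *\<^sub>R (2 * p - 1) ^ k \<partial>restrict_space lborel {0..1})"
    unfolding \<mu>_half_eq_density
    by (rule integral_density) (auto intro!: measurable_restrict_space1)
  also have "\<dots> = (\<integral>p. indicator {0..1} p *\<^sub>R ((2 * indicator {1/2..1} p) *\<^sub>R (2 * p - 1) ^ k) \<partial>lborel)"
    by (rule integral_restrict_space) simp
  also have "\<dots> = (\<integral>p. (2 * (2 * p - 1) ^ k) * indicator {1/2..1} p \<partial>lborel)"
    by (intro Bochner_Integration.integral_cong) (auto simp: indicator_def)
  also have "\<dots> = (2 * 1 - 1) ^ Suc k / (real k + 1) - (2 * (1/2) - 1) ^ Suc k / (real k + 1)"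
  proof (rule integral_FTC_Icc_real)
    fix x :: real
    have "((\<lambda>x. (2 * x - 1) ^ Suc k / (real k + 1)) has_real_derivative
        (real (Suc k) * (2 * x - 1) ^ k * 2) / (real k + 1)) (at x)"
      by (auto intro!: derivative_eq_intros simp: mult_ac simp del: power_Suc)
    also have "(real (Suc k) * (2 * x - 1) ^ k * 2) / (real k + 1) = 2 * (2 * x - 1) ^ k"
      by (simp add: field_simps)
    finally show "((\<lambda>x. (2 * x - 1) ^ Suc k / (real k + 1)) has_real_derivative 2 * (2 * x - 1) ^ k) (at x)" .
    show "isCont (\<lambda>x. 2 * (2 * x - 1) ^ k) x" by (intro continuous_intros)
  qed simp
  finally show ?thesis by simp
qed

section \<open>Integration under the annealed law\<close>

abbreviation annealed :: "(nat \<Rightarrow> int) measure" where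
  "annealed \<equiv> annealed_law \<mu>_half"

lemma measurable_crw_law: "crw_law \<in> \<mu>_half \<rightarrow>\<^sub>M subprob_algebra walk_space"
  unfolding crw_law_def
proof (rule measurable_distr2)
  have "(\<lambda>z. (fst z, snd z)) \<in> \<mu>_half \<Otimes>\<^sub>M uniforms UNIV \<rightarrow>\<^sub>M borel \<Otimes>\<^sub>M uniforms UNIV"
    using measurable_\<mu>_half[of "\<lambda>x. x"]
    by (intro measurable_Pair measurable_compose[OF measurable_fst] measurable_snd) auto
  from measurable_compose[OF this measurable_crw]
  show "case_prod crw \<in> \<mu>_half \<Otimes>\<^sub>M uniforms UNIV \<rightarrow>\<^sub>M walk_space"
    by (simp add: case_prod_beta')
  show "(\<lambda>p. uniforms UNIV) \<in> \<mu>_half \<rightarrow>\<^sub>M subprob_algebra (uniforms UNIV)"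
    by (rule measurable_const)
       (simp add: space_subprob_algebra prob_space_imp_subprob_space prob_space_uniforms)
qed

lemma annealed_eq_bind: "annealed = \<mu>_half \<bind> crw_law"
  unfolding annealed_law_def by (rule bind_cong) (auto simp: walk_law_eq_crw_law)

lemma sets_annealed [simp, measurable_cong]: "sets annealed = sets walk_space"
  unfolding annealed_eq_bind by (rule sets_bind_measurable[OF measurable_crw_law]) simp

lemma space_annealed [simp]: "space annealed = UNIV"
  using sets_eq_imp_space_eq[OF sets_annealed] by simp

lemma prob_space_annealed: "prob_space annealed"
  unfolding annealed_eq_bind
  by (rule prob_space.prob_space_bind[OF prob_space_\<mu>_half _ measurable_crw_law])
     (simp add: prob_space_crw_law)

lemma sets_walk_bounded: "{x. \<forall>n. \<bar>x n\<bar> \<le> int n} \<in> sets walk_space"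
proof -
  have "{x. \<bar>x n\<bar> \<le> int n} \<in> sets walk_space" for n
    using measurable_sets[OF measurable_walk_coord[of n], of "{c. \<bar>c\<bar> \<le> int n}"]
    by (simp add: vimage_def)
  then have "(\<Inter>n. {x. \<bar>x n\<bar> \<le> int n}) \<in> sets walk_space" by (intro sets.countable_INT') auto
  then show ?thesis by (simp add: Collect_all_eq)
qed

lemma AE_annealed_bounded: "AE x in annealed. \<forall>n. \<bar>x n\<bar> \<le> int n"
proof -
  have "AE x in crw_law p. \<forall>n. \<bar>x n\<bar> \<le> int n" for p
    unfolding crw_law_def by (subst AE_distr_iff) (auto simp: sets_walk_bounded abs_crw_le)
  then show ?thesis
    unfolding annealed_eq_bind using sets_walk_bounded
    by (subst AE_bind[OF measurable_crw_law]) (auto simp: pred_def)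
qed

text \<open>The law is carried by the paths with \<open>\<bar>x n\<bar> \<le> int n\<close>, so a
  bound for \<open>f\<close> on these is enough: \<open>g\<close>, which is \<open>f\<close> cut off
  to 0 elsewhere, is bounded everywhere and almost surely equal to \<open>f\<close>.\<close>

lemma annealed_integral:
  fixes f :: "(nat \<Rightarrow> int) \<Rightarrow> real"
  assumes f: "f \<in> borel_measurable walk_space"
    and bd: "\<And>x. (\<And>n. \<bar>x n\<bar> \<le> int n) \<Longrightarrow> \<bar>f x\<bar> \<le> C"
  shows "integrable annealed f"
    "(\<integral>x. f x \<partial>annealed) = (\<integral>p. (\<integral>u. f (crw p u) \<partial>uniforms UNIV) \<partial>\<mu>_half)"
proof -
  define g where "g x = (if x \<in> {x. \<forall>n. \<bar>x n\<bar> \<le> int n} then f x else 0)" for x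
  have g: "g \<in> borel_measurable walk_space"
    unfolding g_def using f by (intro measurable_If_set) (auto simp: sets_walk_bounded)
  have C: "C \<ge> 0" using bd[of "\<lambda>_. 0"] by auto
  have gb: "\<bar>g x\<bar> \<le> C" for x using bd C by (auto simp: g_def)
  have AE: "AE x in annealed. f x = g x" using AE_annealed_bounded by eventually_elim (auto simp: g_def)
  note bind = integrable_bind[OF g _ measurable_crw_law] integral_bind[OF g _ measurable_crw_law]
  have fin: "finite_measure \<mu>_half" using prob_space_\<mu>_half by (simp add: prob_space_def)
  have one: "AE p in \<mu>_half. emeasure (crw_law p) (space (crw_law p)) \<le> ennreal 1"
    using prob_space.emeasure_space_1[OF prob_space_crw_law] by (intro AE_I2) simp
  have "integrable annealed g" unfolding annealed_eq_bind by (rule bind(1)[OF gb fin one])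
  then show "integrable annealed f"
    by (rule integrable_cong_AE_imp) (use f AE in \<open>auto cong: measurable_cong_sets\<close>)
  have "(\<integral>x. f x \<partial>annealed) = (\<integral>x. g x \<partial>annealed)"
    using f g AE by (intro integral_cong_AE) (auto cong: measurable_cong_sets)
  also have "\<dots> = (\<integral>p. (\<integral>x. g x \<partial>crw_law p) \<partial>\<mu>_half)"
    unfolding annealed_eq_bind by (rule bind(2)[OF gb fin one])
  also have "\<dots> = (\<integral>p. (\<integral>u. f (crw p u) \<partial>uniforms UNIV) \<partial>\<mu>_half)"
    unfolding crw_law_def
    by (intro Bochner_Integration.integral_cong refl, subst integral_distr)
       (auto simp: g g_def abs_crw_le)
  finally show "(\<integral>x. f x \<partial>annealed) = (\<integral>p. (\<integral>u. f (crw p u) \<partial>uniforms UNIV) \<partial>\<mu>_half)" .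
qed

lemma integral_uniforms_prod:
  assumes "finite K" and F: "\<And>k. F k \<in> borel_measurable borel" "\<And>k x. \<bar>F k x\<bar> \<le> (1::real)"
  shows "(\<integral>u. (\<Prod>k\<in>K. F k (u k)) \<partial>uniforms UNIV) = (\<Prod>k\<in>K. \<integral>x. F k x \<partial>unit_uniform)"
proof -
  interpret prob_space "uniforms UNIV" by (rule prob_space_uniforms)
  have F': "F k \<in> borel_measurable unit_uniform" for k
    using F(1) by (simp cong: measurable_cong_sets)
  have "indep_vars (\<lambda>_. borel) (\<lambda>k u. F k (u k)) UNIV"
    by (rule indep_vars_compose2[OF indep_vars_uniforms F'])
  then have ind: "indep_vars (\<lambda>_. borel) (\<lambda>k u. F k (u k)) K"
    by (rule indep_vars_subset) simp
  have "(\<integral>u. (\<Prod>k\<in>K. F k (u k)) \<partial>uniforms UNIV) = (\<Prod>k\<in>K. \<integral>u. F k (u k) \<partial>uniforms UNIV)"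
    using F by (intro indep_vars_lebesgue_integral[OF assms(1) ind] integrable_const_bound[of _ 1])
      (auto intro!: measurable_compose[OF _ F'])
  also have "\<dots> = (\<Prod>k\<in>K. \<integral>x. F k x \<partial>unit_uniform)"
  proof (rule prod.cong[OF refl])
    fix k
    have "(\<integral>x. F k x \<partial>unit_uniform) = (\<integral>x. F k x \<partial>distr (uniforms UNIV) unit_uniform (\<lambda>u. u k))"
      by (subst distr_PiM_component) (auto intro: prob_space_unit_uniform)
    also have "\<dots> = (\<integral>u. F k (u k) \<partial>uniforms UNIV)"
      by (rule integral_distr) (auto intro: F')
    finally show "(\<integral>u. F k (u k) \<partial>uniforms UNIV) = (\<integral>x. F k x \<partial>unit_uniform)" by simp
  qed
  finally show ?thesis .
qed

section \<open>Means and correlations of the steps\<close>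

lemma borel_measurable_flip: "(\<lambda>u. real_of_int (flip p u)) \<in> borel_measurable borel"
  unfolding flip_def by measurable

lemma integral_flip:
  assumes "p \<in> {0..1}"
  shows "(\<integral>u. real_of_int (flip p u) \<partial>unit_uniform) = 2 * p - 1"
proof -
  interpret prob_space unit_uniform by (rule prob_space_unit_uniform)
  have "(\<integral>u. real_of_int (flip p u) \<partial>unit_uniform) = (\<integral>u. 2 * indicator {..p} u - 1 \<partial>unit_uniform)"
    by (intro Bochner_Integration.integral_cong) (auto simp: flip_def indicator_def)
  also have "\<dots> = 2 * p - 1"
  proof -
    have "integrable unit_uniform (indicator {..p} :: real \<Rightarrow> real)"
      by (simp add: emeasure_eq_measure)
    then show ?thesis
      using measure_unit_uniform_atMost[OF assms] prob_space
      by (subst Bochner_Integration.integral_diff) auto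
  qed
  finally show ?thesis .
qed

lemma crw_sign_prod:
  "real_of_int (crw_sign p u n) =
    (\<Prod>k\<in>{..n}. (if k = 0 then real_of_int (flip (1/2) (u k)) else real_of_int (flip p (u k))))"
  by (induction n) auto

text \<open>The factors with index up to \<open>i\<close> occur in both signs and square to 1; only
  the flips after \<open>i\<close> survive, and by independence their means \<open>2 * p - 1\<close>
  multiply.\<close>

lemma crw_sign_mult:
  "i \<le> j \<Longrightarrow> real_of_int (crw_sign p u i * crw_sign p u j) =
    (\<Prod>k\<in>{i<..j}. real_of_int (flip p (u k)))"
proof (induction j rule: dec_induct)
  case base
  show ?case by (simp only: crw_sign_square) simp
next
  case (step j)
  have "{i<..Suc j} = insert (Suc j) {i<..j}" using step by auto
  with step show ?case by (simp add: mult_ac)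
qed

text \<open>Every sign contains the fair first toss, which is independent of the other factors and
  has mean 0.\<close>

lemma integral_crw_sign: "(\<integral>u. real_of_int (crw_sign p u n) \<partial>uniforms UNIV) = 0"
proof -
  let ?F = "\<lambda>k x. if k = 0 then real_of_int (flip (1/2) x) else real_of_int (flip p x)"
  have "(\<integral>u. real_of_int (crw_sign p u n) \<partial>uniforms UNIV) =
    (\<Prod>k\<in>{..n}. \<integral>x. ?F k x \<partial>unit_uniform)"
    unfolding crw_sign_prod
  proof (rule integral_uniforms_prod[where F="?F"])
    show "?F k \<in> borel_measurable borel" for k
      by (cases "k = 0") (simp_all add: borel_measurable_flip)
  qed (auto simp: flip_def)
  also have "\<dots> = 0"
    using integral_flip[of "1/2"] by (intro prod_zero bexI[of _ 0]) auto
  finally show ?thesis .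
qed

lemma integral_crw_sign_mult:
  assumes p: "p \<in> {0..1}"
  shows "(\<integral>u. real_of_int (crw_sign p u i * crw_sign p u j) \<partial>uniforms UNIV) =
    (2 * p - 1) ^ (max i j - min i j)"
proof -
  have le: "(\<integral>u. real_of_int (crw_sign p u i * crw_sign p u j) \<partial>uniforms UNIV) =
    (2 * p - 1) ^ (j - i)" if "i \<le> j" for i j
  proof -
    have "(\<integral>u. real_of_int (crw_sign p u i * crw_sign p u j) \<partial>uniforms UNIV) =
        (\<Prod>k\<in>{i<..j}. \<integral>x. real_of_int (flip p x) \<partial>unit_uniform)"
      unfolding crw_sign_mult[OF that]
      by (rule integral_uniforms_prod[where F="\<lambda>k x. real_of_int (flip p x)"])
         (auto simp: borel_measurable_flip flip_def)
    then show ?thesis using that by (simp add: integral_flip[OF p])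
  qed
  show ?thesis
  proof (cases "i \<le> j")
    case True
    then show ?thesis using le[OF True] by simp
  next
    case False
    then show ?thesis using le[of j i] by (simp add: mult.commute)
  qed
qed

text \<open>This is 1 / (|i - j| + 1); the distance is a maximum minus a minimum because subtraction
  of naturals truncates.\<close>

definition corr :: "nat \<Rightarrow> nat \<Rightarrow> real" where
  "corr i j = 1 / (real (max i j - min i j) + 1)"

lemma borel_measurable_walk_coord: "(\<lambda>x. real_of_int (x n)) \<in> borel_measurable walk_space"
  by (rule measurable_compose[OF measurable_walk_coord]) simp

lemma borel_measurable_crw: "(\<lambda>u. real_of_int (crw p u n)) \<in> borel_measurable (uniforms UNIV)"
  by (rule measurable_compose[OF measurable_crw' borel_measurable_walk_coord])

lemma borel_measurable_crw_sign:
  "(\<lambda>u. real_of_int (crw_sign p u n)) \<in> borel_measurable (uniforms UNIV)"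
  unfolding crw_step[symmetric] of_int_diff by (intro borel_measurable_diff borel_measurable_crw)

lemma integrable_uniforms_bounded:
  assumes "f \<in> borel_measurable (uniforms UNIV)" "\<And>u. \<bar>f u\<bar> \<le> (C :: real)"
  shows "integrable (uniforms UNIV) f"
proof -
  interpret prob_space "uniforms UNIV" by (rule prob_space_uniforms)
  show ?thesis using assms by (intro integrable_const_bound[of _ C]) auto
qed

lemma walk_coord_bound: "\<bar>x n\<bar> \<le> int n \<Longrightarrow> \<bar>real_of_int (x n)\<bar> \<le> real n"
  by (metis of_int_abs of_int_le_iff of_int_of_nat_eq)

lemma annealed_mean: "(\<integral>x. real_of_int (x n) \<partial>annealed) = 0"
proof -
  have "(\<integral>u. real_of_int (crw p u n) \<partial>uniforms UNIV) = 0" for p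
  proof -
    have "\<bar>real_of_int (crw_sign p u k)\<bar> \<le> 1" for u k using crw_sign_cases[of p u k] by auto
    then have "(\<integral>u. real_of_int (crw p u n) \<partial>uniforms UNIV) =
      (\<Sum>k<n. \<integral>u. real_of_int (crw_sign p u k) \<partial>uniforms UNIV)"
      unfolding crw_def of_int_sum
      by (intro Bochner_Integration.integral_sum integrable_uniforms_bounded[where C=1]
          borel_measurable_crw_sign)
    then show ?thesis by (simp add: integral_crw_sign)
  qed
  then show ?thesis
    by (subst annealed_integral(2)[where C="real n", OF borel_measurable_walk_coord])
       (auto simp: walk_coord_bound)
qed

lemma integrable_\<mu>_half_power: "integrable \<mu>_half (\<lambda>p. (2 * p - 1) ^ k)"
proof -
  interpret prob_space \<mu>_half by (rule prob_space_\<mu>_half)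
  have "\<bar>(2 * p - 1) ^ k\<bar> \<le> 1" if "p \<in> {0..1}" for p :: real
    unfolding power_abs using that by (intro power_le_one) auto
  then show ?thesis
    by (intro integrable_const_bound[of _ 1] AE_I2 measurable_\<mu>_half) auto
qed

lemma annealed_covariance:
  "(\<integral>x. real_of_int (x m) * real_of_int (x n) \<partial>annealed) = (\<Sum>i<m. \<Sum>j<n. corr i j)"
proof -
  let ?f = "\<lambda>x :: nat \<Rightarrow> int. real_of_int (x m) * real_of_int (x n)"
  have inner: "(\<integral>u. ?f (crw p u) \<partial>uniforms UNIV) =
      (\<Sum>i<m. \<Sum>j<n. (2 * p - 1) ^ (max i j - min i j))" if p: "p \<in> {0..1}" for p
  proof -
    have i: "integrable (uniforms UNIV) (\<lambda>u. real_of_int (crw_sign p u i * crw_sign p u j))" for i j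
    proof (rule integrable_uniforms_bounded[where C=1])
      show "(\<lambda>u. real_of_int (crw_sign p u i * crw_sign p u j)) \<in> borel_measurable (uniforms UNIV)"
        unfolding of_int_mult by (intro borel_measurable_times borel_measurable_crw_sign)
      show "\<bar>real_of_int (crw_sign p u i * crw_sign p u j)\<bar> \<le> 1" for u
        using crw_sign_cases[of p u i] crw_sign_cases[of p u j] by auto
    qed
    have "(\<integral>u. ?f (crw p u) \<partial>uniforms UNIV) =
        (\<integral>u. (\<Sum>i<m. \<Sum>j<n. real_of_int (crw_sign p u i * crw_sign p u j)) \<partial>uniforms UNIV)"
      unfolding crw_def of_int_mult of_int_sum sum_product ..
    also have "\<dots> = (\<Sum>i<m. \<Sum>j<n. \<integral>u. real_of_int (crw_sign p u i * crw_sign p u j) \<partial>uniforms UNIV)"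
      using i by (simp add: Bochner_Integration.integral_sum Bochner_Integration.integrable_sum del: of_int_mult)
    finally show ?thesis by (simp only: integral_crw_sign_mult[OF p])
  qed
  have "(\<integral>x. ?f x \<partial>annealed) = (\<integral>p. (\<integral>u. ?f (crw p u) \<partial>uniforms UNIV) \<partial>\<mu>_half)"
  proof (rule annealed_integral(2))
    show "?f \<in> borel_measurable walk_space"
      by (intro borel_measurable_times borel_measurable_walk_coord)
    show "\<bar>?f x\<bar> \<le> real m * real n" if "\<And>n. \<bar>x n\<bar> \<le> int n" for x
      unfolding abs_mult using that by (intro mult_mono walk_coord_bound) auto
  qed
  also have "\<dots> = (\<integral>p. (\<Sum>i<m. \<Sum>j<n. (2 * p - 1) ^ (max i j - min i j)) \<partial>\<mu>_half)"
    by (intro Bochner_Integration.integral_cong refl inner) simp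
  also have "\<dots> = (\<Sum>i<m. \<Sum>j<n. \<integral>p. (2 * p - 1) ^ (max i j - min i j) \<partial>\<mu>_half)"
    by (simp add: Bochner_Integration.integral_sum Bochner_Integration.integrable_sum
        integrable_\<mu>_half_power)
  finally show ?thesis by (simp add: integral_\<mu>_half_power corr_def)
qed

section \<open>Growth of the variance\<close>

definition walk_var :: "nat \<Rightarrow> real" where
  "walk_var n = (\<Sum>i<n. \<Sum>j<n. corr i j)"

lemma corr_commute: "corr i j = corr j i"
  by (simp add: corr_def max.commute min.commute)

lemma corr_shift: "corr (i + m) (j + m) = corr i j"
proof -
  have "max (i + m) (j + m) - min (i + m) (j + m) = max i j - min i j" by (simp add: max_def min_def)
  then show ?thesis unfolding corr_def by simp
qed

lemma sum_corr_harm: "(\<Sum>i<n. corr i n) = harm (Suc n) - 1"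
proof -
  have "(\<Sum>i<n. corr i n) = (\<Sum>i<n. 1 / (real (n - i) + 1))"
    by (intro sum.cong) (auto simp: corr_def)
  also have "\<dots> = (\<Sum>i<n. 1 / (real (Suc i) + 1))"
    by (subst sum.nat_diff_reindex[symmetric]) (intro sum.cong, auto)
  also have "\<dots> = harm (Suc n) - 1"
    by (induction n) (simp_all add: harm_Suc[of "Suc _"] harm_expand divide_inverse add_ac)
  finally show ?thesis .
qed

text \<open>The new row and the new column of correlations contribute
  \<open>harm (Suc n) - 1\<close> each, the new diagonal entry contributes 1.\<close>

lemma walk_var_Suc: "walk_var (Suc n) = walk_var n + 2 * harm (Suc n) - 1"
proof -
  have "walk_var (Suc n) = walk_var n + (\<Sum>i<n. corr i n) + (\<Sum>j<n. corr n j) + corr n n"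
    by (simp add: walk_var_def sum.distrib)
  also have "(\<Sum>j<n. corr n j) = (\<Sum>i<n. corr i n)" by (simp add: corr_commute)
  finally show ?thesis unfolding sum_corr_harm by (simp add: corr_def)
qed

lemma walk_var_eq: "walk_var n = 2 * (real n + 1) * harm n - 3 * real n"
proof (induction n)
  case 0
  show ?case by (simp add: walk_var_def harm_expand)
next
  case (Suc n)
  have h: "harm n = harm (Suc n) - 1 / (real n + 1)" by (simp add: harm_Suc divide_inverse add_ac)
  have "2 * (real n + 1) * harm n = 2 * (real n + 1) * harm (Suc n) - 2"
    unfolding h by (simp add: field_simps)
  with Suc show ?case by (simp add: walk_var_Suc algebra_simps)
qed

text \<open>The sum of the correlations over the square with sides from \<open>m\<close> to
  \<open>n\<close> is the variance of an increment. By stationarity it equals the variance at time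
  \<open>n - m\<close>, and the two off-diagonal rectangles agree by symmetry.\<close>

lemma covariance_polarization:
  assumes "m \<le> n"
  shows "(\<Sum>i<m. \<Sum>j<n. corr i j) = (walk_var m + walk_var n - walk_var (n - m)) / 2"
proof -
  have split: "{..<n} = {..<m} \<union> {m..<n}" "{..<m} \<inter> {m..<n} = {}" using assms by auto
  have sum: "(\<Sum>j<n. g j) = (\<Sum>j<m. g j) + (\<Sum>j\<in>{m..<n}. g j)" for g :: "nat \<Rightarrow> real"
    unfolding split(1) using split(2) by (intro sum.union_disjoint) auto
  have "(\<Sum>i\<in>{m..<n}. \<Sum>j\<in>{m..<n}. corr i j) = (\<Sum>i<n - m. \<Sum>j<n - m. corr (i + m) (j + m))"
    using assms by (simp add: sum.atLeastLessThan_shift_0[of _ m n] lessThan_atLeast0 add.commute)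
  then have D: "(\<Sum>i\<in>{m..<n}. \<Sum>j\<in>{m..<n}. corr i j) = walk_var (n - m)"
    by (simp add: corr_shift walk_var_def)
  have C: "(\<Sum>i\<in>{m..<n}. \<Sum>j<m. corr i j) = (\<Sum>i<m. \<Sum>j\<in>{m..<n}. corr i j)"
    by (subst sum.swap) (simp add: corr_commute)
  show ?thesis
    using C D by (simp add: walk_var_def sum sum.distrib)
qed

lemma walk_var_nonneg: "walk_var n \<ge> 0"
  unfolding walk_var_def by (intro sum_nonneg) (simp add: corr_def)


lemma harm_le_ln: "n \<ge> 1 \<Longrightarrow> harm n \<le> ln (real n) + 1"
  using euler_mascheroni_sequence_decreasing[of 1 n] by (simp add: harm_expand)

definition scaled_var :: "nat \<Rightarrow> nat \<Rightarrow> real" where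
  "scaled_var N n = walk_var n / (2 * (real N * ln (real N)))"

text \<open>For \<open>1 \<le> n \<le> N\<close> and \<open>2 \<le> N\<close> one has
  \<open>harm n \<le> ln N + 1 \<le> (1 + 1 / ln 2) * ln N\<close> and
  \<open>n + 1 \<le> 2 * n\<close>. Inserted into 2 (n + 1) H_n / (2 N ln N) this leaves the factor
  2 (1 + 1 / ln 2) in front of n / N.\<close>

definition var_const :: real where
  "var_const = 2 + 2 / ln 2"

lemma var_const_pos: "var_const > 0"
  unfolding var_const_def by (intro add_pos_pos) auto

lemma scaled_var_nonneg: "scaled_var N n \<ge> 0"
  unfolding scaled_var_def by (cases "N = 0") (auto intro!: divide_nonneg_nonneg mult_nonneg_nonneg walk_var_nonneg)

text \<open>The linear bound, uniform in \<open>N\<close>, from which fourth moments of increments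
  become quadratic in their length.\<close>

lemma scaled_var_le:
  assumes "N \<ge> 2" "n \<le> N"
  shows "scaled_var N n \<le> var_const * (real n / real N)"
proof (cases "n = 0")
  case True
  then show ?thesis by (simp add: scaled_var_def walk_var_eq harm_expand)
next
  case False
  have ln: "0 < ln (2::real)" "ln 2 \<le> ln (real N)" "0 \<le> real N * ln (real N)" using assms by auto
  have "harm n \<le> ln (real n) + 1" using False by (intro harm_le_ln) simp
  also have "\<dots> \<le> ln (real N) + ln (real N) / ln 2"
    using assms False ln by (intro add_mono) auto
  finally have h: "harm n \<le> ln (real N) + ln (real N) / ln 2" .
  have n1: "real n \<ge> 1" using False by simp
  have "walk_var n \<le> 2 * (real n + 1) * harm n" by (simp add: walk_var_eq)
  also have "\<dots> \<le> 4 * real n * (ln (real N) + ln (real N) / ln 2)"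
    using n1 h by - (rule mult_mono, auto simp: harm_nonneg)
  finally have "scaled_var N n \<le> 4 * real n * (ln (real N) + ln (real N) / ln 2) / (2 * (real N * ln (real N)))"
    unfolding scaled_var_def using ln by (intro divide_right_mono) simp_all
  also have "\<dots> = var_const * (real n / real N)"
    using ln assms by (simp add: var_const_def field_simps)
  finally show ?thesis .
qed

lemma scaled_var_le_const:
  assumes "n \<le> N"
  shows "scaled_var N n \<le> var_const"
proof (cases "N \<ge> 2")
  case True
  have "scaled_var N n \<le> var_const * (real n / real N)" by (rule scaled_var_le[OF True assms])
  also have "\<dots> \<le> var_const * 1"
    using assms True var_const_pos by (intro mult_left_mono) auto
  finally show ?thesis by simp
next
  case False
  then have "N = 0 \<or> N = 1" by auto
  \<comment> \<open>For these \<open>N\<close> the denominator is 0, and so is the quotient; the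
    bound thus holds along the whole sequence.\<close>
  then have "scaled_var N n = 0" by (auto simp: scaled_var_def)
  then show ?thesis using var_const_pos by simp
qed

text \<open>\<open>harm (n N) - ln (n N)\<close> tends to Euler's constant and
  \<open>ln (n N) - ln N\<close> to \<open>ln x\<close>; both are negligible against
  \<open>ln N\<close>.\<close>

lemma harm_div_ln_tendsto:
  assumes n: "filterlim n at_top sequentially" "\<And>N. n N \<le> N"
    and lim: "(\<lambda>N. real (n N) / real N) \<longlonglongrightarrow> x" and x: "x > 0"
  shows "(\<lambda>N. harm (n N) / ln (real N) :: real) \<longlonglongrightarrow> 1"
proof -
  have lnN: "filterlim (\<lambda>N. ln (real N)) at_top sequentially"
    by (rule filterlim_compose[OF ln_at_top filterlim_real_sequentially])
  have "(\<lambda>N. (harm (n N) - ln (real (n N))) + ln (real (n N) / real N)) \<longlonglongrightarrow> euler_mascheroni + ln x"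
    by (intro tendsto_add tendsto_ln lim filterlim_compose[OF euler_mascheroni_LIMSEQ n(1)]) (use x in auto)
  from tendsto_divide_0[OF this filterlim_at_top_imp_at_infinity[OF lnN]]
  have "(\<lambda>N. 1 + ((harm (n N) - ln (real (n N))) + ln (real (n N) / real N)) / ln (real N)) \<longlonglongrightarrow> 1 + 0"
    by (intro tendsto_add tendsto_const)
  moreover have "eventually (\<lambda>N. 1 + ((harm (n N) - ln (real (n N))) + ln (real (n N) / real N)) / ln (real N)
      = harm (n N) / ln (real N)) sequentially"
    using eventually_ge_at_top[of 2] eventually_compose_filterlim[OF eventually_ge_at_top[of 1] n(1)]
  proof eventually_elim
    case (elim N)
    then have "ln (real N) > 0" "real (n N) > 0" "real N > 0" by auto
    then show ?case by (simp add: ln_div field_simps)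
  qed
  ultimately have "(\<lambda>N. harm (n N) / ln (real N) :: real) \<longlonglongrightarrow> 1 + 0"
    by (rule Lim_transform_eventually)
  then show ?thesis by simp
qed

text \<open>For \<open>x > 0\<close> the times tend to infinity and the closed form of the variance
  applies. For \<open>x = 0\<close> they may stay bounded, and the linear bound squeezes the
  variance to 0 instead.\<close>

lemma scaled_var_tendsto:
  assumes n: "\<And>N. n N \<le> N" and lim: "(\<lambda>N. real (n N) / real N) \<longlonglongrightarrow> x" and x: "x \<ge> 0"
  shows "(\<lambda>N. scaled_var N (n N)) \<longlonglongrightarrow> x"
proof (cases "x = 0")
  case True
  have "(\<lambda>N. var_const * (real (n N) / real N)) \<longlonglongrightarrow> var_const * 0"
    using lim True by (intro tendsto_mult tendsto_const) simp
  moreover have "eventually (\<lambda>N. scaled_var N (n N) \<le> var_const * (real (n N) / real N)) sequentially"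
    using eventually_ge_at_top[of 2] by eventually_elim (intro scaled_var_le n)
  moreover have "eventually (\<lambda>N. 0 \<le> scaled_var N (n N)) sequentially"
    by (simp add: scaled_var_nonneg)
  ultimately have "(\<lambda>N. scaled_var N (n N)) \<longlonglongrightarrow> 0"
    by - (rule tendsto_sandwich[of "\<lambda>_. 0" _ _ "\<lambda>N. var_const * (real (n N) / real N)"], simp_all)
  then show ?thesis using True by simp
next
  case False
  with x have x: "x > 0" by simp
  have ninf: "filterlim n at_top sequentially"
  proof -
    have "filterlim (\<lambda>N. real (n N) / real N * real N) at_top sequentially"
      by (rule filterlim_tendsto_pos_mult_at_top[OF lim x filterlim_real_sequentially])
    then have "eventually (\<lambda>N. real Z \<le> real (n N) / real N * real N) sequentially" for Z
      unfolding filterlim_at_top by blast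
    then have "eventually (\<lambda>N. Z \<le> n N) sequentially" for Z
      using eventually_gt_at_top[of 0]
      by (rule eventually_elim2) simp
    then show ?thesis unfolding filterlim_at_top by blast
  qed
  have lnN: "filterlim (\<lambda>N. ln (real N)) at_top sequentially"
    by (rule filterlim_compose[OF ln_at_top filterlim_real_sequentially])
  have inv: "(\<lambda>N. 1 / real N) \<longlonglongrightarrow> 0" by (rule lim_1_over_n)
  have "(\<lambda>N. (real (n N) / real N + 1 / real N) * (harm (n N) / ln (real N))
      - 3 / 2 * (real (n N) / real N / ln (real N))) \<longlonglongrightarrow> (x + 0) * 1 - 3 / 2 * 0"
    by (intro tendsto_diff tendsto_mult tendsto_add tendsto_const lim inv
        harm_div_ln_tendsto[OF ninf n lim x]
        tendsto_divide_0[OF lim filterlim_at_top_imp_at_infinity[OF lnN]])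
  moreover have "eventually (\<lambda>N. (real (n N) / real N + 1 / real N) * (harm (n N) / ln (real N))
      - 3 / 2 * (real (n N) / real N / ln (real N)) = scaled_var N (n N)) sequentially"
    using eventually_ge_at_top[of 2]
  proof eventually_elim
    case (elim N)
    then have "ln (real N) > 0" "real N > 0" by auto
    then show ?case by (simp add: scaled_var_def walk_var_eq field_simps)
  qed
  ultimately have "(\<lambda>N. scaled_var N (n N)) \<longlonglongrightarrow> (x + 0) * 1 - 3 / 2 * 0"
    by (rule Lim_transform_eventually)
  then show ?thesis by simp
qed

section \<open>The limit for a fixed number of steps\<close>

text \<open>A finite box that almost surely contains the prefix of the walk up to time
  \<open>N\<close>; its members that are not walks get weight 0.\<close>

definition walk_prefixes :: "nat \<Rightarrow> (nat \<Rightarrow> int) set" where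
  "walk_prefixes N = (\<Pi>\<^sub>E k\<in>{..N}. {- int N..int N})"

lemma finite_walk_prefixes: "finite (walk_prefixes N)"
  unfolding walk_prefixes_def by (intro finite_PiE) auto

definition prefix_weight :: "nat \<Rightarrow> (nat \<Rightarrow> int) \<Rightarrow> real" where
  "prefix_weight N v = measure annealed (cylinder v N)"

text \<open>Almost surely exactly one prefix in the box matches the path, so \<open>h\<close>
  coincides with a finite combination of cylinder indicators.\<close>

lemma annealed_prefix_expectation:
  fixes h :: "(nat \<Rightarrow> int) \<Rightarrow> real"
  assumes meas: "h \<in> borel_measurable walk_space"
    and h: "\<And>x y. (\<And>k. k \<le> N \<Longrightarrow> x k = y k) \<Longrightarrow> h x = h y"
  shows "(\<integral>x. h x \<partial>annealed) = (\<Sum>v\<in>walk_prefixes N. prefix_weight N v * h v)"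
proof -
  interpret prob_space annealed by (rule prob_space_annealed)
  let ?s = "\<lambda>x. \<Sum>v\<in>walk_prefixes N. indicator (cylinder v N) x * h v"
  have cyl: "cylinder v N \<in> sets annealed" for v by (simp add: sets_cylinder)
  have "AE x in annealed. h x = ?s x"
    using AE_annealed_bounded
  proof eventually_elim
    case (elim x)
    let ?w = "restrict x {..N}"
    have "x k \<in> {- int N..int N}" if "k \<le> N" for k
      using elim[rule_format, of k] that unfolding atLeastAtMost_iff by linarith
    then have w: "?w \<in> walk_prefixes N" unfolding walk_prefixes_def by auto
    have ind: "indicator (cylinder v N) x = (if v = ?w then 1 else 0 :: real)"
      if "v \<in> walk_prefixes N" for v
    proof (cases "x \<in> cylinder v N")
      case True
      then have "v = ?w"
        using that unfolding walk_prefixes_def cylinder_def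
        by (intro extensionalityI[of _ "{..N}"]) (auto simp: PiE_def)
      with True show ?thesis by simp
    next
      case False
      then have "v \<noteq> ?w" by (auto simp: cylinder_def)
      with False show ?thesis by simp
    qed
    have "?s x = (\<Sum>v\<in>walk_prefixes N. if v = ?w then h v else 0)"
      by (intro sum.cong) (auto simp: ind)
    also have "\<dots> = h ?w" using w finite_walk_prefixes by (simp add: sum.delta)
    also have "\<dots> = h x" by (rule h) simp
    finally show ?case by simp
  qed
  then have "(\<integral>x. h x \<partial>annealed) = (\<integral>x. ?s x \<partial>annealed)"
    by (intro integral_cong_AE)
       (use meas cyl in \<open>auto cong: measurable_cong_sets intro!: borel_measurable_sum borel_measurable_times\<close>)
  also have "\<dots> = (\<Sum>v\<in>walk_prefixes N. \<integral>x. indicator (cylinder v N) x * h v \<partial>annealed)"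
    using cyl by (intro Bochner_Integration.integral_sum integrable_mult_left)
      (auto simp: emeasure_eq_measure)
  also have "\<dots> = (\<Sum>v\<in>walk_prefixes N. prefix_weight N v * h v)"
    by (simp add: prefix_weight_def)
  finally show ?thesis .
qed

section \<open>The Gaussian walk and its moments\<close>

definition walk_scale :: "nat \<Rightarrow> real" where
  "walk_scale N = c_half / sqrt (real N * ln (real N))"

lemma walk_scale_square: "(walk_scale N)\<^sup>2 = 1 / (2 * (real N * ln (real N)))"
proof -
  have "0 \<le> real N * ln (real N)" by (cases "N = 0") auto
  then show ?thesis by (simp add: walk_scale_def c_half_def power_divide power_mult_distrib)
qed

text \<open>Summing over \<open>v\<close> the product of the coefficients at two times up to
  \<open>N\<close> returns the rescaled annealed covariance. The cut-off \<open>min j N\<close>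
  gives a value at every index, since later grid blocks reach beyond \<open>N\<close>.\<close>

definition gauss_coef :: "nat \<Rightarrow> nat \<Rightarrow> (nat \<Rightarrow> int) \<Rightarrow> real" where
  "gauss_coef N j v = walk_scale N * (sqrt (prefix_weight N v) * real_of_int (v (min j N)))"

text \<open>The Gaussian process with the covariance of the rescaled annealed walk: each of the finitely
  many walk prefixes \<open>v\<close> carries an independent standard normal weight, multiplied by the square root
  of the probability of \<open>v\<close>. It is frozen after time \<open>N\<close>.\<close>

definition gauss_walk :: "nat \<Rightarrow> ((nat \<Rightarrow> int) \<Rightarrow> real) \<Rightarrow> nat \<Rightarrow> real" where
  "gauss_walk N g j = (\<Sum>v\<in>walk_prefixes N. gauss_coef N j v * g v)"

abbreviation gauss_measure :: "nat \<Rightarrow> ((nat \<Rightarrow> int) \<Rightarrow> real) measure" where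
  "gauss_measure N \<equiv> gauss_space (walk_prefixes N)"

lemma borel_measurable_gauss_walk:
  "(\<lambda>g. gauss_walk N g j) \<in> borel_measurable (gauss_measure N)"
  unfolding gauss_walk_def by (rule measurable_gauss_sum) simp

lemma gauss_walk_linear:
  "(\<Sum>k<d. u k * gauss_walk N g (m k)) =
    (\<Sum>v\<in>walk_prefixes N. (\<Sum>k<d. u k * gauss_coef N (m k) v) * g v)"
  unfolding gauss_walk_def sum_distrib_left sum_distrib_right
  by (subst sum.swap) (simp add: mult.assoc)

definition walk_cov :: "nat \<Rightarrow> nat \<Rightarrow> real" where
  "walk_cov m n = (\<Sum>i<m. \<Sum>j<n. corr i j)"

lemma walk_cov_eq:
  "walk_cov m n = (walk_var m + walk_var n - walk_var (max m n - min m n)) / 2"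
proof (cases "m \<le> n")
  case True
  then show ?thesis using covariance_polarization[OF True] by (simp add: walk_cov_def)
next
  case False
  then have "n \<le> m" by simp
  have "walk_cov m n = walk_cov n m"
    unfolding walk_cov_def by (subst sum.swap) (simp add: corr_commute)
  then show ?thesis using covariance_polarization[OF \<open>n \<le> m\<close>] \<open>n \<le> m\<close> by (simp add: walk_cov_def add.commute)
qed

lemma integrable_annealed_bounded_coords:
  "integrable annealed (\<lambda>x. real_of_int (x m) * real_of_int (x n))"
proof (rule annealed_integral(1))
  show "(\<lambda>x. real_of_int (x m) * real_of_int (x n)) \<in> borel_measurable walk_space"
    by (intro borel_measurable_times borel_measurable_walk_coord)
  show "\<bar>real_of_int (x m) * real_of_int (x n)\<bar> \<le> real m * real n" if "\<And>n. \<bar>x n\<bar> \<le> int n" for x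
    unfolding abs_mult using that by (intro mult_mono walk_coord_bound) auto
qed

lemma annealed_second_moment:
  "(\<integral>x. (\<Sum>k<d. u k * real_of_int (x (m k)))\<^sup>2 \<partial>annealed) =
    (\<Sum>k<d. \<Sum>l<d. u k * u l * walk_cov (m k) (m l))"
proof -
  have "(\<integral>x. (\<Sum>k<d. u k * real_of_int (x (m k)))\<^sup>2 \<partial>annealed) =
    (\<integral>x. (\<Sum>k<d. \<Sum>l<d. (u k * u l) * (real_of_int (x (m k)) * real_of_int (x (m l)))) \<partial>annealed)"
    by (simp add: power2_eq_square sum_product mult_ac)
  also have "\<dots> = (\<Sum>k<d. \<Sum>l<d. (u k * u l) * (\<integral>x. real_of_int (x (m k)) * real_of_int (x (m l)) \<partial>annealed))"
    using integrable_annealed_bounded_coords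
    by (subst Bochner_Integration.integral_sum)
       (auto intro!: Bochner_Integration.integrable_sum simp: Bochner_Integration.integral_sum)
  finally show ?thesis by (simp add: annealed_covariance walk_cov_def)
qed

lemma gauss_coef_sum_squares:
  "(\<Sum>v\<in>walk_prefixes N. (\<Sum>k<d. u k * gauss_coef N (m k) v)\<^sup>2) =
    (walk_scale N)\<^sup>2 * (\<Sum>k<d. \<Sum>l<d. u k * u l * walk_cov (min (m k) N) (min (m l) N))"
proof -
  let ?h = "\<lambda>x :: nat \<Rightarrow> int. (\<Sum>k<d. u k * real_of_int (x (min (m k) N)))\<^sup>2"
  have "(\<Sum>k<d. u k * gauss_coef N (m k) v)\<^sup>2 = (walk_scale N)\<^sup>2 * (prefix_weight N v * ?h v)" for v
  proof -
    have "(\<Sum>k<d. u k * gauss_coef N (m k) v) =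
        walk_scale N * (sqrt (prefix_weight N v) * (\<Sum>k<d. u k * real_of_int (v (min (m k) N))))"
      unfolding gauss_coef_def sum_distrib_left by (intro sum.cong) auto
    then show ?thesis by (simp add: power_mult_distrib prefix_weight_def)
  qed
  then have "(\<Sum>v\<in>walk_prefixes N. (\<Sum>k<d. u k * gauss_coef N (m k) v)\<^sup>2) =
      (walk_scale N)\<^sup>2 * (\<Sum>v\<in>walk_prefixes N. prefix_weight N v * ?h v)"
    by (simp add: sum_distrib_left)
  also have "(\<Sum>v\<in>walk_prefixes N. prefix_weight N v * ?h v) = (\<integral>x. ?h x \<partial>annealed)"
  proof (rule annealed_prefix_expectation[symmetric])
    show "?h \<in> borel_measurable walk_space"
      by (intro borel_measurable_power borel_measurable_sum borel_measurable_times
          borel_measurable_walk_coord) simp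
    show "?h x = ?h y" if "\<And>k. k \<le> N \<Longrightarrow> x k = y k" for x y :: "nat \<Rightarrow> int"
      using that by simp
  qed
  finally show ?thesis by (simp add: annealed_second_moment)
qed

text \<open>Kept in polarized form, so that bounds and limits of \<open>scaled_var\<close> carry
  over to covariances.\<close>

definition gauss_cov :: "nat \<Rightarrow> nat \<Rightarrow> nat \<Rightarrow> real" where
  "gauss_cov N m n = (scaled_var N (min m N) + scaled_var N (min n N)
     - scaled_var N (max (min m N) (min n N) - min (min m N) (min n N))) / 2"

lemma walk_scale_cov: "(walk_scale N)\<^sup>2 * walk_cov (min a N) (min b N) = gauss_cov N a b"
  unfolding walk_scale_square walk_cov_eq gauss_cov_def scaled_var_def
  by (simp add: add_divide_distrib diff_divide_distrib)

lemma gauss_coef_sum_squares':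
  "(\<Sum>v\<in>walk_prefixes N. (\<Sum>k<d. u k * gauss_coef N (m k) v)\<^sup>2) =
    (\<Sum>k<d. \<Sum>l<d. u k * u l * gauss_cov N (m k) (m l))"
  unfolding gauss_coef_sum_squares sum_distrib_left walk_scale_cov[symmetric]
  by (simp add: mult.left_commute)

lemma char_gauss_walk:
  "char (distr (gauss_measure N) borel (\<lambda>g. \<Sum>k<d. u k * gauss_walk N g (m k))) 1 =
    exp (- (\<Sum>k<d. \<Sum>l<d. u k * u l * gauss_cov N (m k) (m l)) / 2)"
  unfolding gauss_walk_linear gauss_coef_sum_squares'[symmetric]
  by (rule char_gauss_sum[OF finite_walk_prefixes])

lemma scaled_var_0 [simp]: "scaled_var N 0 = 0"
  by (simp add: scaled_var_def walk_var_def)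

lemma gauss_cov_self: "gauss_cov N m m = scaled_var N (min m N)"
  by (simp add: gauss_cov_def)

lemma gauss_increment_sum_squares:
  assumes "i \<le> j"
  shows "(\<Sum>v\<in>walk_prefixes N. (gauss_coef N j v - gauss_coef N i v)\<^sup>2) =
    scaled_var N (min j N - min i N)"
proof -
  \<comment> \<open>The increment is the linear form with coefficients 1 at \<open>j\<close> and -1
    at \<open>i\<close>; in its quadratic form the polarized terms cancel down to the variance of
    the increment.\<close>
  let ?u = "\<lambda>k :: nat. if k = 0 then 1 else - 1 :: real" and ?m = "\<lambda>k :: nat. if k = 0 then j else i"
  have "gauss_coef N j v - gauss_coef N i v = (\<Sum>k<2. ?u k * gauss_coef N (?m k) v)" for v
    by (simp add: numeral_2_eq_2)
  then have "(\<Sum>v\<in>walk_prefixes N. (gauss_coef N j v - gauss_coef N i v)\<^sup>2) =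
      (\<Sum>k<2. \<Sum>l<2. ?u k * ?u l * gauss_cov N (?m k) (?m l))"
    by (simp only: gauss_coef_sum_squares')
  also have "\<dots> = gauss_cov N j j + gauss_cov N i i - gauss_cov N j i - gauss_cov N i j"
    by (simp add: numeral_2_eq_2)
  also have "\<dots> = scaled_var N (min j N - min i N)"
  proof -
    have "min i N \<le> min j N" using assms by simp
    then have "max (min i N) (min j N) = min j N" "min (min i N) (min j N) = min i N"
      "max (min j N) (min i N) = min j N" "min (min j N) (min i N) = min i N"
      by (simp_all add: max_absorb1 max_absorb2 min_absorb1 min_absorb2)
    then show ?thesis unfolding gauss_cov_def by (simp add: field_simps)
  qed
  finally show ?thesis .
qed

lemma gauss_walk_diff:
  "gauss_walk N g j - gauss_walk N g i =
    (\<Sum>v\<in>walk_prefixes N. (gauss_coef N j v - gauss_coef N i v) * g v)"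
  unfolding gauss_walk_def by (simp add: left_diff_distrib sum_subtractf)

lemma gauss_walk_even_moment:
  "integrable (gauss_measure N) (\<lambda>g. (gauss_walk N g j - gauss_walk N g i) ^ (2 * k))"
  unfolding gauss_walk_diff by (rule gauss_sum_even_moment[OF finite_walk_prefixes])

lemma gauss_walk_fourth_moment:
  assumes N: "N \<ge> 2" and ij: "i \<le> j"
  shows "(\<integral>g. (gauss_walk N g j - gauss_walk N g i) ^ 4 \<partial>gauss_measure N) \<le>
    3 * (var_const / real N)\<^sup>2 * (real (j - i))\<^sup>2"
proof -
  have "(\<integral>g. (gauss_walk N g j - gauss_walk N g i) ^ (2 * 2) \<partial>gauss_measure N) =
      (scaled_var N (min j N - min i N))\<^sup>2 * (fact (2 * 2) / (2\<^sup>2 * fact 2))"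
    unfolding gauss_walk_diff gauss_sum_even_moment(2)[OF finite_walk_prefixes]
      gauss_increment_sum_squares[OF ij] ..
  then have "(\<integral>g. (gauss_walk N g j - gauss_walk N g i) ^ 4 \<partial>gauss_measure N) =
      3 * (scaled_var N (min j N - min i N))\<^sup>2"
    by (simp add: fact_numeral)
  also have "\<dots> \<le> 3 * (var_const * (real (j - i) / real N))\<^sup>2"
  proof (intro mult_left_mono power_mono)
    have "scaled_var N (min j N - min i N) \<le> var_const * (real (min j N - min i N) / real N)"
      using N by (intro scaled_var_le) auto
    also have "\<dots> \<le> var_const * (real (j - i) / real N)"
      using var_const_pos by (intro mult_left_mono divide_right_mono) auto
    finally show "scaled_var N (min j N - min i N) \<le> var_const * (real (j - i) / real N)" .
  qed (auto simp: scaled_var_nonneg)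
  finally show ?thesis by (simp add: power_mult_distrib power_divide)
qed

lemma gauss_walk_second_moment:
  "integrable (gauss_measure N) (\<lambda>g. (gauss_walk N g j)\<^sup>2)"
  "(\<integral>g. (gauss_walk N g j)\<^sup>2 \<partial>gauss_measure N) = scaled_var N (min j N)"
proof -
  show "integrable (gauss_measure N) (\<lambda>g. (gauss_walk N g j)\<^sup>2)"
    using gauss_sum_even_moment(1)[OF finite_walk_prefixes, where k=1] by (simp add: gauss_walk_def)
  have "(\<integral>g. (gauss_walk N g j)\<^sup>2 \<partial>gauss_measure N) = (\<Sum>v\<in>walk_prefixes N. (gauss_coef N j v)\<^sup>2)"
    using gauss_sum_even_moment(2)[OF finite_walk_prefixes, where k=1] by (simp add: gauss_walk_def)
  also have "\<dots> = scaled_var N (min j N)"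
    using gauss_coef_sum_squares'[where N=N and d="Suc 0" and u="\<lambda>_. 1" and m="\<lambda>_. j"]
    by (simp add: gauss_cov_self lessThan_Suc)
  finally show "(\<integral>g. (gauss_walk N g j)\<^sup>2 \<partial>gauss_measure N) = scaled_var N (min j N)" .
qed

text \<open>Applied to \<open>Suc\<close>: the walks are indexed from 1, the sequences in the
  central limit theorem from 0.\<close>

lemma (in prob_space) indep_vars_reindex_inj:
  assumes "indep_vars M' X I" "inj_on f K" "f ` K \<subseteq> I"
  shows "indep_vars (\<lambda>k. M' (f k)) (\<lambda>k. X (f k)) K"
proof -
  let ?F = "\<lambda>i. {X i -` A \<inter> space M |A. A \<in> sets (M' i)}"
  have rv: "\<forall>i\<in>I. random_variable (M' i) (X i)" and ind: "indep_sets ?F I"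
    using assms(1) by (auto simp: indep_vars_def2)
  have "indep_sets (\<lambda>k. ?F (f k)) K"
    unfolding indep_sets_def
  proof (intro conjI ballI allI impI)
    fix k assume "k \<in> K"
    with assms(3) ind show "?F (f k) \<subseteq> events" unfolding indep_sets_def by blast
  next
    fix J A assume J: "J \<subseteq> K" "J \<noteq> {}" "finite J" and A: "A \<in> Pi J (\<lambda>k. ?F (f k))"
    have inj: "inj_on f J" using assms(2) J(1) by (rule inj_on_subset)
    define B where "B i = A (the_inv_into J f i)" for i
    have B: "B (f j) = A j" if "j \<in> J" for j
      using that inj by (simp add: B_def the_inv_into_f_f)
    have "prob (\<Inter>i\<in>f ` J. B i) = (\<Prod>i\<in>f ` J. prob (B i))"
    proof (rule indep_setsD[OF ind])
      show "f ` J \<subseteq> I" using assms(3) J(1) by blast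
      show "\<forall>i\<in>f ` J. B i \<in> ?F i"
      proof
        fix i assume "i \<in> f ` J"
        then obtain j where j: "j \<in> J" "i = f j" by blast
        show "B i \<in> ?F i" unfolding j(2) B[OF j(1)] by (rule Pi_mem[OF A j(1)])
      qed
    qed (use J in auto)
    then show "prob (\<Inter>j\<in>J. A j) = (\<Prod>j\<in>J. prob (A j))"
      using B by (simp add: prod.reindex[OF inj])
  qed
  then show ?thesis
    unfolding indep_vars_def2 using rv assms(3) by auto
qed

section \<open>Central limit theorem for sums of independent copies\<close>

context prob_space
begin

lemma iid_second_moment:
  fixes Y :: "nat \<Rightarrow> 'a \<Rightarrow> real"
  assumes ind: "indep_vars (\<lambda>_. borel) Y UNIV" and mean: "\<And>i. expectation (Y i) = 0"
    and sq: "\<And>i. integrable M (\<lambda>\<omega>. (Y i \<omega>)\<^sup>2)" "\<And>i. expectation (\<lambda>\<omega>. (Y i \<omega>)\<^sup>2) = s"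
  shows "integrable M (\<lambda>\<omega>. (\<Sum>i<n. Y i \<omega>)\<^sup>2)"
    "expectation (\<lambda>\<omega>. (\<Sum>i<n. Y i \<omega>)\<^sup>2) = real n * s"
proof -
  have rv: "random_variable borel (Y i)" for i using ind by (simp add: indep_vars_def)
  have int: "integrable M (Y i)" for i by (rule square_integrable_imp_integrable[OF rv sq(1)])
  have prod: "integrable M (\<lambda>\<omega>. Y i \<omega> * Y j \<omega>) \<and>
      expectation (\<lambda>\<omega>. Y i \<omega> * Y j \<omega>) = (if i = j then s else 0)" for i j
  proof (cases "i = j")
    case True
    then show ?thesis using sq by (simp add: power2_eq_square)
  next
    case False
    have I: "indep_vars (\<lambda>_. borel) Y {i, j}" by (rule indep_vars_subset[OF ind]) simp
    show ?thesis
      using indep_vars_lebesgue_integral[OF _ I int] indep_vars_integrable[OF _ I int] False mean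
      by simp
  qed
  have eq: "(\<lambda>\<omega>. (\<Sum>i<n. Y i \<omega>)\<^sup>2) = (\<lambda>\<omega>. \<Sum>i<n. \<Sum>j<n. Y i \<omega> * Y j \<omega>)"
    by (simp add: power2_eq_square sum_product)
  show "integrable M (\<lambda>\<omega>. (\<Sum>i<n. Y i \<omega>)\<^sup>2)"
    unfolding eq using prod by (intro Bochner_Integration.integrable_sum) auto
  have "expectation (\<lambda>\<omega>. (\<Sum>i<n. Y i \<omega>)\<^sup>2) = (\<Sum>i<n. \<Sum>j<n. if i = j then s else 0)"
    unfolding eq using prod
    by (subst Bochner_Integration.integral_sum)
       (auto intro!: Bochner_Integration.integrable_sum simp: Bochner_Integration.integral_sum)
  also have "\<dots> = real n * s" by (simp add: sum.delta)
  finally show "expectation (\<lambda>\<omega>. (\<Sum>i<n. Y i \<omega>)\<^sup>2) = real n * s" .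
qed

text \<open>The classical theorem asks for positive variance, but a linear form in the walk can be
  degenerate, for instance at time 0. In that case the variables vanish almost surely and the limit
  is 1.\<close>

lemma iid_char_clt:
  fixes Y :: "nat \<Rightarrow> 'a \<Rightarrow> real"
  assumes ind: "indep_vars (\<lambda>_. borel) Y UNIV" and mean: "\<And>i. expectation (Y i) = 0"
    and sq: "\<And>i. integrable M (\<lambda>\<omega>. (Y i \<omega>)\<^sup>2)" "\<And>i. expectation (\<lambda>\<omega>. (Y i \<omega>)\<^sup>2) = s"
    and distr: "\<And>i. distr M borel (Y i) = \<mu>"
  shows "(\<lambda>n. char (distr M borel (\<lambda>\<omega>. (\<Sum>i<n. Y i \<omega>) / sqrt (real n))) 1)
    \<longlonglongrightarrow> complex_of_real (exp (- s / 2))"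
proof (cases "s = 0")
  case True
  have rv: "random_variable borel (Y i)" for i using ind by (simp add: indep_vars_def)
  have "AE \<omega> in M. Y i \<omega> = 0" for i
    using sq[of i] True by (simp add: integral_nonneg_eq_0_iff_AE)
  then have "AE \<omega> in M. \<forall>i. Y i \<omega> = 0" by (simp add: AE_all_countable)
  then have AE: "AE \<omega> in M. (\<Sum>i<n. Y i \<omega>) / sqrt (real n) = 0" for n
    by eventually_elim simp
  have m: "(\<lambda>\<omega>. (\<Sum>i<n. Y i \<omega>) / sqrt (real n)) \<in> borel_measurable M" for n
    by (intro borel_measurable_divide borel_measurable_sum rv) simp
  have "distr M borel (\<lambda>\<omega>. (\<Sum>i<n. Y i \<omega>) / sqrt (real n)) = distr M borel (\<lambda>_. 0)" for n
    by (rule distr_cong_AE[OF refl _ AE m]) auto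
  moreover have "char (distr M borel (\<lambda>_. 0)) 1 = 1"
    unfolding char_def by (subst integral_distr) (auto simp: prob_space)
  ultimately show ?thesis using True by simp
next
  case False
  have "s \<ge> 0" unfolding sq(2)[of 0, symmetric] by simp
  with False have s: "s > 0" by simp
  have rv: "random_variable borel (Y i)" for i using ind by (simp add: indep_vars_def)
  have S: "(\<lambda>\<omega>. (\<Sum>i<n. Y i \<omega>) / sqrt (real n * (sqrt s)\<^sup>2)) \<in> borel_measurable M" for n
    by (intro borel_measurable_divide borel_measurable_sum rv) simp
  have "weak_conv_m (\<lambda>n. distr M borel (\<lambda>\<omega>. (\<Sum>i<n. Y i \<omega>) / sqrt (real n * (sqrt s)\<^sup>2)))
    std_normal_distribution"
    by (rule central_limit_theorem_zero_mean[OF ind mean _ sq(1) _ distr]) (use s sq mean in auto)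
  \<comment> \<open>Evaluation at \<open>sqrt s\<close> undoes the normalisation by the standard
    deviation.\<close>
  from levy_continuity1[OF real_distribution_distr[OF S] real_dist_normal_dist this, of "sqrt s"]
  have "(\<lambda>n. char (distr M borel (\<lambda>\<omega>. (\<Sum>i<n. Y i \<omega>) / sqrt (real n * (sqrt s)\<^sup>2))) (1 * sqrt s))
    \<longlonglongrightarrow> complex_of_real (exp (- s / 2))"
    using s by (simp add: char_std_normal_distribution)
  moreover have "char (distr M borel (\<lambda>\<omega>. (\<Sum>i<n. Y i \<omega>) / sqrt (real n * (sqrt s)\<^sup>2))) (1 * sqrt s) =
    char (distr M borel (\<lambda>\<omega>. (\<Sum>i<n. Y i \<omega>) / sqrt (real n))) 1" for n
    unfolding char_distr_scale[OF S, symmetric]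
    using s by (simp add: real_sqrt_mult)
  ultimately show ?thesis by (simp only:)
qed

end

section \<open>Finite-dimensional convergence for fixed N\<close>

definition gauss_law :: "nat \<Rightarrow> (real \<Rightarrow> real) measure" where
  "gauss_law N = distr (gauss_measure N) (borel_of skorohod_topology) (\<lambda>g. step_path N (gauss_walk N g))"

lemma measurable_gauss_path:
  "(\<lambda>g. step_path N (gauss_walk N g)) \<in> gauss_measure N \<rightarrow>\<^sub>M borel_of skorohod_topology"
  by (rule measurable_compose[OF borel_measurable_sequence measurable_step_path])
     (rule borel_measurable_gauss_walk)

lemma prob_space_gauss_law: "prob_space (gauss_law N)"
  unfolding gauss_law_def
  by (intro prob_space.prob_space_distr prob_space_gauss_space measurable_gauss_path)

lemma sets_gauss_law [simp]: "sets (gauss_law N) = sets (borel_of skorohod_topology)"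
  by (simp add: gauss_law_def)

text \<open>Enumerating \<open>J\<close> turns finite-dimensional laws into laws of sequences padded
  with zeros, the format of the continuity theorem.\<close>

lemma fdd_integral:
  fixes f :: "(real \<Rightarrow> real) \<Rightarrow> real" and Y :: "real \<Rightarrow> 'a \<Rightarrow> real"
  assumes \<tau>: "bij_betw \<tau> {..<d} J"
    and f: "continuous_map (product_topology (\<lambda>_. euclideanreal) J) euclideanreal f"
    and Y: "\<And>t. t \<in> J \<Longrightarrow> Y t \<in> borel_measurable M"
  defines "F \<equiv> \<lambda>y :: nat \<Rightarrow> real. f (\<lambda>t\<in>J. y (the_inv_into {..<d} \<tau> t))"
  shows "continuous_on UNIV F"
    "(\<integral>x. f x \<partial>fdd M Y J) = (\<integral>\<omega>. F (\<lambda>k. if k < d then Y (\<tau> k) \<omega> else 0) \<partial>M)"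
proof -
  let ?i = "the_inv_into {..<d} \<tau>"
  have inj: "inj_on \<tau> {..<d}" and im: "\<tau> ` {..<d} = J" using \<tau> by (auto simp: bij_betw_def)
  have i: "?i t < d" "\<tau> (?i t) = t" if "t \<in> J" for t
    using the_inv_into_into[OF inj, of t "{..<d}"] f_the_inv_into_f[OF inj, of t] that im by auto
  have "continuous_map euclidean (product_topology (\<lambda>_. euclideanreal) J) (\<lambda>y :: nat \<Rightarrow> real. \<lambda>t\<in>J. y (?i t))"
    unfolding continuous_map_componentwise
    by (auto intro: continuous_on_product_coordinates)
  from continuous_map_compose[OF this f] show F: "continuous_on UNIV F"
    by (simp add: F_def comp_def)
  have Fm: "F \<in> borel_measurable borel" by (rule borel_measurable_continuous_onI[OF F])
  let ?e = "\<lambda>(z :: real \<Rightarrow> real) k. if k < d then z (\<tau> k) else 0"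
  have em: "?e \<in> PiM J (\<lambda>_. borel) \<rightarrow>\<^sub>M borel"
  proof (rule borel_measurable_sequence)
    fix k
    have "(\<lambda>z. z (\<tau> k)) \<in> borel_measurable (PiM J (\<lambda>_. borel))" if "k < d"
      by (rule measurable_component_singleton) (use that im in auto)
    then show "(\<lambda>z. ?e z k) \<in> borel_measurable (PiM J (\<lambda>_. borel))" by (cases "k < d") simp_all
  qed
  have Fe: "F (?e z) = f z" if "z \<in> extensional J" for z
  proof -
    have "(\<lambda>t\<in>J. ?e z (?i t)) = z" using that i by (auto simp: extensional_def restrict_def)
    then show ?thesis by (simp add: F_def)
  qed
  have "(\<lambda>z. F (?e z)) \<in> borel_measurable (PiM J (\<lambda>_. borel))"
    by (rule measurable_compose[OF em Fm])
  then have fm: "f \<in> borel_measurable (PiM J (\<lambda>_. borel))"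
    by (rule measurable_cong[THEN iffD1, rotated]) (simp add: space_PiM PiE_def Fe)
  have "(\<integral>x. f x \<partial>fdd M Y J) = (\<integral>\<omega>. f (\<lambda>t\<in>J. Y t \<omega>) \<partial>M)"
    unfolding fdd_def by (rule integral_distr[OF measurable_restrict[OF Y] fm])
  also have "\<dots> = (\<integral>\<omega>. F (\<lambda>k. if k < d then Y (\<tau> k) \<omega> else 0) \<partial>M)"
  proof (rule Bochner_Integration.integral_cong[OF refl])
    fix \<omega>
    have "?e (\<lambda>t\<in>J. Y t \<omega>) = (\<lambda>k. if k < d then Y (\<tau> k) \<omega> else 0)" using im by auto
    then show "f (\<lambda>t\<in>J. Y t \<omega>) = F (\<lambda>k. if k < d then Y (\<tau> k) \<omega> else 0)"
      using Fe[of "\<lambda>t\<in>J. Y t \<omega>"] by simp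
  qed
  finally show "(\<integral>x. f x \<partial>fdd M Y J) = (\<integral>\<omega>. F (\<lambda>k. if k < d then Y (\<tau> k) \<omega> else 0) \<partial>M)" .
qed

context
  fixes M :: "'a measure" and X :: "nat \<Rightarrow> 'a \<Rightarrow> nat \<Rightarrow> int"
  assumes M: "prob_space M"
    and indep: "prob_space.indep_vars M (\<lambda>_. walk_space) X {1..}"
    and law: "\<And>i. i \<ge> 1 \<Longrightarrow> distr M walk_space (X i) = annealed"
begin

lemma measurable_walk: "i \<ge> 1 \<Longrightarrow> X i \<in> M \<rightarrow>\<^sub>M walk_space"
  using indep by (simp add: prob_space.indep_vars_def[OF M])

lemma walk_expectation:
  fixes f :: "(nat \<Rightarrow> int) \<Rightarrow> real"
  assumes "i \<ge> 1" "f \<in> borel_measurable walk_space"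
  shows "(\<integral>\<omega>. f (X i \<omega>) \<partial>M) = (\<integral>x. f x \<partial>annealed)"
    "integrable M (\<lambda>\<omega>. f (X i \<omega>)) \<longleftrightarrow> integrable annealed f"
  using integral_distr[OF measurable_walk[OF assms(1)] assms(2)]
    integrable_distr_eq[OF measurable_walk[OF assms(1)] assms(2)] law[OF assms(1)] by simp_all

context
  fixes d :: nat and u :: "nat \<Rightarrow> real" and m :: "nat \<Rightarrow> nat"
begin

definition linear_form :: "(nat \<Rightarrow> int) \<Rightarrow> real" where
  "linear_form x = (\<Sum>k<d. u k * real_of_int (x (m k)))"

definition linear_form_var :: real where
  "linear_form_var = (\<Sum>k<d. \<Sum>l<d. u k * u l * walk_cov (m k) (m l))"

lemma borel_measurable_linear_form: "linear_form \<in> borel_measurable walk_space"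
  unfolding linear_form_def
  by (intro borel_measurable_sum borel_measurable_times borel_measurable_walk_coord) simp

lemma linear_form_iid:
  "prob_space.indep_vars M (\<lambda>_. borel) (\<lambda>i \<omega>. linear_form (X (Suc i) \<omega>)) UNIV"
  "(\<integral>\<omega>. linear_form (X (Suc i) \<omega>) \<partial>M) = 0"
  "integrable M (\<lambda>\<omega>. (linear_form (X (Suc i) \<omega>))\<^sup>2)"
  "(\<integral>\<omega>. (linear_form (X (Suc i) \<omega>))\<^sup>2 \<partial>M) = linear_form_var"
  "distr M borel (\<lambda>\<omega>. linear_form (X (Suc i) \<omega>)) = distr annealed borel linear_form"
proof -
  interpret prob_space M by (rule M)
  have "indep_vars (\<lambda>_. walk_space) (\<lambda>i. X (Suc i)) UNIV"
    by (rule indep_vars_reindex_inj[OF indep]) auto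
  then show "indep_vars (\<lambda>_. borel) (\<lambda>i \<omega>. linear_form (X (Suc i) \<omega>)) UNIV"
    by (rule indep_vars_compose2) (rule borel_measurable_linear_form)
  have i: "integrable annealed (\<lambda>x. real_of_int (x n))" for n
    by (rule annealed_integral(1)[where C="real n", OF borel_measurable_walk_coord])
       (rule walk_coord_bound)
  have "(\<integral>x. linear_form x \<partial>annealed) = (\<Sum>k<d. u k * (\<integral>x. real_of_int (x (m k)) \<partial>annealed))"
    unfolding linear_form_def using i by (subst Bochner_Integration.integral_sum) auto
  then show "(\<integral>\<omega>. linear_form (X (Suc i) \<omega>) \<partial>M) = 0"
    by (simp add: walk_expectation(1)[OF _ borel_measurable_linear_form] annealed_mean)
  have sqm: "(\<lambda>x. (linear_form x)\<^sup>2) \<in> borel_measurable walk_space"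
    by (intro borel_measurable_power borel_measurable_linear_form)
  have "(linear_form x)\<^sup>2 = (\<Sum>k<d. \<Sum>l<d. (u k * u l) * (real_of_int (x (m k)) * real_of_int (x (m l))))" for x
    by (simp add: linear_form_def power2_eq_square sum_product mult_ac)
  then have "integrable annealed (\<lambda>x. (linear_form x)\<^sup>2)"
    using integrable_annealed_bounded_coords
    by (simp add: Bochner_Integration.integrable_sum)
  then show "integrable M (\<lambda>\<omega>. (linear_form (X (Suc i) \<omega>))\<^sup>2)"
    using walk_expectation(2)[OF _ sqm, of "Suc i"] by simp
  show "(\<integral>\<omega>. (linear_form (X (Suc i) \<omega>))\<^sup>2 \<partial>M) = linear_form_var"
    using walk_expectation(1)[OF _ sqm, of "Suc i"] annealed_second_moment[where u=u and m=m and d=d]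
    by (simp add: linear_form_def linear_form_var_def)
  have "distr M borel (\<lambda>\<omega>. linear_form (X (Suc i) \<omega>)) = distr (distr M walk_space (X (Suc i))) borel linear_form"
    using distr_distr[OF borel_measurable_linear_form measurable_walk[of "Suc i"]] by (simp add: comp_def)
  then show "distr M borel (\<lambda>\<omega>. linear_form (X (Suc i) \<omega>)) = distr annealed borel linear_form"
    using law[of "Suc i"] by simp
qed

lemma sum_linear_form_shift:
  "(\<Sum>i=1..n. linear_form (X i \<omega>)) = (\<Sum>i<n. linear_form (X (Suc i) \<omega>))"
  by (simp add: sum.atLeast1_atMost_eq)

lemma linear_form_clt:
  "(\<lambda>n. char (distr M borel (\<lambda>\<omega>. (\<Sum>i=1..n. linear_form (X i \<omega>)) / sqrt (real n))) 1)
    \<longlonglongrightarrow> complex_of_real (exp (- linear_form_var / 2))"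
  unfolding sum_linear_form_shift
  by (rule prob_space.iid_char_clt[OF M linear_form_iid])

lemma linear_form_sum_second_moment:
  "integrable M (\<lambda>\<omega>. ((\<Sum>i=1..n. linear_form (X i \<omega>)) / sqrt (real n))\<^sup>2)"
  "(\<integral>\<omega>. ((\<Sum>i=1..n. linear_form (X i \<omega>)) / sqrt (real n))\<^sup>2 \<partial>M) \<le> linear_form_var"
proof -
  note S = prob_space.iid_second_moment[OF M linear_form_iid(1-4)]
  show "integrable M (\<lambda>\<omega>. ((\<Sum>i=1..n. linear_form (X i \<omega>)) / sqrt (real n))\<^sup>2)"
    unfolding sum_linear_form_shift power_divide by (intro integrable_divide_zero S(1))
  have v: "linear_form_var \<ge> 0" unfolding linear_form_iid(4)[of 0, symmetric] by simp
  have "(\<integral>\<omega>. ((\<Sum>i=1..n. linear_form (X i \<omega>)) / sqrt (real n))\<^sup>2 \<partial>M) = real n * linear_form_var / real n"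
    unfolding sum_linear_form_shift power_divide by (simp add: S(2))
  then show "(\<integral>\<omega>. ((\<Sum>i=1..n. linear_form (X i \<omega>)) / sqrt (real n))\<^sup>2 \<partial>M) \<le> linear_form_var"
    using v by (cases "n = 0") auto
qed

end

lemma rescaled_sum_eq:
  "rescaled_sum X N n t \<omega> =
    walk_scale N * ((\<Sum>i=1..n. real_of_int (X i \<omega> (nat \<lfloor>real N * t\<rfloor>))) / sqrt (real n))"
  by (simp add: rescaled_sum_def walk_scale_def)

lemma borel_measurable_rescaled_sum: "rescaled_sum X N n t \<in> borel_measurable M"
proof -
  have "(\<lambda>\<omega>. real_of_int (X i \<omega> k)) \<in> borel_measurable M" if "i \<ge> 1" for i k
    by (rule measurable_compose[OF measurable_walk[OF that] borel_measurable_walk_coord])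
  then have "(\<lambda>\<omega>. walk_scale N * ((\<Sum>i=1..n. real_of_int (X i \<omega> (nat \<lfloor>real N * t\<rfloor>))) / sqrt (real n)))
      \<in> borel_measurable M"
    by (intro borel_measurable_times borel_measurable_divide borel_measurable_sum) auto
  then show ?thesis by (simp add: rescaled_sum_eq[abs_def])
qed

text \<open>Exchanging the sums makes a linear combination over times into a normalised sum over
  independent walks, to which the one-dimensional central limit theorem applies.\<close>

lemma rescaled_sum_linear:
  "(\<Sum>k<d. u k * rescaled_sum X N n (\<tau> k) \<omega>) =
    (\<Sum>i=1..n. linear_form d (\<lambda>k. walk_scale N * u k) (\<lambda>k. nat \<lfloor>real N * \<tau> k\<rfloor>) (X i \<omega>)) / sqrt (real n)"
proof -
  have "(\<Sum>k<d. u k * rescaled_sum X N n (\<tau> k) \<omega>) =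
    (\<Sum>k<d. \<Sum>i=1..n. walk_scale N * u k * real_of_int (X i \<omega> (nat \<lfloor>real N * \<tau> k\<rfloor>)) / sqrt (real n))"
    unfolding rescaled_sum_eq sum_divide_distrib sum_distrib_left
    by (intro sum.cong) auto
  also have "\<dots> = (\<Sum>i=1..n. \<Sum>k<d. walk_scale N * u k * real_of_int (X i \<omega> (nat \<lfloor>real N * \<tau> k\<rfloor>)) / sqrt (real n))"
    by (rule sum.swap)
  finally show ?thesis by (simp add: linear_form_def sum_divide_distrib)
qed

lemma linear_form_var_scaled:
  assumes "\<And>k. k < d \<Longrightarrow> m k \<le> N"
  shows "linear_form_var d (\<lambda>k. walk_scale N * u k) m =
    (\<Sum>k<d. \<Sum>l<d. u k * u l * gauss_cov N (m k) (m l))"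
  unfolding linear_form_var_def
proof (intro sum.cong refl)
  fix k l assume "k \<in> {..<d}" "l \<in> {..<d}"
  then have "gauss_cov N (m k) (m l) = (walk_scale N)\<^sup>2 * walk_cov (m k) (m l)"
    using assms by (simp add: walk_scale_cov[symmetric] min_absorb1)
  then show "walk_scale N * u k * (walk_scale N * u l) * walk_cov (m k) (m l) =
      u k * u l * gauss_cov N (m k) (m l)"
    by (simp add: power2_eq_square)
qed

text \<open>Cramer-Wold: for each direction the limiting variance of the linear form is the
  quadratic form of \<open>gauss_cov\<close>, hence the characteristic functions converge to those
  of \<open>gauss_walk\<close>.\<close>

lemma fdd_converges_gauss_law:
  assumes N: "N \<ge> 2"
  shows "fdd_converges {0..1} M (rescaled_sum X N) (gauss_law N) (\<lambda>t z. z t)"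
  unfolding fdd_converges_def weakly_converges_def
proof (intro allI impI, elim conjE)
  fix J :: "real set" and f :: "(real \<Rightarrow> real) \<Rightarrow> real"
  assume J: "finite J" "J \<subseteq> {0..1}"
    and f: "continuous_map (product_topology (\<lambda>_. euclideanreal) J) euclideanreal f"
    and bd: "bounded (f ` topspace (product_topology (\<lambda>_. euclideanreal) J))"
  define d where "d = card J"
  obtain \<tau> where \<tau>: "bij_betw \<tau> {..<d} J"
    using ex_bij_betw_nat_finite[OF J(1)] by (auto simp: d_def lessThan_atLeast0)
  have \<tau>01: "\<tau> k \<in> {0..1}" if "k < d" for k using \<tau> J(2) that by (auto simp: bij_betw_def)
  obtain K where K: "\<And>x. x \<in> extensional J \<Longrightarrow> \<bar>f x\<bar> \<le> K"
    using bd by (auto simp: bounded_iff PiE_def)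
  define F where "F y = f (\<lambda>t\<in>J. y (the_inv_into {..<d} \<tau> t))" for y :: "nat \<Rightarrow> real"
  have Fb: "\<bar>F y\<bar> \<le> K" for y unfolding F_def by (intro K) simp
  define m where "m k = nat \<lfloor>real N * \<tau> k\<rfloor>" for k
  have mN: "m k \<le> N" if "k < d" for k unfolding m_def by (rule floor_index_le[OF \<tau>01[OF that]])
  define V where "V n \<omega> k = (if k < d then rescaled_sum X N n (\<tau> k) \<omega> else 0)" for n \<omega> k
  define W where "W g k = (if k < d then gauss_walk N g (m k) else 0)" for g k
  have eval: "(\<lambda>z. z t) \<in> borel_measurable (gauss_law N)" if "t \<in> J" for t
    using measurable_skorohod_eval[of t] J(2) that by (auto cong: measurable_cong_sets)
  have Fc: "continuous_on UNIV F"
    and IV: "(\<integral>x. f x \<partial>fdd M (rescaled_sum X N n) J) = (\<integral>\<omega>. F (V n \<omega>) \<partial>M)" for n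
    using fdd_integral[OF \<tau> f borel_measurable_rescaled_sum] by (simp_all add: F_def V_def)
  have "(\<integral>x. f x \<partial>fdd (gauss_law N) (\<lambda>t z. z t) J) =
      (\<integral>z. F (\<lambda>k. if k < d then z (\<tau> k) else 0) \<partial>gauss_law N)"
    using fdd_integral(2)[OF \<tau> f eval] by (simp add: F_def)
  also have "\<dots> = (\<integral>g. F (\<lambda>k. if k < d then step_path N (gauss_walk N g) (\<tau> k) else 0) \<partial>gauss_measure N)"
    unfolding gauss_law_def
  proof (rule integral_distr[OF measurable_gauss_path])
    have "(\<lambda>z. (if k < d then z (\<tau> k) else 0)) \<in> borel_measurable (borel_of skorohod_topology)" for k
      using measurable_skorohod_eval[OF \<tau>01[of k]] by (cases "k < d") simp_all
    then have "(\<lambda>z k. (if k < d then z (\<tau> k) else 0)) \<in> borel_of skorohod_topology \<rightarrow>\<^sub>M borel"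
      by (rule borel_measurable_sequence)
    from measurable_compose[OF this borel_measurable_continuous_onI[OF Fc]]
    show "(\<lambda>z. F (\<lambda>k. if k < d then z (\<tau> k) else 0)) \<in> borel_measurable (borel_of skorohod_topology)" .
  qed
  also have "\<dots> = (\<integral>g. F (W g) \<partial>gauss_measure N)"
  proof -
    have "(\<lambda>k. if k < d then step_path N (gauss_walk N g) (\<tau> k) else 0) = W g" for g
      using \<tau>01 by (auto simp: W_def m_def step_path_eq)
    then show ?thesis by simp
  qed
  finally have IW: "(\<integral>x. f x \<partial>fdd (gauss_law N) (\<lambda>t z. z t) J) = (\<integral>g. F (W g) \<partial>gauss_measure N)" .
  \<comment> \<open>A single coordinate is the one-term linear form with coefficient 1, so its
    second moment is bounded by the general estimate; the factor \<open>* 1\<close> keeps the shape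
    \<open>walk_scale N * u k\<close>.\<close>
  have single: "rescaled_sum X N n (\<tau> k) \<omega> =
      (\<Sum>i=1..n. linear_form 1 (\<lambda>_. walk_scale N * 1) (\<lambda>_. m k) (X i \<omega>)) / sqrt (real n)" for n k \<omega>
    using rescaled_sum_linear[where d=1 and u="\<lambda>_. 1" and \<tau>="\<lambda>_. \<tau> k"]
    by (simp add: m_def lessThan_Suc del: sum.lessThan_Suc)
  have singlevar: "linear_form_var 1 (\<lambda>_. walk_scale N * 1) (\<lambda>_. m k) \<le> var_const" if "k < d" for k
    using linear_form_var_scaled[where d=1 and u="\<lambda>_. 1" and m="\<lambda>_. m k" and N=N] mN[OF that] scaled_var_le_const[of "m k" N]
    by (simp add: gauss_cov_self min_absorb1)
  have "(\<lambda>n. \<integral>\<omega>. F (V n \<omega>) \<partial>M) \<longlonglongrightarrow> (\<integral>g. F (W g) \<partial>gauss_measure N)"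
  proof (rule multivariate_levy_continuity[where d=d and C=var_const, OF M prob_space_gauss_space
        _ _ _ _ _ _ _ _ _ Fc Fb])
    show "(\<lambda>\<omega>. V n \<omega> k) \<in> borel_measurable M" for n k
      unfolding V_def using borel_measurable_rescaled_sum by (cases "k < d") simp_all
    show "V n \<omega> k = 0" if "d \<le> k" for n \<omega> k using that by (simp add: V_def)
    show "integrable M (\<lambda>\<omega>. (V n \<omega> k)\<^sup>2)" for n k
      unfolding V_def using linear_form_sum_second_moment(1)
      by (cases "k < d") (simp_all only: single if_True if_False, simp)
    show "(\<integral>\<omega>. (V n \<omega> k)\<^sup>2 \<partial>M) \<le> var_const" for n k
    proof (cases "k < d")
      case True
      then show ?thesis
        unfolding V_def if_P[OF True] single
        by (intro order_trans[OF linear_form_sum_second_moment(2) singlevar])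
    next
      case False
      then show ?thesis using var_const_pos by (simp add: V_def)
    qed
    show "(\<lambda>g. W g k) \<in> borel_measurable (gauss_measure N)" for k
      unfolding W_def using borel_measurable_gauss_walk by (cases "k < d") simp_all
    show "W g k = 0" if "d \<le> k" for g k using that by (simp add: W_def)
    show "integrable (gauss_measure N) (\<lambda>g. (W g k)\<^sup>2)" for k
      unfolding W_def using gauss_walk_second_moment(1) by (cases "k < d") simp_all
    show "(\<integral>g. (W g k)\<^sup>2 \<partial>gauss_measure N) \<le> var_const" for k
      unfolding W_def using gauss_walk_second_moment(2) scaled_var_le_const var_const_pos by (cases "k < d") simp_all
    fix u :: "nat \<Rightarrow> real"
    have Veq: "(\<Sum>k<d. u k * V n \<omega> k) =
        (\<Sum>i=1..n. linear_form d (\<lambda>k. walk_scale N * u k) m (X i \<omega>)) / sqrt (real n)" for n \<omega>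
      using rescaled_sum_linear[where d=d and u=u and \<tau>=\<tau>] by (simp add: V_def m_def[abs_def])
    have var: "linear_form_var d (\<lambda>k. walk_scale N * u k) m =
        (\<Sum>k<d. \<Sum>l<d. u k * u l * gauss_cov N (m k) (m l))"
      by (rule linear_form_var_scaled[OF mN])
    have Weq: "(\<Sum>k<d. u k * W g k) = (\<Sum>k<d. u k * gauss_walk N g (m k))" for g
      by (simp add: W_def)
    show "(\<lambda>n. char (distr M borel (\<lambda>\<omega>. \<Sum>k<d. u k * V n \<omega> k)) 1)
      \<longlonglongrightarrow> char (distr (gauss_measure N) borel (\<lambda>g. \<Sum>k<d. u k * W g k)) 1"
      unfolding Veq Weq char_gauss_walk var[symmetric]
      by (rule linear_form_clt)
  qed
  then show "(\<lambda>n. \<integral>x. f x \<partial>fdd M (rescaled_sum X N n) J)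
      \<longlonglongrightarrow> (\<integral>x. f x \<partial>fdd (gauss_law N) (\<lambda>t z. z t) J)"
    unfolding IV IW .
qed

end

section \<open>Brownian motion and a maximal inequality\<close>

text \<open>Young's inequality (p + q)^2 \<le> 5/4 p^2 + 5 q^2, valid because 4/5 + 1/5 = 1, applied
  twice; this gives the constants (5/4)^3 and 5^3.\<close>

lemma fourth_power_add_le: "(x + y) ^ 4 \<le> 125 / 64 * x ^ 4 + 125 * (y::real) ^ 4"
proof -
  have sq: "(p + q)\<^sup>2 \<le> 5 / 4 * p\<^sup>2 + 5 * q\<^sup>2" for p q :: real
  proof -
    have "5 / 4 * p\<^sup>2 + 5 * q\<^sup>2 - (p + q)\<^sup>2 = (p / 2 - 2 * q)\<^sup>2"
      by (simp add: power2_eq_square algebra_simps)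
    moreover have "0 \<le> (p / 2 - 2 * q)\<^sup>2" by simp
    ultimately show ?thesis by linarith
  qed
  have "(x + y) ^ 4 = ((x + y)\<^sup>2)\<^sup>2" by simp
  also have "\<dots> \<le> (5 / 4 * x\<^sup>2 + 5 * y\<^sup>2)\<^sup>2" by (intro power_mono sq) simp
  also have "\<dots> \<le> 5 / 4 * (5 / 4 * x\<^sup>2)\<^sup>2 + 5 * (5 * y\<^sup>2)\<^sup>2" by (rule sq)
  also have "\<dots> = 125 / 64 * x ^ 4 + 125 * y ^ 4" by (simp add: power_mult_distrib power_divide)
  finally show ?thesis .
qed

definition max_osc :: "(nat \<Rightarrow> 'a \<Rightarrow> real) \<Rightarrow> nat \<Rightarrow> nat \<Rightarrow> 'a \<Rightarrow> real" where
  "max_osc S a b \<omega> = Max ((\<lambda>j. (S j \<omega> - S a \<omega>) ^ 4) ` {a..b})"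

lemma max_osc_ge: "a \<le> j \<Longrightarrow> j \<le> b \<Longrightarrow> (S j \<omega> - S a \<omega>) ^ 4 \<le> max_osc S a b \<omega>"
  unfolding max_osc_def by (intro Max_ge) auto

lemma max_osc_le:
  assumes "a \<le> b" "\<And>j. a \<le> j \<Longrightarrow> j \<le> b \<Longrightarrow> (S j \<omega> - S a \<omega>) ^ 4 \<le> K"
  shows "max_osc S a b \<omega> \<le> K"
  unfolding max_osc_def using assms by (intro Max.boundedI) auto

lemma max_osc_nonneg: "a \<le> b \<Longrightarrow> 0 \<le> max_osc S a b \<omega>"
  using max_osc_ge[of a a b S \<omega>] by simp

text \<open>Points right of \<open>c\<close> are compared with \<open>a\<close> by way of
  \<open>c\<close>. The larger of the two cases is bounded by a sum, whose expectation
  splits.\<close>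

lemma max_osc_split:
  assumes "a \<le> c" "c \<le> b"
  shows "max_osc S a b \<omega> \<le>
    max_osc S a c \<omega> + (125 / 64 * max_osc S c b \<omega> + 125 * (S c \<omega> - S a \<omega>) ^ 4)"
proof (rule max_osc_le)
  fix j assume j: "a \<le> j" "j \<le> b"
  have nonneg: "0 \<le> max_osc S a c \<omega>" "0 \<le> max_osc S c b \<omega>" "0 \<le> (S c \<omega> - S a \<omega>) ^ 4"
    using assms by (simp_all add: max_osc_nonneg)
  show "(S j \<omega> - S a \<omega>) ^ 4 \<le>
    max_osc S a c \<omega> + (125 / 64 * max_osc S c b \<omega> + 125 * (S c \<omega> - S a \<omega>) ^ 4)"
  proof (cases "j \<le> c")
    case True
    then have "(S j \<omega> - S a \<omega>) ^ 4 \<le> max_osc S a c \<omega>" using j by (intro max_osc_ge)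
    with nonneg show ?thesis by linarith
  next
    case False
    then have "(S j \<omega> - S c \<omega>) ^ 4 \<le> max_osc S c b \<omega>" using j by (intro max_osc_ge) auto
    moreover have "(S j \<omega> - S a \<omega>) ^ 4 \<le> 125 / 64 * (S j \<omega> - S c \<omega>) ^ 4 + 125 * (S c \<omega> - S a \<omega>) ^ 4"
      using fourth_power_add_le[of "S j \<omega> - S c \<omega>" "S c \<omega> - S a \<omega>"] by simp
    ultimately show ?thesis using nonneg by linarith
  qed
qed (use assms in simp)

lemma borel_measurable_max_osc:
  assumes "\<And>j. S j \<in> borel_measurable M"
  shows "max_osc S a b \<in> borel_measurable M"
proof -
  note [measurable] = assms
  show ?thesis unfolding max_osc_def[abs_def] by (intro borel_measurable_Max) auto
qed

lemma integrable_max_osc: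
  assumes S: "\<And>j. S j \<in> borel_measurable M"
    and int: "\<And>i j. integrable M (\<lambda>\<omega>. (S j \<omega> - S i \<omega>) ^ 4)" and ab: "a \<le> b"
  shows "integrable M (max_osc S a b)"
proof (rule Bochner_Integration.integrable_bound)
  show "integrable M (\<lambda>\<omega>. \<Sum>j\<in>{a..b}. (S j \<omega> - S a \<omega>) ^ 4)" using int by simp
  show "AE \<omega> in M. norm (max_osc S a b \<omega>) \<le> norm (\<Sum>j\<in>{a..b}. (S j \<omega> - S a \<omega>) ^ 4)"
  proof (rule AE_I2)
    fix \<omega>
    have "max_osc S a b \<omega> \<le> (\<Sum>j\<in>{a..b}. (S j \<omega> - S a \<omega>) ^ 4)"
      by (intro max_osc_le ab member_le_sum) auto
    then show "norm (max_osc S a b \<omega>) \<le> norm (\<Sum>j\<in>{a..b}. (S j \<omega> - S a \<omega>) ^ 4)"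
      using max_osc_nonneg[OF ab, of S \<omega>] by simp
  qed
qed (rule borel_measurable_max_osc[OF S])

text \<open>Splitting a block at its midpoint, the weights in \<open>(x + y)\<^sup>4 \<le> 125/64 x\<^sup>4 + 125 y\<^sup>4\<close> are chosen such
  that \<open>1 + 125/64 + 1 \<le> 4\<close>: a bound \<open>125 C L\<^sup>2\<close> for blocks of length \<open>L\<close> passes to length \<open>2 L\<close>.\<close>

lemma expectation_max_osc_le:
  assumes S: "\<And>j. S j \<in> borel_measurable M"
    and int: "\<And>i j. integrable M (\<lambda>\<omega>. (S j \<omega> - S i \<omega>) ^ 4)"
    and mom: "\<And>i j. i \<le> j \<Longrightarrow> (\<integral>\<omega>. (S j \<omega> - S i \<omega>) ^ 4 \<partial>M) \<le> C * (real (j - i))\<^sup>2"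
    and C: "C \<ge> 0" and ab: "a \<le> b" "b - a \<le> 2 ^ r"
  shows "(\<integral>\<omega>. max_osc S a b \<omega> \<partial>M) \<le> 125 * C * (2 ^ r)\<^sup>2"
  using ab
proof (induction r arbitrary: a b)
  case 0
  have "max_osc S a b \<omega> \<le> (S b \<omega> - S a \<omega>) ^ 4" for \<omega>
  proof (rule max_osc_le[OF 0(1)])
    fix j assume "a \<le> j" "j \<le> b"
    then have "j = a \<or> j = b" using 0(2) by auto
    then show "(S j \<omega> - S a \<omega>) ^ 4 \<le> (S b \<omega> - S a \<omega>) ^ 4" by auto
  qed
  then have "(\<integral>\<omega>. max_osc S a b \<omega> \<partial>M) \<le> (\<integral>\<omega>. (S b \<omega> - S a \<omega>) ^ 4 \<partial>M)"
    by (intro integral_mono integrable_max_osc[OF S int 0(1)] int)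
  also have "\<dots> \<le> C * (real (b - a))\<^sup>2" by (rule mom[OF 0(1)])
  also have "\<dots> \<le> C * 1\<^sup>2" using 0(2) C by (intro mult_left_mono power_mono) auto
  finally show ?case using C by simp
next
  case (Suc r)
  show ?case
  proof (cases "b - a \<le> 2 ^ r")
    case True
    from Suc.IH[OF Suc.prems(1) True] have "(\<integral>\<omega>. max_osc S a b \<omega> \<partial>M) \<le> 125 * C * (2 ^ r)\<^sup>2" .
    also have "\<dots> \<le> 125 * C * (2 ^ Suc r)\<^sup>2"
      using C by (intro mult_left_mono power_mono power_increasing) auto
    finally show ?thesis .
  next
    case False
    define c where "c = a + 2 ^ r"
    have c: "a \<le> c" "c \<le> b" "c - a \<le> 2 ^ r" "b - c \<le> 2 ^ r" "c - a = 2 ^ r"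
      using False Suc.prems by (auto simp: c_def)
    have i: "integrable M (max_osc S a b)" "integrable M (max_osc S a c)" "integrable M (max_osc S c b)"
      using c by (auto intro!: integrable_max_osc[OF S int])
    have "(\<integral>\<omega>. max_osc S a b \<omega> \<partial>M) \<le>
      (\<integral>\<omega>. max_osc S a c \<omega> + (125 / 64 * max_osc S c b \<omega> + 125 * (S c \<omega> - S a \<omega>) ^ 4) \<partial>M)"
      using i int by (intro integral_mono max_osc_split c) auto
    also have "\<dots> = (\<integral>\<omega>. max_osc S a c \<omega> \<partial>M) + (125 / 64 * (\<integral>\<omega>. max_osc S c b \<omega> \<partial>M) +
        125 * (\<integral>\<omega>. (S c \<omega> - S a \<omega>) ^ 4 \<partial>M))"
      using i int by simp
    \<comment> \<open>The increment up to the midpoint costs 125 times \<open>C * (2 ^ r)^2\<close>,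
      exactly one copy of the inductive bound; this is where the factor 125 in the claim comes
      from.\<close>
    also have "\<dots> \<le> 125 * C * (2 ^ r)\<^sup>2 + (125 / 64 * (125 * C * (2 ^ r)\<^sup>2) + 125 * (C * (2 ^ r)\<^sup>2))"
      using Suc.IH[OF c(1,3)] Suc.IH[OF c(2,4)] mom[OF c(1)] c(5)
      by (intro add_mono mult_left_mono) auto
    also have "\<dots> = 125 * (253 / 64) * (C * (2 ^ r)\<^sup>2)" by (simp add: algebra_simps)
    also have "\<dots> \<le> 125 * 4 * (C * (2 ^ r)\<^sup>2)" using C by (intro mult_right_mono) auto
    also have "\<dots> = 125 * C * (2 ^ Suc r)\<^sup>2" by (simp add: power_mult_distrib)
    finally show ?thesis .
  qed
qed

section \<open>Brownian paths and their values on a grid\<close>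

lemma random_path_cadlag:
  assumes "continuous_on {0..1} (\<lambda>t. B t \<omega>)"
  shows "random_path B \<omega> \<in> cadlag"
  unfolding cadlag_def random_path_def
proof (intro CollectI conjI ballI)
  let ?x = "\<lambda>t\<in>{0..1::real}. B t \<omega>"
  show "?x \<in> extensional {0..1}" by simp
  have c: "continuous_on {0..1} ?x" by (rule continuous_on_eq[OF assms]) simp
  fix t :: real
  show "(?x \<longlongrightarrow> ?x t) (at_right t)" if t: "t \<in> {0..<1}"
  proof -
    have "(?x \<longlongrightarrow> ?x t) (at t within {0..1})"
      by (rule c[unfolded continuous_on_def, rule_format]) (use t in auto)
    then have "(?x \<longlongrightarrow> ?x t) (at t within {t..1})" by (rule tendsto_within_subset) (use t in auto)
    then show ?thesis using t by (simp add: at_within_Icc_at_right)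
  qed
  show "\<exists>l. (?x \<longlongrightarrow> l) (at_left t)" if t: "t \<in> {0<..1}"
  proof -
    have "(?x \<longlongrightarrow> ?x t) (at t within {0..1})"
      by (rule c[unfolded continuous_on_def, rule_format]) (use t in auto)
    then have "(?x \<longlongrightarrow> ?x t) (at t within {0..t})" by (rule tendsto_within_subset) (use t in auto)
    then show ?thesis using t by (auto simp: at_within_Icc_at_left)
  qed
qed

lemma real_floor_div:
  assumes "m > 0" "t \<in> {0..1}"
  shows "\<bar>min 1 (real (nat \<lfloor>real m * t\<rfloor>) / real m) - t\<bar> \<le> 1 / real m"
proof -
  have "real m * t \<ge> 0" using assms by simp
  then have f: "real (nat \<lfloor>real m * t\<rfloor>) = of_int \<lfloor>real m * t\<rfloor>" by simp
  have "of_int \<lfloor>real m * t\<rfloor> \<le> real m * t" "real m * t \<le> of_int \<lfloor>real m * t\<rfloor> + 1" by linarith+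
  then have "real (nat \<lfloor>real m * t\<rfloor>) / real m \<le> t" "t \<le> real (nat \<lfloor>real m * t\<rfloor>) / real m + 1 / real m"
    using assms(1) unfolding f by (simp_all add: field_simps)
  then show ?thesis using assms(2) by (auto simp: abs_le_iff min_def)
qed

text \<open>The cut-off at 1 keeps every entry of the infinite sequence inside the time interval, so
  that all of them are random variables.\<close>

definition path_grid :: "(real \<Rightarrow> 'a \<Rightarrow> real) \<Rightarrow> nat \<Rightarrow> 'a \<Rightarrow> real \<Rightarrow> real" where
  "path_grid B m \<omega> = step_path m (\<lambda>k. B (min 1 (real k / real m)) \<omega>)"

lemma path_grid_cadlag: "path_grid B m \<omega> \<in> cadlag"
  by (simp add: path_grid_def step_path_cadlag)

text \<open>Uniform continuity on the compact interval turns the mesh 1/m into a uniform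
  bound.\<close>

lemma path_grid_approximates_continuous:
  assumes c: "continuous_on {0..1} (\<lambda>t. B t \<omega>)"
  shows "(\<lambda>m. skorohod_dist (path_grid B m \<omega>) (random_path B \<omega>)) \<longlonglongrightarrow> 0"
proof (rule LIMSEQ_I)
  fix r :: real assume r: "r > 0"
  have "uniformly_continuous_on {0..1} (\<lambda>t. B t \<omega>)"
    by (rule compact_uniformly_continuous[OF c]) simp
  then obtain \<delta> where \<delta>: "\<delta> > 0"
    "\<And>s t. s \<in> {0..1} \<Longrightarrow> t \<in> {0..1} \<Longrightarrow> dist s t < \<delta> \<Longrightarrow> dist (B s \<omega>) (B t \<omega>) < r / 2"
    unfolding uniformly_continuous_on_def using r by (metis half_gt_zero)
  obtain n where n: "1 / real (Suc n) < \<delta>"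
    using reals_Archimedean[OF \<delta>(1)] by (auto simp: inverse_eq_divide)
  show "\<exists>no. \<forall>m\<ge>no. norm (skorohod_dist (path_grid B m \<omega>) (random_path B \<omega>) - 0) < r"
  proof (intro exI[of _ "Suc n"] allI impI)
    fix m assume m: "m \<ge> Suc n"
    have "1 / real m \<le> 1 / real (Suc n)" using m by (intro divide_left_mono) auto
    then have md: "1 / real m < \<delta>" using n by linarith
    have "skorohod_dist (path_grid B m \<omega>) (random_path B \<omega>) \<le> r / 2"
    proof (rule skorohod_dist_le[OF path_grid_cadlag random_path_cadlag[where B=B and \<omega>=\<omega>, OF c]])
      fix t :: real assume t: "t \<in> {0..1}"
      let ?s = "min 1 (real (nat \<lfloor>real m * t\<rfloor>) / real m)"
      have "\<bar>?s - t\<bar> \<le> 1 / real m" by (rule real_floor_div[OF _ t]) (use m in simp)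
      then have "dist ?s t < \<delta>" using md by (simp add: dist_real_def)
      then have "dist (B ?s \<omega>) (B t \<omega>) < r / 2" using t by (intro \<delta>(2)) auto
      then show "\<bar>path_grid B m \<omega> t - random_path B \<omega> t\<bar> \<le> r / 2"
        using t by (simp add: path_grid_def step_path_eq random_path_def dist_real_def)
    qed (use r in simp)
    then show "norm (skorohod_dist (path_grid B m \<omega>) (random_path B \<omega>) - 0) < r"
      using r by simp
  qed
qed

context
  fixes M :: "'b measure" and B :: "real \<Rightarrow> 'b \<Rightarrow> real"
  assumes bm: "brownian_motion M B"
begin

lemma brownian_prob_space: "prob_space M"
  using bm by (simp add: brownian_motion_def)

lemma borel_measurable_brownian: "t \<in> {0..1} \<Longrightarrow> B t \<in> borel_measurable M"
  using bm by (simp add: brownian_motion_def)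

lemma brownian_continuous: "\<omega> \<in> space M \<Longrightarrow> continuous_on {0..1} (\<lambda>t. B t \<omega>)"
  using bm by (simp add: brownian_motion_def)

lemma measurable_brownian_step:
  "(\<lambda>\<omega>. path_grid B m \<omega>) \<in> M \<rightarrow>\<^sub>M borel_of skorohod_topology"
  unfolding path_grid_def
  by (rule measurable_compose[OF borel_measurable_sequence measurable_step_path])
     (rule borel_measurable_brownian, auto)

lemma measurable_brownian_path: "random_path B \<in> M \<rightarrow>\<^sub>M borel_of skorohod_topology"
  by (rule measurable_skorohod_limit[OF measurable_brownian_step])
     (auto intro: random_path_cadlag path_grid_approximates_continuous brownian_continuous)

lemma prob_space_path_law: "prob_space (path_law M B)"
  unfolding path_law_def
  by (intro prob_space.prob_space_distr brownian_prob_space measurable_brownian_path)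

lemma brownian_increment_distr:
  assumes st: "0 \<le> s" "s < t" "t \<le> 1"
  shows "distr M borel (\<lambda>\<omega>. (B t \<omega> - B s \<omega>) / sqrt (t - s)) = std_normal_distribution"
proof -
  interpret prob_space M by (rule brownian_prob_space)
  have "distributed M lborel (\<lambda>\<omega>. B t \<omega> - B s \<omega>) (normal_density 0 (sqrt (t - s)))"
    using bm st by (simp add: brownian_motion_def)
  then have "distributed M lborel (\<lambda>\<omega>. (B t \<omega> - B s \<omega> - 0) / sqrt (t - s)) std_normal_density"
    using st by (subst (asm) normal_standard_normal_convert) simp_all
  then have "distr M lborel (\<lambda>\<omega>. (B t \<omega> - B s \<omega>) / sqrt (t - s)) = std_normal_distribution"
    by (simp add: distributed_def)
  moreover have "distr M borel (\<lambda>\<omega>. (B t \<omega> - B s \<omega>) / sqrt (t - s)) =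
      distr M lborel (\<lambda>\<omega>. (B t \<omega> - B s \<omega>) / sqrt (t - s))"
    by (rule distr_cong) simp_all
  ultimately show ?thesis by simp
qed

lemma borel_measurable_brownian_increment:
  assumes "s \<in> {0..1}" "t \<in> {0..1}"
  shows "(\<lambda>\<omega>. (B t \<omega> - B s \<omega>) / r) \<in> borel_measurable M"
  by (intro borel_measurable_divide borel_measurable_diff borel_measurable_brownian assms) simp

lemma char_brownian_increment:
  assumes st: "0 \<le> s" "s < t" "t \<le> 1"
  shows "char (distr M borel (\<lambda>\<omega>. c * (B t \<omega> - B s \<omega>))) 1 = exp (- (c\<^sup>2 * (t - s)) / 2)"
proof -
  have "(\<lambda>\<omega>. c * (B t \<omega> - B s \<omega>)) = (\<lambda>\<omega>. (c * sqrt (t - s)) * ((B t \<omega> - B s \<omega>) / sqrt (t - s)))"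
    using st by (auto simp: fun_eq_iff)
  then have "char (distr M borel (\<lambda>\<omega>. c * (B t \<omega> - B s \<omega>))) 1 =
      char (distr M borel (\<lambda>\<omega>. (B t \<omega> - B s \<omega>) / sqrt (t - s))) (1 * (c * sqrt (t - s)))"
    using st by (simp only:) (intro char_distr_scale borel_measurable_brownian_increment, auto)
  then show ?thesis
    using st by (simp add: brownian_increment_distr char_std_normal_distribution power_mult_distrib)
qed

lemma brownian_zero: "AE \<omega> in M. B 0 \<omega> = 0"
  using bm by (simp add: brownian_motion_def)

lemma brownian_second_moment:
  assumes t: "t \<in> {0..1}"
  shows "integrable M (\<lambda>\<omega>. (B t \<omega>)\<^sup>2)" "(\<integral>\<omega>. (B t \<omega>)\<^sup>2 \<partial>M) = t"
proof -
  interpret prob_space M by (rule brownian_prob_space)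
  have m: "(\<lambda>\<omega>. (B s \<omega>)\<^sup>2) \<in> borel_measurable M" if "s \<in> {0..1}" for s
    by (intro borel_measurable_power borel_measurable_brownian that)
  have "integrable M (\<lambda>\<omega>. (B t \<omega>)\<^sup>2) \<and> (\<integral>\<omega>. (B t \<omega>)\<^sup>2 \<partial>M) = t"
  proof (cases "t = 0")
    case True
    have AE: "AE \<omega> in M. (B t \<omega>)\<^sup>2 = 0" using brownian_zero True by simp
    have "integrable M (\<lambda>\<omega>. (B t \<omega>)\<^sup>2) \<longleftrightarrow> integrable M (\<lambda>\<omega>. 0 :: real)"
      using AE by (intro integrable_cong_AE m t) auto
    moreover have "(\<integral>\<omega>. (B t \<omega>)\<^sup>2 \<partial>M) = (\<integral>\<omega>. 0 \<partial>M)"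
      using AE by (intro integral_cong_AE m t) auto
    ultimately show ?thesis using True by simp
  next
    case False
    let ?X = "\<lambda>\<omega>. (B t \<omega> - B 0 \<omega>) / sqrt (t - 0)"
    have X: "?X \<in> borel_measurable M" using t by (intro borel_measurable_brownian_increment) auto
    have p: "(\<lambda>x :: real. x ^ (2 * 1)) \<in> borel_measurable borel" by simp
    have d: "distr M borel ?X = std_normal_distribution"
      using t False by (intro brownian_increment_distr) auto
    have X2: "integrable M (\<lambda>\<omega>. ?X \<omega> ^ (2 * 1))" "(\<integral>\<omega>. ?X \<omega> ^ (2 * 1) \<partial>M) = 1"
      using std_normal_distribution_even_moments[of 1]
      unfolding d[symmetric] integrable_distr_eq[OF X p] integral_distr[OF X p] by simp_all
    have eq: "AE \<omega> in M. (B t \<omega>)\<^sup>2 = t * ?X \<omega> ^ (2 * 1)"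
      using brownian_zero
    proof eventually_elim
      case (elim \<omega>)
      then show ?case using t False by (simp add: power_divide)
    qed
    have i: "integrable M (\<lambda>\<omega>. t * ?X \<omega> ^ (2 * 1))" by (intro integrable_mult_right X2(1))
    have m2: "(\<lambda>\<omega>. t * ?X \<omega> ^ (2 * 1)) \<in> borel_measurable M"
      by (intro borel_measurable_times borel_measurable_power X) simp
    have "integrable M (\<lambda>\<omega>. (B t \<omega>)\<^sup>2)"
      using integrable_cong_AE[OF m[OF t] m2 eq] i by simp
    moreover have "(\<integral>\<omega>. (B t \<omega>)\<^sup>2 \<partial>M) = (\<integral>\<omega>. t * ?X \<omega> ^ (2 * 1) \<partial>M)"
      by (rule integral_cong_AE[OF m[OF t] m2 eq])
    ultimately show ?thesis using X2(2) by simp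
  qed
  then show "integrable M (\<lambda>\<omega>. (B t \<omega>)\<^sup>2)" "(\<integral>\<omega>. (B t \<omega>)\<^sup>2 \<partial>M) = t" by auto
qed

lemma brownian_indep_increments:
  fixes \<tau> :: "nat \<Rightarrow> real" and n :: nat
  assumes "\<And>i. i \<le> n \<Longrightarrow> \<tau> i \<in> {0..1}" "\<And>i. i < n \<Longrightarrow> \<tau> i < \<tau> (Suc i)"
  shows "prob_space.indep_vars M (\<lambda>_. borel) (\<lambda>i \<omega>. B (\<tau> (Suc i)) \<omega> - B (\<tau> i) \<omega>) {..<n}"
proof -
  have "\<forall>(n::nat) \<tau>. (\<forall>i\<le>n. \<tau> i \<in> {0..1}) \<and> (\<forall>i<n. \<tau> i < \<tau> (Suc i)) \<longrightarrow>
      prob_space.indep_vars M (\<lambda>_. borel) (\<lambda>i \<omega>. B (\<tau> (Suc i)) \<omega> - B (\<tau> i) \<omega>) {..<n}"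
    using bm unfolding brownian_motion_def by (elim conjE)
  from this[THEN spec, THEN spec, of n \<tau>] show ?thesis using assms by blast
qed

text \<open>Summation by parts turns a linear form in \<open>B (k / m)\<close> into one in the independent increments.\<close>

lemma char_brownian_grid:
  assumes m: "m > 0"
  shows "char (distr M borel (\<lambda>\<omega>. \<Sum>k<Suc m. w k * B (real k / real m) \<omega>)) 1 =
    exp (- (\<Sum>k<Suc m. \<Sum>l<Suc m. w k * w l * (real (min k l) / real m)) / 2)"
proof -
  interpret prob_space M by (rule brownian_prob_space)
  \<comment> \<open>The coefficient of the increment number \<open>j\<close> collects the weights of
    all grid points after it.\<close>
  define c where "c j = (\<Sum>k<Suc m. if j < k then w k else 0)" for j
  have grid: "real k / real m \<in> {0..1}" if "k \<le> m" for k using m that by simp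
  have abel: "(\<Sum>k<Suc m. w k * (\<Sum>j<k. a j)) = (\<Sum>j<m. c j * a j)" for a :: "nat \<Rightarrow> real"
  proof -
    have "(\<Sum>k<Suc m. w k * (\<Sum>j<k. a j)) = (\<Sum>k<Suc m. \<Sum>j<m. (if j < k then w k else 0) * a j)"
    proof (rule sum.cong[OF refl])
      fix k assume k: "k \<in> {..<Suc m}"
      have "(\<Sum>j<m. (if j < k then w k else 0) * a j) = (\<Sum>j\<in>{..<m} \<inter> {j. j < k}. w k * a j)"
        by (subst sum.inter_restrict) (auto intro!: sum.cong)
      also have "{..<m} \<inter> {j. j < k} = {..<k}" using k by auto
      finally show "w k * (\<Sum>j<k. a j) = (\<Sum>j<m. (if j < k then w k else 0) * a j)"
        by (simp add: sum_distrib_left)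
    qed
    also have "\<dots> = (\<Sum>j<m. c j * a j)"
      unfolding c_def sum_distrib_right by (rule sum.swap)
    finally show ?thesis .
  qed
  have csq: "(\<Sum>j<m. (c j)\<^sup>2) = (\<Sum>k<Suc m. \<Sum>l<Suc m. w k * w l * real (min k l))"
  proof -
    have "(\<Sum>j<m. (c j)\<^sup>2) =
      (\<Sum>j<m. \<Sum>k<Suc m. \<Sum>l<Suc m. (if j < k then w k else 0) * (if j < l then w l else 0))"
      by (simp only: power2_eq_square c_def sum_product)
    also have "\<dots> = (\<Sum>k<Suc m. \<Sum>l<Suc m. \<Sum>j<m. (if j < k then w k else 0) * (if j < l then w l else 0))"
      by (rule trans[OF sum.swap]) (rule sum.cong[OF refl], rule sum.swap)
    also have "\<dots> = (\<Sum>k<Suc m. \<Sum>l<Suc m. w k * w l * real (min k l))"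
    proof (intro sum.cong refl)
      \<comment> \<open>An increment contributes to the pair \<open>k\<close>, \<open>l\<close> iff
        it precedes both, hence \<open>min k l\<close> of them do.\<close>
      fix k l assume kl: "k \<in> {..<Suc m}" "l \<in> {..<Suc m}"
      have "(\<Sum>j<m. (if j < k then w k else 0) * (if j < l then w l else 0)) =
        (\<Sum>j\<in>{..<m} \<inter> {j. j < min k l}. w k * w l)"
        by (subst sum.inter_restrict) (auto intro!: sum.cong)
      also have "{..<m} \<inter> {j. j < min k l} = {..<min k l}" using kl by auto
      finally show "(\<Sum>j<m. (if j < k then w k else 0) * (if j < l then w l else 0)) =
        w k * w l * real (min k l)" by simp
    qed
    finally show ?thesis .
  qed
  let ?I = "\<lambda>j \<omega>. B (real (Suc j) / real m) \<omega> - B (real j / real m) \<omega>"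
  have ind: "indep_vars (\<lambda>_. borel) (\<lambda>j \<omega>. ?I j \<omega>) {..<m}"
  proof -
    have "\<forall>i\<le>m. real i / real m \<in> {0..1}" using grid by blast
    moreover have "\<forall>i<m. real i / real m < real (Suc i) / real m"
      using m by (simp add: divide_strict_right_mono)
    ultimately show ?thesis by (intro brownian_indep_increments[where \<tau>="\<lambda>i. real i / real m"]) auto
  qed
  have indc: "indep_vars (\<lambda>_. borel) (\<lambda>j \<omega>. c j * ?I j \<omega>) {..<m}"
    by (rule indep_vars_compose2[OF ind]) simp
  have "distr M borel (\<lambda>\<omega>. \<Sum>k<Suc m. w k * B (real k / real m) \<omega>) =
      distr M borel (\<lambda>\<omega>. \<Sum>j<m. c j * ?I j \<omega>)"
  proof (rule distr_cong_AE[OF refl])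
    show "AE \<omega> in M. (\<Sum>k<Suc m. w k * B (real k / real m) \<omega>) = (\<Sum>j<m. c j * ?I j \<omega>)"
      using brownian_zero
    proof eventually_elim
      case (elim \<omega>)
      have "(\<Sum>j<k. ?I j \<omega>) = B (real k / real m) \<omega>" for k
        using elim by (induction k) auto
      then show ?case unfolding abel[symmetric] by simp
    qed
    show "(\<lambda>\<omega>. \<Sum>k<Suc m. w k * B (real k / real m) \<omega>) \<in> borel_measurable M"
      by (intro borel_measurable_sum borel_measurable_times borel_measurable_brownian grid) auto
    show "(\<lambda>\<omega>. \<Sum>j<m. c j * ?I j \<omega>) \<in> borel_measurable M"
      by (intro borel_measurable_sum borel_measurable_times borel_measurable_diff
          borel_measurable_brownian grid) auto
  qed simp
  then have "char (distr M borel (\<lambda>\<omega>. \<Sum>k<Suc m. w k * B (real k / real m) \<omega>)) 1 =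
      (\<Prod>j<m. char (distr M borel (\<lambda>\<omega>. c j * ?I j \<omega>)) 1)"
    by (simp only: char_distr_sum[OF indc])
  also have "\<dots> = (\<Prod>j<m. complex_of_real (exp (- ((c j)\<^sup>2 / real m) / 2)))"
  proof (rule prod.cong[OF refl])
    fix j assume "j \<in> {..<m}"
    then have "char (distr M borel (\<lambda>\<omega>. c j * ?I j \<omega>)) 1 =
      exp (- ((c j)\<^sup>2 * (real (Suc j) / real m - real j / real m)) / 2)"
      using m by (intro char_brownian_increment) (auto simp: divide_strict_right_mono)
    then show "char (distr M borel (\<lambda>\<omega>. c j * ?I j \<omega>)) 1 = complex_of_real (exp (- ((c j)\<^sup>2 / real m) / 2))"
      by (simp add: diff_divide_distrib[symmetric])
  qed
  also have "\<dots> = complex_of_real (exp (\<Sum>j<m. - ((c j)\<^sup>2 / real m) / 2))"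
    by (simp add: exp_sum)
  also have "(\<Sum>j<m. - ((c j)\<^sup>2 / real m) / 2) = - ((\<Sum>j<m. (c j)\<^sup>2) / real m) / 2"
    by (simp add: sum_divide_distrib sum_negf)
  also have "(\<Sum>j<m. (c j)\<^sup>2) / real m = (\<Sum>k<Suc m. \<Sum>l<Suc m. w k * w l * (real (min k l) / real m))"
    unfolding csq by (simp only: sum_divide_distrib times_divide_eq_right)
  finally show ?thesis .
qed

end

section \<open>Convergence of the covariances on a grid\<close>

lemma real_nat_div_le: "real (x div m) \<le> real x / real m"
proof (cases "m = 0")
  case False
  have "real m * real (x div m) \<le> real x"
    by (metis of_nat_le_iff of_nat_mult times_div_less_eq_dividend)
  then show ?thesis using False by (simp add: pos_le_divide_eq mult.commute)
qed simp

lemma div_ratio_tendsto: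
  assumes "m > 0"
  shows "(\<lambda>N. real (N * k div m) / real N) \<longlonglongrightarrow> real k / real m"
proof -
  have lo: "(\<lambda>N. real k / real m - 1 / real N) \<longlonglongrightarrow> real k / real m - 0"
    by (intro tendsto_diff tendsto_const lim_1_over_n)
  have bounds: "real k / real m - 1 / real N \<le> real (N * k div m) / real N \<and>
      real (N * k div m) / real N \<le> real k / real m" if N: "N > 0" for N
  proof -
    have "real (N * k) = real m * real (N * k div m) + real (N * k mod m)"
      by (metis mult_div_mod_eq of_nat_add of_nat_mult)
    moreover have "real (N * k mod m) \<le> real m" using assms by (simp add: less_imp_le)
    ultimately have "real (N * k) \<le> real m * real (N * k div m) + real m" by linarith
    then have "real (N * k) / real m - 1 \<le> real (N * k div m)"
      using assms by (simp add: field_simps)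
    then have "(real (N * k) / real m - 1) / real N \<le> real (N * k div m) / real N"
      by (rule divide_right_mono) simp
    moreover have "(real (N * k) / real m - 1) / real N = real k / real m - 1 / real N"
      using N by (simp add: diff_divide_distrib)
    moreover have "real (N * k div m) / real N \<le> (real (N * k) / real m) / real N"
      by (intro divide_right_mono real_nat_div_le) simp
    ultimately show ?thesis using N by simp
  qed
  have "eventually (\<lambda>N. N > (0::nat)) sequentially" by (rule eventually_gt_at_top)
  then have "eventually (\<lambda>N. real k / real m - 1 / real N \<le> real (N * k div m) / real N) sequentially"
    "eventually (\<lambda>N. real (N * k div m) / real N \<le> real k / real m) sequentially"
    by (eventually_elim, simp add: bounds)+
  from tendsto_sandwich[OF this lo[unfolded diff_zero] tendsto_const] show ?thesis .
qed

lemma gauss_cov_tendsto: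
  assumes m: "m > 0" and kl: "k \<le> m" "l \<le> m"
  shows "(\<lambda>N. gauss_cov N (N * k div m) (N * l div m)) \<longlonglongrightarrow> real (min k l) / real m"
proof -
  have le: "N * k div m \<le> N" if "k \<le> m" for N k
    using that m by (metis div_le_mono mult_le_mono2 nonzero_mult_div_cancel_right not_gr_zero)
  have le_case: "(\<lambda>N. gauss_cov N (N * k div m) (N * l div m)) \<longlonglongrightarrow> real k / real m"
    if kl: "k \<le> l" "l \<le> m" for k l
  proof -
    let ?a = "\<lambda>N. N * k div m" and ?b = "\<lambda>N. N * l div m"
    have ab: "?a N \<le> ?b N" "?a N \<le> N" "?b N \<le> N" for N
      using kl le by (auto intro: div_le_mono)
    have "(\<lambda>N. real (?b N) / real N - real (?a N) / real N) \<longlonglongrightarrow> real l / real m - real k / real m"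
      by (intro tendsto_diff div_ratio_tendsto m)
    then have d: "(\<lambda>N. real (?b N - ?a N) / real N) \<longlonglongrightarrow> real l / real m - real k / real m"
      by (simp add: diff_divide_distrib of_nat_diff ab)
    have A: "(\<lambda>N. scaled_var N (?a N)) \<longlonglongrightarrow> real k / real m"
      by (rule scaled_var_tendsto[OF ab(2) div_ratio_tendsto[OF m]]) simp
    have B: "(\<lambda>N. scaled_var N (?b N)) \<longlonglongrightarrow> real l / real m"
      by (rule scaled_var_tendsto[OF ab(3) div_ratio_tendsto[OF m]]) simp
    have D: "(\<lambda>N. scaled_var N (?b N - ?a N)) \<longlonglongrightarrow> real l / real m - real k / real m"
    proof (rule scaled_var_tendsto[OF _ d])
      show "?b N - ?a N \<le> N" for N using ab(3)[of N] by linarith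
      show "0 \<le> real l / real m - real k / real m" using kl by (simp add: divide_right_mono)
    qed
    \<comment> \<open>With s = k/m and t = l/m the limit is (s + t - (t - s)) / 2 = s, the Brownian
      covariance.\<close>
    have lim: "(\<lambda>N. (scaled_var N (?a N) + scaled_var N (?b N) - scaled_var N (?b N - ?a N)) / 2)
      \<longlonglongrightarrow> (real k / real m + real l / real m - (real l / real m - real k / real m)) / 2"
      by (rule tendsto_divide[OF tendsto_diff[OF tendsto_add[OF A B] D] tendsto_const]) simp
    have eq: "gauss_cov N (?a N) (?b N) =
        (scaled_var N (?a N) + scaled_var N (?b N) - scaled_var N (?b N - ?a N)) / 2" for N
      using ab[of N] by (simp add: gauss_cov_def min_absorb1 min_absorb2 max_absorb2)
    have "(real k / real m + real l / real m - (real l / real m - real k / real m)) / 2 = real k / real m"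
      by simp
    then show ?thesis using lim by (simp only: eq)
  qed
  have sym: "gauss_cov N a b = gauss_cov N b a" for N a b
    by (simp add: gauss_cov_def max.commute min.commute add.commute)
  show ?thesis
  proof (cases "k \<le> l")
    case True
    then show ?thesis using le_case[OF True kl(2)] by simp
  next
    case False
    then show ?thesis using le_case[of l k] kl(1) by (simp add: sym)
  qed
qed

section \<open>The limit for many steps\<close>

text \<open>Trades the maximum over a grid block for its fourth power.\<close>

lemma le_add_fourth_power:
  fixes y e :: real
  assumes "e > 0" "y \<ge> 0"
  shows "y \<le> e + y ^ 4 / e ^ 3"
proof (cases "y \<le> e")
  case True
  have "0 \<le> y ^ 4 / e ^ 3" using assms by simp
  with True show ?thesis by linarith
next
  case False
  have "y * e ^ 3 \<le> y * y ^ 3" using False assms by (intro mult_left_mono power_mono) auto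
  also have "\<dots> = y ^ 4" by (simp add: power_numeral_reduce)
  finally have "y \<le> y ^ 4 / e ^ 3" using assms by (simp add: pos_le_divide_eq)
  then show ?thesis using assms by linarith
qed

text \<open>If \<open>t\<close> lies in block \<open>k\<close> of the coarse grid, its fine index
  lies between the integer parts of the block ends. Rounding can make it hit the right end, so the
  blocks are closed there.\<close>

lemma floor_grid_bounds:
  assumes m: "m > 0" and t: "t \<in> {0..1}"
  defines "k \<equiv> nat \<lfloor>real m * t\<rfloor>"
  shows "N * k div m \<le> nat \<lfloor>real N * t\<rfloor>" "nat \<lfloor>real N * t\<rfloor> \<le> N * Suc k div m"
proof -
  have t0: "0 \<le> real m * t" "0 \<le> real N * t" using t by auto
  have k: "real k \<le> real m * t" "real m * t \<le> real k + 1"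
    unfolding k_def using t0 by (simp_all add: of_nat_nat)
  have d: "real (x div m) \<le> real x / real m" for x by (rule real_nat_div_le)
  have "real (N * k div m) \<le> real N * real k / real m" using d[of "N * k"] by simp
  also have "\<dots> \<le> real N * (real m * t) / real m"
    using k(1) by (intro divide_right_mono mult_left_mono) auto
  also have "\<dots> = real N * t" using m by simp
  finally have "int (N * k div m) \<le> \<lfloor>real N * t\<rfloor>" by (simp add: le_floor_iff)
  then show "N * k div m \<le> nat \<lfloor>real N * t\<rfloor>" by linarith
  have "real (nat \<lfloor>real N * t\<rfloor>) * real m \<le> (real N * t) * real m"
    using t0 by (intro mult_right_mono) (auto simp: of_nat_nat)
  also have "\<dots> = real N * (real m * t)" by simp
  also have "\<dots> \<le> real N * (real k + 1)" using k(2) by (intro mult_left_mono) auto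
  finally have "real (nat \<lfloor>real N * t\<rfloor> * m) \<le> real (N * Suc k)" by (simp add: algebra_simps)
  then have "nat \<lfloor>real N * t\<rfloor> * m \<le> N * Suc k" by (simp only: of_nat_le_iff)
  then show "nat \<lfloor>real N * t\<rfloor> \<le> N * Suc k div m" using m by (simp add: less_eq_div_iff_mult_less_eq)
qed

lemma grid_block_length:
  assumes "m > (0::nat)"
  shows "N * Suc k div m - N * k div m \<le> N div m + 1"
proof -
  have "N * Suc k div m = (N * k + N) div m" by (simp add: add.commute)
  also have "\<dots> \<le> N * k div m + N div m + 1"
    unfolding div_add1_eq[of "N * k" N m]
  proof -
    have "(N * k mod m + N mod m) div m \<le> 1"
    proof -
      have "N * k mod m + N mod m < 2 * m"
        using mod_less_divisor[OF assms, of "N * k"] mod_less_divisor[OF assms, of N] by linarith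
      then have "(N * k mod m + N mod m) div m < 2" by (simp add: less_mult_imp_div_less)
      then show ?thesis by simp
    qed
    then show "N * k div m + N div m + (N * k mod m + N mod m) div m \<le> N * k div m + N div m + 1" by simp
  qed
  finally show ?thesis by linarith
qed

text \<open>The maximal inequality is stated for dyadic lengths; rounding a block length up costs a
  factor 2.\<close>

lemma ex_power2_between: "\<exists>r. n \<le> 2 ^ r \<and> (2::nat) ^ r \<le> 2 * n" if "n \<ge> 1" for n :: nat
  using that
proof (induction n rule: nat_induct_at_least)
  case base
  show ?case by (rule exI[of _ 0]) simp
next
  case (Suc n)
  then obtain r where r: "n \<le> 2 ^ r" "(2::nat) ^ r \<le> 2 * n" by blast
  show ?case
  proof (cases "Suc n \<le> 2 ^ r")
    case True
    with r(2) show ?thesis by (intro exI[of _ r]) auto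
  next
    case False
    with r have "2 ^ r = n" by simp
    then show ?thesis by (intro exI[of _ "Suc r"]) auto
  qed
qed

text \<open>The block \<open>k = m\<close> is included for \<open>t = 1\<close>; for
  \<open>m > 0\<close> it starts at \<open>N\<close>, where the walk is frozen. A sum over the
  blocks bounds each single one and is easy to integrate.\<close>

definition block_osc :: "nat \<Rightarrow> nat \<Rightarrow> ((nat \<Rightarrow> int) \<Rightarrow> real) \<Rightarrow> real" where
  "block_osc m N g = (\<Sum>k<Suc m. max_osc (\<lambda>j g. gauss_walk N g j) (N * k div m) (N * Suc k div m) g)"

lemma grid_mono: "N * k div m \<le> N * Suc k div (m :: nat)"
  by (intro div_le_mono) simp

lemma gauss_walk_diff_fourth:
  "integrable (gauss_measure N) (\<lambda>g. (gauss_walk N g j - gauss_walk N g i) ^ 4)"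
  using gauss_walk_even_moment[of N j i 2] by simp

lemma integrable_block_osc: "integrable (gauss_measure N) (block_osc m N)"
  unfolding block_osc_def[abs_def]
  by (intro Bochner_Integration.integrable_sum integrable_max_osc borel_measurable_gauss_walk
      gauss_walk_diff_fourth grid_mono)

text \<open>The dyadic length is at most 2 (N/m + 1) \<le> 4 N/m, so one block costs 125 * 3 * 4^2 =
  6000 times \<open>var_const^2 / m^2\<close>; the number of blocks, m + 1, is at most 2 m.\<close>

lemma expectation_block_osc_le:
  assumes m: "m > 0" and N: "N \<ge> 2" "N \<ge> m"
  shows "(\<integral>g. block_osc m N g \<partial>gauss_measure N) \<le> 12000 * var_const\<^sup>2 / real m"
proof -
  let ?S = "\<lambda>j g. gauss_walk N g j" and ?C = "3 * (var_const / real N)\<^sup>2"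
  obtain r where r: "N div m + 1 \<le> 2 ^ r" "(2::nat) ^ r \<le> 2 * (N div m + 1)"
    using ex_power2_between[of "N div m + 1"] by auto
  have "real (N div m) \<le> real N / real m" by (rule real_nat_div_le)
  moreover have "1 \<le> real N / real m" using m N by simp
  moreover have "real (2 ^ r) \<le> real (2 * (N div m + 1))" using r(2) by (simp only: of_nat_le_iff)
  ultimately have r4: "(2 :: real) ^ r \<le> 4 * (real N / real m)" by simp
  have block: "(\<integral>g. max_osc ?S (N * k div m) (N * Suc k div m) g \<partial>gauss_measure N) \<le>
      6000 * var_const\<^sup>2 / (real m)\<^sup>2" for k
  proof -
    have "(\<integral>g. max_osc ?S (N * k div m) (N * Suc k div m) g \<partial>gauss_measure N) \<le>
        125 * ?C * (2 ^ r)\<^sup>2"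
      using grid_block_length[OF m, of N k] r(1)
      by (intro expectation_max_osc_le borel_measurable_gauss_walk gauss_walk_diff_fourth
          gauss_walk_fourth_moment N grid_mono) auto
    also have "\<dots> \<le> 125 * ?C * (4 * (real N / real m))\<^sup>2"
      using r4 by (intro mult_left_mono power_mono) auto
    also have "\<dots> = 6000 * var_const\<^sup>2 / (real m)\<^sup>2"
      using m N by (simp add: power_mult_distrib power_divide)
    finally show ?thesis .
  qed
  have "(\<integral>g. block_osc m N g \<partial>gauss_measure N) =
      (\<Sum>k<Suc m. \<integral>g. max_osc ?S (N * k div m) (N * Suc k div m) g \<partial>gauss_measure N)"
    unfolding block_osc_def
    by (intro Bochner_Integration.integral_sum integrable_max_osc borel_measurable_gauss_walk
        gauss_walk_diff_fourth grid_mono)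
  also have "\<dots> \<le> (\<Sum>k<Suc m. 6000 * var_const\<^sup>2 / (real m)\<^sup>2)" by (intro sum_mono block)
  also have "\<dots> = 6000 * var_const\<^sup>2 * (real m + 1) / (real m)\<^sup>2" by (simp add: mult.commute add.commute)
  also have "\<dots> \<le> 6000 * var_const\<^sup>2 * (2 * real m) / (real m)\<^sup>2"
    using m by (intro divide_right_mono mult_left_mono) auto
  also have "\<dots> = 12000 * var_const\<^sup>2 / real m" using m by (simp add: power2_eq_square)
  finally show ?thesis .
qed

definition gauss_grid :: "nat \<Rightarrow> nat \<Rightarrow> ((nat \<Rightarrow> int) \<Rightarrow> real) \<Rightarrow> real \<Rightarrow> real" where
  "gauss_grid m N w = step_path m (\<lambda>k. gauss_walk N w (N * k div m))"

text \<open>At each time the two paths differ by an increment within a single block; its fourth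
  power is at most the oscillation of that block, hence at most the sum over all blocks.\<close>

lemma skorohod_dist_grid_le:
  assumes m: "m > 0" and e: "e > 0"
  shows "skorohod_dist (step_path N (gauss_walk N g)) (gauss_grid m N g)
    \<le> e + block_osc m N g / e ^ 3"
  unfolding gauss_grid_def
proof (rule skorohod_dist_le[OF step_path_cadlag step_path_cadlag])
  let ?o = "\<lambda>k. max_osc (\<lambda>j g. gauss_walk N g j) (N * k div m) (N * Suc k div m) g"
  have o: "?o k \<ge> 0" for k by (intro max_osc_nonneg grid_mono)
  have "block_osc m N g \<ge> 0" unfolding block_osc_def by (intro sum_nonneg o)
  then show "0 \<le> e + block_osc m N g / e ^ 3" using e by simp
  fix t :: real assume t: "t \<in> {0..1}"
  define k where "k = nat \<lfloor>real m * t\<rfloor>"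
  define j where "j = nat \<lfloor>real N * t\<rfloor>"
  have km: "k \<le> m" unfolding k_def by (rule floor_index_le[OF t])
  have j: "N * k div m \<le> j" "j \<le> N * Suc k div m"
    unfolding j_def k_def using floor_grid_bounds[OF m t] by auto
  let ?y = "\<bar>gauss_walk N g j - gauss_walk N g (N * k div m)\<bar>"
  have "?y \<le> e + ?y ^ 4 / e ^ 3" by (rule le_add_fourth_power[OF e]) simp
  also have "?y ^ 4 = (gauss_walk N g j - gauss_walk N g (N * k div m)) ^ 4"
    by (simp add: power_even_abs)
  also have "\<dots> \<le> ?o k" by (rule max_osc_ge[where S="\<lambda>j g. gauss_walk N g j", OF j])
  also have "?o k \<le> block_osc m N g"
    unfolding block_osc_def using km o by (intro member_le_sum) auto
  finally show "\<bar>step_path N (gauss_walk N g) t - step_path m (\<lambda>k. gauss_walk N g (N * k div m)) t\<bar>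
      \<le> e + block_osc m N g / e ^ 3"
    using t e by (simp add: step_path_eq k_def j_def divide_right_mono)
qed

lemma step_path_cong: "(\<And>k. k \<le> N \<Longrightarrow> y k = z k) \<Longrightarrow> step_path N y = step_path N z"
  by (auto simp: step_path_def fun_eq_iff floor_index_le)

section \<open>Limits of integrals of Lipschitz functionals\<close>

context
  fixes g :: "(real \<Rightarrow> real) \<Rightarrow> real" and L K :: real
  assumes L: "L \<ge> 0"
    and lip: "\<And>x y. x \<in> cadlag \<Longrightarrow> y \<in> cadlag \<Longrightarrow> \<bar>g x - g y\<bar> \<le> L * skorohod_dist x y"
    and bounded: "\<And>x. x \<in> cadlag \<Longrightarrow> \<bar>g x\<bar> \<le> K"
begin

lemma borel_measurable_lipschitz: "g \<in> borel_measurable (borel_of skorohod_topology)"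
  by (intro continuous_map_measurable_borel_of lipschitz_imp_continuous_map_skorohod[where L=L] lip)

lemma continuous_on_step_path: "continuous_on UNIV (\<lambda>y. g (step_path m y))"
  unfolding continuous_on_def
proof
  fix y :: "nat \<Rightarrow> real"
  show "((\<lambda>y. g (step_path m y)) \<longlongrightarrow> g (step_path m y)) (at y)"
  proof (rule tendstoI)
    fix e :: real assume e: "e > 0"
    have "eventually (\<lambda>z. skorohod_dist (step_path m y) (step_path m z) < e / (L + 1)) (nhds y)"
      using e L by (intro eventually_step_path_close) auto
    then have "eventually (\<lambda>z. dist (g (step_path m z)) (g (step_path m y)) < e) (nhds y)"
    proof eventually_elim
      case (elim z)
      have "\<bar>g (step_path m y) - g (step_path m z)\<bar> \<le> L * skorohod_dist (step_path m y) (step_path m z)"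
        by (intro lip step_path_cadlag)
      also have "\<dots> \<le> (L + 1) * skorohod_dist (step_path m y) (step_path m z)"
        by (intro mult_right_mono) auto
      also have "\<dots> < e" using elim L by (simp add: pos_less_divide_eq mult.commute)
      finally show ?case by (simp add: dist_real_def abs_minus_commute)
    qed
    then show "eventually (\<lambda>z. dist (g (step_path m z)) (g (step_path m y)) < e) (at y)"
      unfolding eventually_at_filter by eventually_elim simp
  qed
qed

lemma borel_measurable_step_functional:
  assumes "\<And>k. (\<lambda>\<omega>. V \<omega> k) \<in> borel_measurable M"
  shows "(\<lambda>\<omega>. g (step_path m (V \<omega>))) \<in> borel_measurable M"
  by (rule measurable_compose[OF borel_measurable_sequence[of V, OF assms]
      measurable_compose[OF measurable_step_path borel_measurable_lipschitz]])

lemma grid_approximation: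
  assumes m: "m > 0" and N: "N \<ge> 2" "N \<ge> m" and e: "e > 0"
  shows "\<bar>(\<integral>x. g x \<partial>gauss_law N) -
      (\<integral>w. g (gauss_grid m N w) \<partial>gauss_measure N)\<bar>
    \<le> L * (e + 12000 * var_const\<^sup>2 / real m / e ^ 3)"
proof -
  interpret prob_space "gauss_measure N" by (rule prob_space_gauss_space)
  let ?A = "\<lambda>w. g (step_path N (gauss_walk N w))"
    and ?B = "\<lambda>w. g (gauss_grid m N w)"
  have i: "integrable (gauss_measure N) ?A" "integrable (gauss_measure N) ?B"
    unfolding gauss_grid_def
    by (intro integrable_const_bound[of _ K] borel_measurable_step_functional
        borel_measurable_gauss_walk AE_I2; simp add: bounded step_path_cadlag)+
  have "(\<integral>x. g x \<partial>gauss_law N) = (\<integral>w. ?A w \<partial>gauss_measure N)"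
    unfolding gauss_law_def by (rule integral_distr[OF measurable_gauss_path borel_measurable_lipschitz])
  then have "\<bar>(\<integral>x. g x \<partial>gauss_law N) - (\<integral>w. ?B w \<partial>gauss_measure N)\<bar> =
      \<bar>\<integral>w. ?A w - ?B w \<partial>gauss_measure N\<bar>" using i by simp
  also have "\<dots> \<le> (\<integral>w. \<bar>?A w - ?B w\<bar> \<partial>gauss_measure N)" by (rule integral_abs_bound)
  also have "\<dots> \<le> (\<integral>w. L * (e + block_osc m N w / e ^ 3) \<partial>gauss_measure N)"
  proof (rule integral_mono)
    show "\<bar>?A w - ?B w\<bar> \<le> L * (e + block_osc m N w / e ^ 3)" for w
      using lip[OF step_path_cadlag step_path_cadlag] skorohod_dist_grid_le[OF m e] L
      unfolding gauss_grid_def by (rule order_trans[OF _ mult_left_mono])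
    show "integrable (gauss_measure N) (\<lambda>w. L * (e + block_osc m N w / e ^ 3))"
      using integrable_block_osc by (intro integrable_mult_right Bochner_Integration.integrable_add
          integrable_divide_zero) auto
  qed (use i in simp)
  also have "\<dots> = L * (e + (\<integral>w. block_osc m N w \<partial>gauss_measure N) / e ^ 3)"
    using integrable_block_osc by (simp add: prob_space)
  also have "\<dots> \<le> L * (e + 12000 * var_const\<^sup>2 / real m / e ^ 3)"
    using L e by (intro mult_left_mono add_left_mono divide_right_mono expectation_block_osc_le m N) auto
  finally show ?thesis .
qed

lemma grid_limit:
  assumes bm: "brownian_motion M' B" and m: "m > 0"
  shows "(\<lambda>N. \<integral>w. g (gauss_grid m N w) \<partial>gauss_measure N)
    \<longlonglongrightarrow> (\<integral>\<omega>. g (path_grid B m \<omega>) \<partial>M')"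
proof -
  define V where "V N w k = (if k < Suc m then gauss_walk N w (N * k div m) else 0)" for N w k
  define W where "W \<omega> k = (if k < Suc m then B (real k / real m) \<omega> else 0)" for \<omega> k
  have grid: "real k / real m \<in> {0..1}" if "k < Suc m" for k using m that by simp
  \<comment> \<open>One constant has to bound the second moments on both sides; those of Brownian
    motion on the unit interval are at most 1.\<close>
  have vc: "1 \<le> var_const" by (simp add: var_const_def)
  have "(\<lambda>N. \<integral>w. g (step_path m (V N w)) \<partial>gauss_measure N) \<longlonglongrightarrow> (\<integral>\<omega>. g (step_path m (W \<omega>)) \<partial>M')"
  proof (rule multivariate_levy_continuity[where d="Suc m" and C=var_const and K=K and V=V and W=W
          and f="\<lambda>y. g (step_path m y)",
        OF prob_space_gauss_space brownian_prob_space[OF bm]])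
    show "(\<lambda>w. V N w k) \<in> borel_measurable (gauss_measure N)" for N k
      unfolding V_def using borel_measurable_gauss_walk by (cases "k < Suc m") simp_all
    show "V N w k = 0" if "Suc m \<le> k" for N w k using that by (simp add: V_def)
    show "integrable (gauss_measure N) (\<lambda>w. (V N w k)\<^sup>2)" for N k
      unfolding V_def using gauss_walk_second_moment(1) by (cases "k < Suc m") simp_all
    show "(\<integral>w. (V N w k)\<^sup>2 \<partial>gauss_measure N) \<le> var_const" for N k
      unfolding V_def using gauss_walk_second_moment(2) scaled_var_le_const vc by (cases "k < Suc m") simp_all
    show "(\<lambda>\<omega>. W \<omega> k) \<in> borel_measurable M'" for k
      unfolding W_def using borel_measurable_brownian[OF bm grid] by (cases "k < Suc m") simp_all
    show "W \<omega> k = 0" if "Suc m \<le> k" for \<omega> k using that by (simp add: W_def)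
    show "integrable M' (\<lambda>\<omega>. (W \<omega> k)\<^sup>2)" for k
      unfolding W_def using brownian_second_moment(1)[OF bm grid] by (cases "k < Suc m") simp_all
    show "(\<integral>\<omega>. (W \<omega> k)\<^sup>2 \<partial>M') \<le> var_const" for k
    proof (cases "k < Suc m")
      case True
      have "real k / real m \<le> 1" using grid[OF True] by simp
      then show ?thesis
        unfolding W_def if_P[OF True] brownian_second_moment(2)[OF bm grid[OF True]] using vc by linarith
    next
      case False
      then show ?thesis using vc by (simp add: W_def)
    qed
    show "continuous_on UNIV (\<lambda>y. g (step_path m y))" by (rule continuous_on_step_path)
    show "\<bar>g (step_path m y)\<bar> \<le> K" for y by (rule bounded[OF step_path_cadlag])
    fix u :: "nat \<Rightarrow> real"
    have Veq: "(\<Sum>k<Suc m. u k * V N w k) = (\<Sum>k<Suc m. u k * gauss_walk N w (N * k div m))" for N w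
      by (intro sum.cong) (auto simp: V_def)
    have Weq: "(\<Sum>k<Suc m. u k * W \<omega> k) = (\<Sum>k<Suc m. u k * B (real k / real m) \<omega>)" for \<omega>
      by (intro sum.cong) (auto simp: W_def)
    have "(\<lambda>N. exp (- (\<Sum>k<Suc m. \<Sum>l<Suc m. u k * u l * gauss_cov N (N * k div m) (N * l div m)) / 2))
      \<longlonglongrightarrow> exp (- (\<Sum>k<Suc m. \<Sum>l<Suc m. u k * u l * (real (min k l) / real m)) / 2)"
    proof -
      have "(\<lambda>N. \<Sum>k<Suc m. \<Sum>l<Suc m. u k * u l * gauss_cov N (N * k div m) (N * l div m))
        \<longlonglongrightarrow> (\<Sum>k<Suc m. \<Sum>l<Suc m. u k * u l * (real (min k l) / real m))"
      proof (intro tendsto_sum)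
        fix k l assume "k \<in> {..<Suc m}" "l \<in> {..<Suc m}"
        then show "(\<lambda>N. u k * u l * gauss_cov N (N * k div m) (N * l div m))
          \<longlonglongrightarrow> u k * u l * (real (min k l) / real m)"
          by (intro tendsto_mult[OF tendsto_const] gauss_cov_tendsto m) auto
      qed
      then show ?thesis by (rule tendsto_exp[OF tendsto_divide[OF tendsto_minus tendsto_const]]) simp
    qed
    then show "(\<lambda>N. char (distr (gauss_measure N) borel (\<lambda>w. \<Sum>k<Suc m. u k * V N w k)) 1)
      \<longlonglongrightarrow> char (distr M' borel (\<lambda>\<omega>. \<Sum>k<Suc m. u k * W \<omega> k)) 1"
      unfolding Veq Weq char_gauss_walk char_brownian_grid[OF bm m] by (rule tendsto_of_real)
  qed
  moreover have "step_path m (V N w) = gauss_grid m N w" for N w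
    unfolding gauss_grid_def by (rule step_path_cong) (simp add: V_def)
  moreover have "step_path m (W \<omega>) = path_grid B m \<omega>" for \<omega>
    unfolding path_grid_def using m by (intro step_path_cong) (simp add: W_def min_absorb2)
  ultimately show ?thesis by (simp only:)
qed

text \<open>Comparison through the grid: Gaussian path to its grid path, grid path to Brownian grid
  path, and from there to the Brownian path, each within \<open>r / 4\<close>. The order of choice
  is \<open>e\<close>, then \<open>m\<close>, then \<open>N\<close>, because the first estimate is
  uniform in large \<open>N\<close>.\<close>

lemma gauss_law_lipschitz_limit:
  assumes bm: "brownian_motion M' B"
  shows "(\<lambda>N. \<integral>x. g x \<partial>gauss_law N) \<longlonglongrightarrow> (\<integral>x. g x \<partial>path_law M' B)"
proof (rule LIMSEQ_I)
  fix r :: real assume r: "r > 0"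
  interpret prob_space M' by (rule brownian_prob_space[OF bm])
  let ?D = "\<integral>\<omega>. g (random_path B \<omega>) \<partial>M'"
    and ?Dm = "\<lambda>m. \<integral>\<omega>. g (path_grid B m \<omega>) \<partial>M'"
    and ?Am = "\<lambda>m N. \<integral>w. g (gauss_grid m N w) \<partial>gauss_measure N"
  have cad: "random_path B \<omega> \<in> cadlag" if "\<omega> \<in> space M'" for \<omega>
    by (rule random_path_cadlag[where B=B, OF brownian_continuous[OF bm that]])
  have D: "(\<integral>x. g x \<partial>path_law M' B) = ?D"
    unfolding path_law_def by (rule integral_distr[OF measurable_brownian_path[OF bm] borel_measurable_lipschitz])
  have "?Dm \<longlonglongrightarrow> ?D"
  proof (rule integral_dominated_convergence[where w="\<lambda>_. K"])
    show "(\<lambda>\<omega>. g (random_path B \<omega>)) \<in> borel_measurable M'"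
      by (rule measurable_compose[OF measurable_brownian_path[OF bm] borel_measurable_lipschitz])
    show "(\<lambda>\<omega>. g (path_grid B m \<omega>)) \<in> borel_measurable M'" for m
      by (rule measurable_compose[OF measurable_brownian_step[OF bm] borel_measurable_lipschitz])
    show "AE \<omega> in M'. (\<lambda>m. g (path_grid B m \<omega>)) \<longlonglongrightarrow> g (random_path B \<omega>)"
    proof (rule AE_I2)
      fix \<omega> assume \<omega>: "\<omega> \<in> space M'"
      have "(\<lambda>m. L * skorohod_dist (path_grid B m \<omega>) (random_path B \<omega>)) \<longlonglongrightarrow> L * 0"
        by (intro tendsto_mult[OF tendsto_const] path_grid_approximates_continuous brownian_continuous[OF bm \<omega>])
      then have "(\<lambda>m. L * skorohod_dist (path_grid B m \<omega>) (random_path B \<omega>)) \<longlonglongrightarrow> 0" by simp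
      then have "(\<lambda>m. g (path_grid B m \<omega>) - g (random_path B \<omega>)) \<longlonglongrightarrow> 0"
        by (rule Lim_null_comparison[rotated]) (simp add: lip path_grid_cadlag cad[OF \<omega>])
      then show "(\<lambda>m. g (path_grid B m \<omega>)) \<longlonglongrightarrow> g (random_path B \<omega>)"
        by (rule LIM_zero_cancel)
    qed
    show "AE \<omega> in M'. norm (g (path_grid B m \<omega>)) \<le> K" for m
      by (simp add: bounded path_grid_cadlag)
  qed simp
  then have "eventually (\<lambda>m. dist (?Dm m) ?D < r / 4) sequentially"
    by (rule tendstoD) (use r in simp)
  \<comment> \<open>Half of the budget \<open>r / 4\<close> of the grid approximation goes to
    \<open>L * e\<close>, the other half to the oscillation term; \<open>L + 1\<close> avoids a
    division by zero.\<close>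
  moreover define e where "e = r / (8 * (L + 1))"
  have e: "e > 0" using r L by (simp add: e_def)
  have Le: "L * e \<le> r / 8"
  proof -
    have "L * e \<le> (L + 1) * e" using e by (intro mult_right_mono) auto
    also have "\<dots> = r / 8"
    proof -
      have "L + 1 \<noteq> 0" using L by simp
      then show ?thesis by (simp add: e_def field_simps)
    qed
    finally show ?thesis .
  qed
  moreover have "(\<lambda>m. L * (12000 * var_const\<^sup>2 / e ^ 3) * (1 / real m)) \<longlonglongrightarrow> L * (12000 * var_const\<^sup>2 / e ^ 3) * 0"
    by (intro tendsto_mult tendsto_const lim_1_over_n)
  then have "eventually (\<lambda>m. L * (12000 * var_const\<^sup>2 / e ^ 3) * (1 / real m) < r / 8) sequentially"
    by (rule order_tendstoD) (use r in simp)
  moreover have "eventually (\<lambda>m. m > (0::nat)) sequentially" by (rule eventually_gt_at_top)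
  ultimately have "eventually (\<lambda>m. dist (?Dm m) ?D < r / 4 \<and>
      L * (12000 * var_const\<^sup>2 / e ^ 3) * (1 / real m) < r / 8 \<and> m > 0) sequentially"
    by (intro eventually_conj) 
  then obtain m where m: "dist (?Dm m) ?D < r / 4"
    "L * (12000 * var_const\<^sup>2 / e ^ 3) * (1 / real m) < r / 8" "m > 0"
    using eventually_happens'[OF sequentially_bot] by blast
  have "eventually (\<lambda>N. dist (?Am m N) (?Dm m) < r / 4) sequentially"
    by (rule tendstoD[OF grid_limit[OF bm m(3)]]) (use r in simp)
  then obtain n0 where n0: "\<And>N. N \<ge> n0 \<Longrightarrow> dist (?Am m N) (?Dm m) < r / 4"
    unfolding eventually_sequentially by blast
  show "\<exists>no. \<forall>N\<ge>no. norm ((\<integral>x. g x \<partial>gauss_law N) - (\<integral>x. g x \<partial>path_law M' B)) < r"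
  proof (intro exI[of _ "max n0 (max 2 m)"] allI impI)
    fix N assume N: "N \<ge> max n0 (max 2 m)"
    have "\<bar>(\<integral>x. g x \<partial>gauss_law N) - ?Am m N\<bar> \<le> L * (e + 12000 * var_const\<^sup>2 / real m / e ^ 3)"
      by (rule grid_approximation[OF m(3) _ _ e]) (use N in auto)
    also have "\<dots> = L * e + L * (12000 * var_const\<^sup>2 / e ^ 3) * (1 / real m)"
      by (simp add: distrib_left mult.commute)
    also have "\<dots> < r / 4" using Le m(2) by linarith
    finally have "\<bar>(\<integral>x. g x \<partial>gauss_law N) - ?Am m N\<bar> < r / 4" .
    moreover have "\<bar>?Am m N - ?Dm m\<bar> < r / 4" using n0[of N] N by (simp add: dist_real_def)
    moreover have "\<bar>?Dm m - ?D\<bar> < r / 4" using m(1) by (simp add: dist_real_def)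
    ultimately show "norm ((\<integral>x. g x \<partial>gauss_law N) - (\<integral>x. g x \<partial>path_law M' B)) < r"
      using r unfolding D real_norm_def by linarith
  qed
qed

end

theorem theorem2:
  fixes M :: "'a measure" and X :: "nat \<Rightarrow> 'a \<Rightarrow> nat \<Rightarrow> int"
    and M' :: "'b measure" and B :: "real \<Rightarrow> 'b \<Rightarrow> real"
  assumes "prob_space M"
    and "prob_space.indep_vars M (\<lambda>_. walk_space) X {1..}"
    and "\<And>i. i \<ge> 1 \<Longrightarrow> distr M walk_space (X i) = annealed_law \<mu>_half"
    and "brownian_motion M' B"
  shows "\<exists>Z :: nat \<Rightarrow> (real \<Rightarrow> real) measure.
    (\<forall>N\<ge>2. prob_space (Z N) \<and> sets (Z N) = sets (borel_of skorohod_topology) \<and>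
       fdd_converges {0..1} M (rescaled_sum X N) (Z N) (\<lambda>t z. z t)) \<and>
    weakly_converges skorohod_topology Z (path_law M' B)"
proof (intro exI[of _ gauss_law] conjI allI impI)
  show "prob_space (gauss_law N)" for N by (rule prob_space_gauss_law)
  show "sets (gauss_law N) = sets (borel_of skorohod_topology)" for N by simp
  show "fdd_converges {0..1} M (rescaled_sum X N) (gauss_law N) (\<lambda>t z. z t)" if "N \<ge> 2" for N
    using assms(1-3) that by (rule fdd_converges_gauss_law)
  \<comment> \<open>The sequence is one of probability measures from index 0 on: for
    \<open>N < 2\<close> the scale is 0 and the law sits on the zero path.\<close>
  show "weakly_converges skorohod_topology gauss_law (path_law M' B)"
    by (rule weakly_converges_lipschitzI[OF prob_space_gauss_law sets_gauss_law
          prob_space_path_law[OF assms(4)]])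
       (auto simp: path_law_def intro: gauss_law_lipschitz_limit[OF _ _ _ assms(4), unfolded path_law_def])
qed

end
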